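(* Let $d=2$, let $\mathbb{P}$ be an admissible measure on $\Omega$ and let $D$ be the effective diffusion tensor. Then $$\det(D)=\frac{1}{Z^2}.$$ Consequently, if $\lambda_1\le\lambda_2$ are the eigenvalues of $D$, then $$\frac1{Z^2}\le\lambda_1\le\frac1Z\le\lambda_2\le1.$$ In particular, if $D$ is isotropic (i.e. a scalar multiple of the identity), then $D=\frac1Z\mathbf{I}$.
   Context: Setting (here $d=2$). Let $\Omega=C^3(\mathbb{R}^d;\mathbb{R})$ with the Fréchet metric generated by the seminorms $\|f\|_N=\sup_{|x|\le N}\sum_{k\le3}|\nabla^kf(x)|$, $N\in\mathbb{N}$ (a Polish space). For $x\in\mathbb{R}^d$ let $\tau_x:\Omega\to\Omega$, $\tau_xh=h(\cdot+x)$. A Borel probability measure $\mathbb{P}$ on $\Omega$ is called admissible if: (stationarity) $\mathbb{P}(\tau_x^{-1}(B))=\mathbb{P}(B)$ for all Borel $B$ and all $x$; (ergodicity) if $B$ is Borel and $\tau_x(B)=B$ for all $x$, then $\mathbb{P}(B)\in\{0,1\}$; (stochastic continuity) for all $\delta>0$, the $\mathbb{P}$-probability that the distance between $\tau_xh$ and $h$ exceeds $\delta$ tends to $0$ as $x\to0$; (boundedness) there is a constant $K>0$ such that for $\mathbb{P}$-a.e. $h$, $|\nabla h(x)|+|\nabla\nabla h(x)|\le K$ for all $x\in\mathbb{R}^d$. Coefficients. For $h\in\Omega$: $g(x,h)=I+\nabla h(x)\otimes\nabla h(x)$, $|g|=\det g$, $F(x,h)=\frac{1}{\sqrt{|g|(x,h)}}\nabla_x\cdot\big(\sqrt{|g|(x,h)}\,g^{-1}(x,h)\big)$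 (row-wise divergence). Write $g(h)=g(0,h)$, $F(h)=F(0,h)$. Set $Z=\int_\Omega\sqrt{|g|(h)}\,\mathbb{P}(dh)$ (average surface area) and $\pi(dh)=\frac{\sqrt{|g|(h)}}{Z}\mathbb{P}(dh)$. Stochastic derivatives. $D_i$ denotes the $L^2(\mathbb{P})$-generator of translations in direction $e_i$: $D_iV(h)=\frac{d}{d\lambda}V(\tau_{\lambda e_i}h)|_{\lambda=0}$ in $L^2(\mathbb{P})$. $\mathbb{D}V=(D_iV)_{i=1}^d$ and $\mathbb{D}\cdot\mathbf V=\sum_iD_iV_i$. $C^k_b(\Omega)$ is the space of bounded measurable $f:\Omega\to\mathbb{R}$ such that $x\mapsto f(\tau_xh)$ is $C^k$ with derivatives up to order $k$ bounded by deterministic constants. $\mathcal{L}$ is the unique self-adjoint extension in $L^2(\pi)$ of $\hat{\mathcal L}f=\frac{1}{\sqrt{|g|(h)}}\mathbb{D}\cdot(\sqrt{|g|(h)}g^{-1}(h)\mathbb{D}f)$, $f\in C_b^2(\Omega)$. Space $\mathcal{H}_1$. $\mathcal{H}_1$ is the completion of $\{\phi\in C_b^2(\Omega):\int\phi\,d\pi=0\}$ under $\|\phi\|_1^2=\langle(-\mathcal L)\phi,\phi\rangle_{L^2(\pi)}=\frac1Z\int_\Omega\mathbb{D}\phi\cdot g^{-1}\mathbb{D}\phi\sqrt{|g|}\,d\mathbb{P}$. Since $g$ is uniformly elliptic and bounded, $\mathbb{D}$ extends continuously to $\mathbb{D}:\mathcal{H}_1\to(L^2(\mathbb{P}))^d$.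 Correctors and effective tensor. For $e\in\mathbb{R}^d$ put $F^e=F\cdot e$, and for $\lambda>0$ let $\chi^e_\lambda\in L^2(\pi)$ solve $(\lambda I-\mathcal L)\chi^e_\lambda=F^e$. It is known that $\chi^e_\lambda$ converges in $\mathcal{H}_1$ as $\lambda\to0$; the limit is denoted $\chi^e$. $\chi=(\chi^{e_i})_{i=1}^d$, $(\mathbb{D}\chi)_{ij}=D_j\chi^{e_i}$, and the effective diffusion tensor is $$D=\frac1Z\int_\Omega(I+\mathbb{D}\chi(h))\,g^{-1}(h)\,(I+\mathbb{D}\chi(h))^\top\sqrt{|g|(h)}\,\mathbb{P}(dh).$$ *)

theory Defs
  imports "HOL-Probability.Probability"
begin

section \<open>Functions of class C^k on Euclidean space\<close>

definition partial :: "'n::finite \<Rightarrow> (real^'n \<Rightarrow> real) \<Rightarrow> real^'n \<Rightarrow> real" where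
  "partial i f x = deriv (\<lambda>t. f (x + t *\<^sub>R axis i 1)) 0"

fun partials :: "'n::finite list \<Rightarrow> (real^'n \<Rightarrow> real) \<Rightarrow> real^'n \<Rightarrow> real" where
  "partials [] f = f"
| "partials (i # is) f = partials is (partial i f)"

fun Ck :: "nat \<Rightarrow> (real^'n::finite \<Rightarrow> real) \<Rightarrow> bool" where
  "Ck 0 f \<longleftrightarrow> continuous_on UNIV f"
| "Ck (Suc k) f \<longleftrightarrow> (\<forall>x. f differentiable (at x)) \<and> (\<forall>i. Ck k (partial i f))"

text \<open>Euclidean norm of the tensor of all partial derivatives of order \<open>k\<close>; for \<open>k = 0\<close> it
  is the absolute value of \<open>f x\<close>.\<close>
definition tensor_norm :: "nat \<Rightarrow> (real^'n::finite \<Rightarrow> real) \<Rightarrow> real^'n \<Rightarrow> real" where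
  "tensor_norm k f x = L2_set (\<lambda>is. partials is f x) {is. length is = k}"

lemma Ck_continuous: "Ck k f \<Longrightarrow> continuous_on UNIV f"
  by (cases k) (auto simp: continuous_at_imp_continuous_on differentiable_imp_continuous_within)

lemma partial_diff:
  fixes f g :: "real^'n::finite \<Rightarrow> real"
  assumes "f differentiable (at x)" "g differentiable (at x)"
  shows "partial i (\<lambda>x. f x - g x) x = partial i f x - partial i g x"
proof -
  have *: "(\<lambda>t. f (x + t *\<^sub>R axis i 1)) field_differentiable (at 0)"
    if f: "f differentiable (at x)" for f
  proof -
    have "(\<lambda>t::real. x + t *\<^sub>R axis i 1) differentiable (at 0)"
      by (intro derivative_intros)
    then have "(f \<circ> (\<lambda>t::real. x + t *\<^sub>R axis i 1)) differentiable (at 0)"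
      using f by (intro differentiable_chain_at) auto
    then show ?thesis
      by (simp add: o_def field_differentiable_def real_differentiable_def)
  qed
  show ?thesis
    unfolding partial_def using *[OF assms(1)] *[OF assms(2)] by (rule deriv_diff)
qed

lemma partials_diff:
  assumes "Ck k f" "Ck k g" "length is \<le> k"
  shows "partials is (\<lambda>x. f x - g x) = (\<lambda>x. partials is f x - partials is g x)"
  using assms
proof (induction "is" arbitrary: f g k)
  case (Cons i "is")
  then obtain k' where k: "k = Suc k'" by (cases k) auto
  have "partial i (\<lambda>x. f x - g x) = (\<lambda>x. partial i f x - partial i g x)"
    using Cons.prems k by (auto intro!: ext partial_diff)
  then show ?case using Cons.prems k Cons.IH[of k' "partial i f" "partial i g"] by simp
qed simp

lemma Ck_diff: "Ck k f \<Longrightarrow> Ck k g \<Longrightarrow> Ck k (\<lambda>x. f x - g x)"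
proof (induction k arbitrary: f g)
  case (Suc k)
  have "partial i (\<lambda>x. f x - g x) = (\<lambda>x. partial i f x - partial i g x)" for i
    using Suc.prems by (auto intro!: ext partial_diff)
  then show ?case using Suc by auto
qed (auto intro: continuous_on_diff)

lemma partials_continuous: "Ck k f \<Longrightarrow> length is \<le> k \<Longrightarrow> continuous_on UNIV (partials is f)"
proof (induction "is" arbitrary: f k)
  case Nil
  then show ?case by (simp add: Ck_continuous)
next
  case (Cons i "is")
  then show ?case by (cases k) auto
qed

lemma tensor_norm_0: "tensor_norm 0 f x = \<bar>f x\<bar>"
  by (simp add: tensor_norm_def L2_set_def)

lemma tensor_norm_nonneg: "tensor_norm k f x \<ge> 0"
  by (simp add: tensor_norm_def L2_set_nonneg)

lemma finite_lists_length: "finite {is :: 'n::finite list. length is = k}"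
  using finite_lists_length_eq[of "UNIV :: 'n set" k] by simp


section \<open>The space of surfaces\<close>

definition Omega :: "(real^'n::finite \<Rightarrow> real) set" where
  "Omega = {h. Ck 3 h}"

definition seminorm_N :: "nat \<Rightarrow> (real^'n::finite \<Rightarrow> real) \<Rightarrow> real" where
  "seminorm_N N f = (SUP x\<in>cball 0 (real N). \<Sum>k\<le>3. tensor_norm k f x)"

text \<open>The value 0 outside \<open>Omega\<close> is needed because the locale \<open>Metric_space\<close> asks for symmetry and
  nonnegativity on the whole type.\<close>
definition frechet_dist :: "(real^'n::finite \<Rightarrow> real) \<Rightarrow> (real^'n \<Rightarrow> real) \<Rightarrow> real" where
  "frechet_dist f g =
     (if f \<in> Omega \<and> g \<in> Omega
      then \<Sum>N. (1/2) ^ N * (seminorm_N N (\<lambda>x. f x - g x) / (1 + seminorm_N N (\<lambda>x. f x - g x)))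
      else 0)"

lemma tensor_norm_continuous:
  assumes "Ck m f" "k \<le> m"
  shows "continuous_on UNIV (tensor_norm k f)"
  unfolding tensor_norm_def[abs_def] L2_set_def
  using assms by (intro continuous_intros partials_continuous[of m]) auto

lemma tensor_norm_triangle:
  assumes "Ck m f" "Ck m g" "Ck m h" "k \<le> m"
  shows "tensor_norm k (\<lambda>x. f x - h x) x
     \<le> tensor_norm k (\<lambda>x. f x - g x) x + tensor_norm k (\<lambda>x. g x - h x) x"
proof -
  let ?I = "{is :: 'a list. length is = k}"
  have "tensor_norm k (\<lambda>x. f x - h x) x
      = L2_set (\<lambda>is. partials is (\<lambda>x. f x - g x) x + partials is (\<lambda>x. g x - h x) x) ?I"
    unfolding tensor_norm_def
    by (rule L2_set_cong) (use assms in \<open>auto simp: partials_diff[of m]\<close>)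
  then show ?thesis by (simp add: tensor_norm_def L2_set_triangle_ineq)
qed

lemma tensor_norm_commute:
  assumes "Ck m f" "Ck m g" "k \<le> m"
  shows "tensor_norm k (\<lambda>x. f x - g x) x = tensor_norm k (\<lambda>x. g x - f x) x"
  unfolding tensor_norm_def L2_set_def
  using assms by (simp add: partials_diff[of m] power2_commute)

lemma seminorm_bdd:
  assumes "Ck 3 f"
  shows "bdd_above ((\<lambda>x. \<Sum>k\<le>3. tensor_norm k f x) ` cball 0 (real N))"
proof -
  have "continuous_on (cball 0 (real N)) (\<lambda>x. \<Sum>k\<le>3. tensor_norm k f x)"
    using assms
    by (intro continuous_intros continuous_on_subset[OF tensor_norm_continuous[of 3]]) auto
  then show ?thesis
    by (intro bounded_imp_bdd_above compact_imp_bounded compact_continuous_image) auto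
qed

lemma seminorm_upper:
  assumes "Ck 3 f" "norm x \<le> real N"
  shows "(\<Sum>k\<le>3. tensor_norm k f x) \<le> seminorm_N N f"
  unfolding seminorm_N_def using assms by (intro cSUP_upper seminorm_bdd) auto

lemma seminorm_nonneg:
  assumes "Ck 3 f"
  shows "seminorm_N N f \<ge> 0"
proof -
  have "0 \<le> (\<Sum>k\<le>3. tensor_norm k f 0)" by (simp add: sum_nonneg tensor_norm_nonneg)
  also have "\<dots> \<le> seminorm_N N f" using assms by (intro seminorm_upper) auto
  finally show ?thesis .
qed

lemma seminorm_triangle:
  assumes "Ck 3 f" "Ck 3 g" "Ck 3 h"
  shows "seminorm_N N (\<lambda>x. f x - h x)
     \<le> seminorm_N N (\<lambda>x. f x - g x) + seminorm_N N (\<lambda>x. g x - h x)"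
  unfolding seminorm_N_def[of N "\<lambda>x. f x - h x"]
proof (rule cSUP_least)
  fix x :: "real^'a" assume "x \<in> cball 0 (real N)"
  then have x: "norm x \<le> real N" by simp
  have "(\<Sum>k\<le>3. tensor_norm k (\<lambda>x. f x - h x) x)
      \<le> (\<Sum>k\<le>3. tensor_norm k (\<lambda>x. f x - g x) x + tensor_norm k (\<lambda>x. g x - h x) x)"
    using assms by (intro sum_mono tensor_norm_triangle[of 3]) auto
  also have "\<dots> = (\<Sum>k\<le>3. tensor_norm k (\<lambda>x. f x - g x) x)
      + (\<Sum>k\<le>3. tensor_norm k (\<lambda>x. g x - h x) x)"
    by (rule sum.distrib)
  also have "\<dots> \<le> seminorm_N N (\<lambda>x. f x - g x) + seminorm_N N (\<lambda>x. g x - h x)"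
    using assms x by (intro add_mono seminorm_upper Ck_diff) auto
  finally show "(\<Sum>k\<le>3. tensor_norm k (\<lambda>x. f x - h x) x)
      \<le> seminorm_N N (\<lambda>x. f x - g x) + seminorm_N N (\<lambda>x. g x - h x)" .
qed auto

lemma seminorm_commute:
  assumes "Ck 3 f" "Ck 3 g"
  shows "seminorm_N N (\<lambda>x. f x - g x) = seminorm_N N (\<lambda>x. g x - f x)"
  unfolding seminorm_N_def
  using assms by (intro SUP_cong sum.cong tensor_norm_commute[of 3]) auto

lemma frechet_summable:
  assumes "Ck 3 f"
  shows "summable (\<lambda>N. (1/2::real) ^ N * (seminorm_N N f / (1 + seminorm_N N f)))"
proof (rule summable_comparison_test)
  show "summable (\<lambda>N. (1/2::real) ^ N)" by (simp add: summable_geometric)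
  have "norm ((1/2::real) ^ n * (seminorm_N n f / (1 + seminorm_N n f))) \<le> (1/2) ^ n" for n
  proof -
    have "0 \<le> seminorm_N n f / (1 + seminorm_N n f)" "seminorm_N n f / (1 + seminorm_N n f) \<le> 1"
      using seminorm_nonneg[OF assms, of n] by auto
    moreover have "(1/2::real) ^ n * t \<le> (1/2) ^ n" "0 \<le> (1/2::real) ^ n * t" if "0 \<le> t" "t \<le> 1" for t
      using that by (simp_all add: mult_left_le)
    ultimately show ?thesis unfolding real_norm_def by (metis abs_of_nonneg)
  qed
  then show "\<exists>M. \<forall>n\<ge>M. norm ((1/2::real) ^ n * (seminorm_N n f / (1 + seminorm_N n f))) \<le> (1/2) ^ n"
    by blast
qed

lemma quotient_triangle:
  fixes a b c :: real
  assumes "0 \<le> a" "0 \<le> b" "0 \<le> c" "a \<le> b + c"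
  shows "a / (1 + a) \<le> b / (1 + b) + c / (1 + c)"
proof -
  have "a / (1 + a) \<le> (b + c) / (1 + (b + c))"
    using assms by (simp add: divide_simps) (simp add: algebra_simps)
  also have "\<dots> = b / (1 + (b + c)) + c / (1 + (b + c))" by (rule add_divide_distrib)
  also have "\<dots> \<le> b / (1 + b) + c / (1 + c)"
    using assms by (intro add_mono divide_left_mono) auto
  finally show ?thesis .
qed

lemma Metric_space_Omega: "Metric_space Omega frechet_dist"
proof
  fix f g h :: "real^'n \<Rightarrow> real"
  let ?q = "\<lambda>f g N. (1/2::real) ^ N *
    (seminorm_N N (\<lambda>x. f x - g x) / (1 + seminorm_N N (\<lambda>x. f x - g x)))"
  have nn: "0 \<le> seminorm_N N (\<lambda>x. f x - g x)" if "f \<in> Omega" "g \<in> Omega"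
    for f g :: "real^'n \<Rightarrow> real" and N
    using that by (intro seminorm_nonneg Ck_diff) (auto simp: Omega_def)
  have summ: "summable (?q f g)" if "f \<in> Omega" "g \<in> Omega" for f g :: "real^'n \<Rightarrow> real"
    using that by (intro frechet_summable Ck_diff) (auto simp: Omega_def)
  have dist: "frechet_dist f g = suminf (?q f g)" if "f \<in> Omega" "g \<in> Omega"
    for f g :: "real^'n \<Rightarrow> real"
    using that by (simp add: frechet_dist_def)
  show "0 \<le> frechet_dist f g"
  proof (cases "f \<in> Omega \<and> g \<in> Omega")
    case True
    then have "0 \<le> suminf (?q f g)" using nn[of f g] by (intro suminf_nonneg summ) auto
    then show ?thesis using True dist by simp
  qed (auto simp: frechet_dist_def)
  show "frechet_dist f g = frechet_dist g f"
    by (auto simp: frechet_dist_def Omega_def seminorm_commute[of f g])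
  show "frechet_dist f g = 0 \<longleftrightarrow> f = g" if fg: "f \<in> Omega" "g \<in> Omega"
  proof
    assume "frechet_dist f g = 0"
    then have "\<forall>N. ?q f g N = 0"
      using suminf_eq_zero_iff[OF summ[OF fg]] nn[OF fg] dist[OF fg] by simp
    then have z: "seminorm_N N (\<lambda>x. f x - g x) = 0" for N
    proof -
      have "1 + seminorm_N N (\<lambda>x. f x - g x) = 0 \<or> seminorm_N N (\<lambda>x. f x - g x) = 0"
        using \<open>\<forall>N. ?q f g N = 0\<close> by auto
      then show ?thesis using nn[OF fg, of N] by linarith
    qed
    show "f = g"
    proof
      fix x :: "real^'n"
      obtain N where N: "norm x \<le> real N" using real_arch_simple by blast
      have "\<bar>f x - g x\<bar> = tensor_norm 0 (\<lambda>x. f x - g x) x" by (simp add: tensor_norm_0)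
      also have "\<dots> \<le> (\<Sum>k\<le>3. tensor_norm k (\<lambda>x. f x - g x) x)"
        by (rule member_le_sum) (auto simp: tensor_norm_nonneg)
      also have "\<dots> \<le> seminorm_N N (\<lambda>x. f x - g x)"
        using fg N by (intro seminorm_upper Ck_diff) (auto simp: Omega_def)
      finally show "f x = g x" using z by simp
    qed
  next
    assume "f = g"
    have 0: "partials is (\<lambda>x. f x - f x) x = 0" if "length is \<le> 3" for x "is"
      using fg that by (subst partials_diff[of 3]) (auto simp: Omega_def)
    have "tensor_norm k (\<lambda>x. f x - f x) x = 0" if "k \<le> 3" for k x
      using 0 that unfolding tensor_norm_def L2_set_def by (simp del: diff_self)
    then have "seminorm_N N (\<lambda>x. f x - f x) = 0" for N by (simp add: seminorm_N_def)
    then show "frechet_dist f g = 0" using \<open>f = g\<close> by (simp add: frechet_dist_def)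
  qed
  show "frechet_dist f h \<le> frechet_dist f g + frechet_dist g h"
    if O: "f \<in> Omega" "g \<in> Omega" "h \<in> Omega"
  proof -
    have "?q f h N \<le> ?q f g N + ?q g h N" for N
    proof -
      have "seminorm_N N (\<lambda>x. f x - h x) / (1 + seminorm_N N (\<lambda>x. f x - h x))
          \<le> seminorm_N N (\<lambda>x. f x - g x) / (1 + seminorm_N N (\<lambda>x. f x - g x))
           + seminorm_N N (\<lambda>x. g x - h x) / (1 + seminorm_N N (\<lambda>x. g x - h x))"
        using O by (intro quotient_triangle nn seminorm_triangle) (auto simp: Omega_def)
      then show ?thesis
        by (simp only: distrib_left[symmetric]) (intro mult_left_mono, auto)
    qed
    then have "suminf (?q f h) \<le> (\<Sum>N. ?q f g N + ?q g h N)"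
      using O by (intro suminf_le summable_add summ) auto
    also have "\<dots> = suminf (?q f g) + suminf (?q g h)"
      using O by (intro suminf_add[symmetric] summ) auto
    finally show ?thesis using O by (simp add: dist)
  qed
qed

definition borel_Omega :: "(real^'n::finite \<Rightarrow> real) measure" where
  "borel_Omega = sigma Omega {U. openin (Metric_space.mtopology Omega frechet_dist) U}"

definition shift :: "real^'n::finite \<Rightarrow> (real^'n \<Rightarrow> real) \<Rightarrow> real^'n \<Rightarrow> real" where
  "shift x h = (\<lambda>y. h (y + x))"

definition admissible :: "(real^'n::finite \<Rightarrow> real) measure \<Rightarrow> bool" where
  "admissible P \<longleftrightarrow>
     prob_space P \<and> space P = Omega \<and> sets P = sets borel_Omega \<and>
     (\<forall>B\<in>sets P. \<forall>x. measure P {h\<in>Omega. shift x h \<in> B} = measure P B) \<and>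
     (\<forall>B\<in>sets P. (\<forall>x. shift x ` B = B) \<longrightarrow> measure P B \<in> {0, 1}) \<and>
     (\<forall>\<delta>>0. ((\<lambda>x. measure P {h\<in>Omega. frechet_dist (shift x h) h > \<delta>}) \<longlongrightarrow> 0) (at 0)) \<and>
     (\<exists>K>0. AE h in P. \<forall>x. tensor_norm 1 h x + tensor_norm 2 h x \<le> K)"


section \<open>Coefficients\<close>

definition metric_g :: "real^'n::finite \<Rightarrow> (real^'n \<Rightarrow> real) \<Rightarrow> real^'n^'n" where
  "metric_g x h = mat 1 + (\<chi> i j. partial i h x * partial j h x)"

definition area :: "real^'n::finite \<Rightarrow> (real^'n \<Rightarrow> real) \<Rightarrow> real" where
  "area x h = sqrt (det (metric_g x h))"

definition drift :: "real^'n::finite \<Rightarrow> (real^'n \<Rightarrow> real) \<Rightarrow> real^'n" where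
  "drift x h = (\<chi> i. (1 / area x h) *
     (\<Sum>j\<in>UNIV. partial j (\<lambda>y. area y h * matrix_inv (metric_g y h) $ i $ j) x))"

definition Zconst :: "(real^'n::finite \<Rightarrow> real) measure \<Rightarrow> real" where
  "Zconst P = (LINT h|P. area 0 h)"

definition pi_measure :: "(real^'n::finite \<Rightarrow> real) measure \<Rightarrow> (real^'n \<Rightarrow> real) measure" where
  "pi_measure P = density P (\<lambda>h. ennreal (area 0 h / Zconst P))"


section \<open>Square-integrable functions and unbounded operators\<close>

text \<open>Elements of an L2 space are represented by functions; all notions below are invariant under
  changing them on null sets.\<close>

definition L2 :: "'a measure \<Rightarrow> ('a \<Rightarrow> 'b::euclidean_space) set" where
  "L2 M = {u \<in> borel_measurable M. integrable M (\<lambda>x. (norm (u x))\<^sup>2)}"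

definition L2_norm :: "'a measure \<Rightarrow> ('a \<Rightarrow> 'b::euclidean_space) \<Rightarrow> real" where
  "L2_norm M u = sqrt (LINT x|M. (norm (u x))\<^sup>2)"

definition L2_inner :: "'a measure \<Rightarrow> ('a \<Rightarrow> real) \<Rightarrow> ('a \<Rightarrow> real) \<Rightarrow> real" where
  "L2_inner M u v = (LINT x|M. u x * v x)"

text \<open>An unbounded operator is given by its graph.  If the domain is dense, the adjoint relation
  is the graph of a linear operator that is single-valued modulo null sets, so that equality of a
  densely defined graph with its adjoint makes it the graph of a self-adjoint operator.\<close>

definition adjoint_graph ::
  "'a measure \<Rightarrow> (('a \<Rightarrow> real) \<times> ('a \<Rightarrow> real)) set \<Rightarrow> (('a \<Rightarrow> real) \<times> ('a \<Rightarrow> real)) set" where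
  "adjoint_graph M A =
     {(u, w). u \<in> L2 M \<and> w \<in> L2 M \<and> (\<forall>(v, z)\<in>A. L2_inner M u z = L2_inner M w v)}"

definition self_adjoint :: "'a measure \<Rightarrow> (('a \<Rightarrow> real) \<times> ('a \<Rightarrow> real)) set \<Rightarrow> bool" where
  "self_adjoint M A \<longleftrightarrow>
     A \<subseteq> L2 M \<times> L2 M \<and>
     (\<forall>u\<in>L2 M. \<forall>\<epsilon>>0. \<exists>v\<in>Domain A. L2_norm M (\<lambda>x. u x - v x) < \<epsilon>) \<and>
     adjoint_graph M A = A"


section \<open>Stochastic derivatives and the generator\<close>

definition has_stoch_deriv ::
  "(real^'n::finite \<Rightarrow> real) measure \<Rightarrow> 'n \<Rightarrow> ((real^'n \<Rightarrow> real) \<Rightarrow> real)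
    \<Rightarrow> ((real^'n \<Rightarrow> real) \<Rightarrow> real) \<Rightarrow> bool" where
  "has_stoch_deriv P i V W \<longleftrightarrow>
     V \<in> L2 P \<and> W \<in> L2 P \<and>
     ((\<lambda>t. L2_norm P (\<lambda>h. (V (shift (t *\<^sub>R axis i 1) h) - V h) / t - W h)) \<longlongrightarrow> 0) (at 0)"

text \<open>A version of the derivative; it is determined only almost everywhere, and only for \<open>V\<close> in the
  domain of the generator of translations.\<close>
definition stoch_deriv ::
  "(real^'n::finite \<Rightarrow> real) measure \<Rightarrow> 'n \<Rightarrow> ((real^'n \<Rightarrow> real) \<Rightarrow> real)
    \<Rightarrow> (real^'n \<Rightarrow> real) \<Rightarrow> real" where
  "stoch_deriv P i V = (SOME W. has_stoch_deriv P i V W)"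

definition stoch_grad ::
  "(real^'n::finite \<Rightarrow> real) measure \<Rightarrow> ((real^'n \<Rightarrow> real) \<Rightarrow> real) \<Rightarrow> (real^'n \<Rightarrow> real) \<Rightarrow> real^'n" where
  "stoch_grad P V h = (\<chi> i. stoch_deriv P i V h)"

definition stoch_div ::
  "(real^'n::finite \<Rightarrow> real) measure \<Rightarrow> ((real^'n \<Rightarrow> real) \<Rightarrow> real^'n) \<Rightarrow> (real^'n \<Rightarrow> real) \<Rightarrow> real" where
  "stoch_div P V h = (\<Sum>i\<in>UNIV. stoch_deriv P i (\<lambda>h'. V h' $ i) h)"

definition Cb :: "nat \<Rightarrow> ((real^'n::finite \<Rightarrow> real) \<Rightarrow> real) set" where
  "Cb k = {f \<in> borel_measurable borel_Omega.
     (\<exists>C. \<forall>h\<in>Omega. \<bar>f h\<bar> \<le> C) \<and>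
     (\<forall>h\<in>Omega. Ck k (\<lambda>x. f (shift x h))) \<and>
     (\<forall>is. length is \<le> k \<longrightarrow>
       (\<exists>C. \<forall>h\<in>Omega. \<forall>x. \<bar>partials is (\<lambda>y. f (shift y h)) x\<bar> \<le> C))}"

definition L_hat ::
  "(real^'n::finite \<Rightarrow> real) measure \<Rightarrow> ((real^'n \<Rightarrow> real) \<Rightarrow> real) \<Rightarrow> (real^'n \<Rightarrow> real) \<Rightarrow> real" where
  "L_hat P f h = (1 / area 0 h) *
     stoch_div P (\<lambda>h'. area 0 h' *\<^sub>R (matrix_inv (metric_g 0 h') *v stoch_grad P f h')) h"

definition self_adjoint_extension ::
  "(real^'n::finite \<Rightarrow> real) measure
    \<Rightarrow> (((real^'n \<Rightarrow> real) \<Rightarrow> real) \<times> ((real^'n \<Rightarrow> real) \<Rightarrow> real)) set \<Rightarrow> bool" where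
  "self_adjoint_extension P L \<longleftrightarrow>
     self_adjoint (pi_measure P) L \<and> (\<forall>f\<in>Cb 2. (f, L_hat P f) \<in> L)"


section \<open>The space H_1\<close>

definition H1_pre :: "(real^'n::finite \<Rightarrow> real) measure \<Rightarrow> ((real^'n \<Rightarrow> real) \<Rightarrow> real) set" where
  "H1_pre P = {\<phi> \<in> Cb 2. (LINT h|pi_measure P. \<phi> h) = 0}"

definition H1_norm :: "(real^'n::finite \<Rightarrow> real) measure \<Rightarrow> ((real^'n \<Rightarrow> real) \<Rightarrow> real) \<Rightarrow> real" where
  "H1_norm P \<phi> = sqrt (1 / Zconst P *
     (LINT h|P. (stoch_grad P \<phi> h \<bullet> (matrix_inv (metric_g 0 h) *v stoch_grad P \<phi> h)) * area 0 h))"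

text \<open>Elements of the completion \<open>H_1\<close> are represented by Cauchy sequences; two sequences represent
  the same element iff their distance \<open>H1_dist\<close> is zero.\<close>

definition H1 :: "(real^'n::finite \<Rightarrow> real) measure \<Rightarrow> (nat \<Rightarrow> (real^'n \<Rightarrow> real) \<Rightarrow> real) set" where
  "H1 P = {\<Phi>. (\<forall>n. \<Phi> n \<in> H1_pre P) \<and>
     (\<forall>\<epsilon>>0. \<exists>N. \<forall>m\<ge>N. \<forall>n\<ge>N. H1_norm P (\<lambda>h. \<Phi> m h - \<Phi> n h) < \<epsilon>)}"

definition H1_dist ::
  "(real^'n::finite \<Rightarrow> real) measure \<Rightarrow> (nat \<Rightarrow> (real^'n \<Rightarrow> real) \<Rightarrow> real)
    \<Rightarrow> (nat \<Rightarrow> (real^'n \<Rightarrow> real) \<Rightarrow> real) \<Rightarrow> real" where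
  "H1_dist P \<Phi> \<Psi> = lim (\<lambda>n. H1_norm P (\<lambda>h. \<Phi> n h - \<Psi> n h))"

text \<open>The element \<open>u\<close> of \<open>L2\<close> with respect to \<open>pi_measure P\<close>, regarded as an element of \<open>H_1\<close>, is
  represented by \<open>\<Phi>\<close>.\<close>
definition H1_represents ::
  "(real^'n::finite \<Rightarrow> real) measure \<Rightarrow> (nat \<Rightarrow> (real^'n \<Rightarrow> real) \<Rightarrow> real)
    \<Rightarrow> ((real^'n \<Rightarrow> real) \<Rightarrow> real) \<Rightarrow> bool" where
  "H1_represents P \<Phi> u \<longleftrightarrow>
     \<Phi> \<in> H1 P \<and> u \<in> L2 (pi_measure P) \<and>
     (\<lambda>n. L2_norm (pi_measure P) (\<lambda>h. \<Phi> n h - u h)) \<longlonglongrightarrow> 0"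

text \<open>A version of the continuous extension of \<open>stoch_grad\<close> to \<open>H_1\<close>.\<close>
definition H1_grad ::
  "(real^'n::finite \<Rightarrow> real) measure \<Rightarrow> (nat \<Rightarrow> (real^'n \<Rightarrow> real) \<Rightarrow> real)
    \<Rightarrow> (real^'n \<Rightarrow> real) \<Rightarrow> real^'n" where
  "H1_grad P \<Phi> = (SOME G. G \<in> L2 P \<and>
     (\<lambda>n. L2_norm P (\<lambda>h. stoch_grad P (\<Phi> n) h - G h)) \<longlonglongrightarrow> 0)"


section \<open>Correctors and the effective diffusion tensor\<close>

definition resolvent_solution ::
  "(real^'n::finite \<Rightarrow> real) measure
    \<Rightarrow> (((real^'n \<Rightarrow> real) \<Rightarrow> real) \<times> ((real^'n \<Rightarrow> real) \<Rightarrow> real)) set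
    \<Rightarrow> real^'n \<Rightarrow> real \<Rightarrow> ((real^'n \<Rightarrow> real) \<Rightarrow> real) \<Rightarrow> bool" where
  "resolvent_solution P L e lam u \<longleftrightarrow>
     (\<exists>w. (u, w) \<in> L \<and> (AE h in pi_measure P. lam * u h - w h = drift 0 h \<bullet> e))"

text \<open>\<open>X\<close> represents the corrector in direction \<open>e\<close>: the limit in \<open>H_1\<close> of the resolvent solutions
  \<open>u lam\<close>, which are represented by \<open>U lam\<close>.\<close>
definition is_corrector ::
  "(real^'n::finite \<Rightarrow> real) measure
    \<Rightarrow> (((real^'n \<Rightarrow> real) \<Rightarrow> real) \<times> ((real^'n \<Rightarrow> real) \<Rightarrow> real)) set
    \<Rightarrow> real^'n \<Rightarrow> (nat \<Rightarrow> (real^'n \<Rightarrow> real) \<Rightarrow> real) \<Rightarrow> bool" where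
  "is_corrector P L e X \<longleftrightarrow> X \<in> H1 P \<and>
     (\<exists>u U. (\<forall>lam>0. resolvent_solution P L e lam (u lam) \<and> H1_represents P (U lam) (u lam)) \<and>
            ((\<lambda>lam. H1_dist P (U lam) X) \<longlongrightarrow> 0) (at_right 0))"

definition effective_tensor ::
  "(real^'n::finite \<Rightarrow> real) measure \<Rightarrow> ('n \<Rightarrow> nat \<Rightarrow> (real^'n \<Rightarrow> real) \<Rightarrow> real) \<Rightarrow> real^'n^'n" where
  "effective_tensor P X = (1 / Zconst P) *\<^sub>R
     (LINT h|P.
        (let D\<chi> = (\<chi> i j. H1_grad P (X i) h $ j)
         in area 0 h *\<^sub>R
              ((mat 1 + D\<chi>) ** matrix_inv (metric_g 0 h) ** transpose (mat 1 + D\<chi>))))"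

definition is_effective_tensor ::
  "(real^'n::finite \<Rightarrow> real) measure \<Rightarrow> real^'n^'n \<Rightarrow> bool" where
  "is_effective_tensor P D \<longleftrightarrow>
     (\<exists>L X. self_adjoint_extension P L \<and> (\<forall>i. is_corrector P L (axis i 1) (X i)) \<and>
            D = effective_tensor P X)"

text \<open>A symmetric real 2x2 matrix has a double eigenvalue \<open>c\<close> iff \<open>eigenvalues A = {c}\<close>, so for such
  matrices \<open>eigenvalues A = {a, b}\<close> says that \<open>a\<close> and \<open>b\<close> are the eigenvalues with multiplicity.\<close>
definition eigenvalues :: "real^'n^'n \<Rightarrow> real set" where
  "eigenvalues A = {c. \<exists>v. v \<noteq> 0 \<and> A *v v = c *\<^sub>R v}"

end

theory Submission
  imports Defs
begin

text \<open>Write \<open>A = |g|\<^sup>1\<^sup>/\<^sup>2 g\<^sup>-\<^sup>1\<close>, a symmetric matrix field of determinant \<open>1\<close>.  The fields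
  \<open>\<xi> i = e i + D \<chi> i\<close> are curl free with mean \<open>e i\<close>, and by the corrector equation the fluxes
  \<open>A \<xi> i\<close> are divergence free; their mean is \<open>Z\<close> times a column of the effective tensor.
  In the plane, the determinant of two stationary fields that are both curl free or both divergence
  free has as its expectation the determinant of the means.  Since \<open>det (A \<xi> 1, A \<xi> 2) = det (\<xi> 1, \<xi> 2)\<close>
  pointwise, it follows that \<open>Z\<^sup>2 det D = 1\<close>.

  For divergence-free \<open>q\<close> and \<open>r\<close>, rotating \<open>r\<close> by a right angle gives a curl-free field \<open>p\<close>, and the
  correlation function \<open>x \<mapsto> E[q \<cdot> p \<circ> \<tau> x]\<close> has vanishing weak gradient, so it is constant; ergodicity
  identifies the constant as \<open>E q \<cdot> E p\<close>.  The eigenvalue bounds follow from \<open>D \<le> I\<close>, a consequence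
  of the variational characterisation of \<open>D\<close> and of \<open>|g|\<^sup>1\<^sup>/\<^sup>2 g\<^sup>-\<^sup>1 \<le> |g|\<^sup>1\<^sup>/\<^sup>2 I\<close>.\<close>

section \<open>Square-integrable functions\<close>

text \<open>Dimension two enters twice: \<open>det (|g|^(1/2) g^(-1)) = |g|^(d/2 - 1)\<close> is 1
  for every \<open>g\<close> only if d = 2, and only in the plane does a quarter turn exchange
  curl-free and divergence-free fields. The two halves of the determinant identity need different
  arguments. The curl-free \<open>\<xi> i\<close> is a constant plus an L2 limit of gradients of
  smooth stationary functions, and for these the identity is an integration by parts. A flux is only
  known to be orthogonal to such gradients, with no stationary stream function at hand; this forces
  the detour through correlations. They are continuous on the plane, the orthogonality of either
  field is a weak divergence equation for them, and in the plane these equations yield the vanishing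
  gradient. The corrector is defined as a limit, so its equation has to be recovered from the
  resolvent equations, where \<open>lam * u lam\<close> tends to zero because the energy bounds
  \<open>lam\<close> times the squared norm of \<open>u lam\<close>. Derivatives in the definitions
  are versions fixed by \<open>SOME\<close>; the proof computes with derivatives along translation
  orbits and transfers the results almost everywhere.\<close>

lemma L2_I: "u \<in> borel_measurable M \<Longrightarrow> integrable M (\<lambda>x. (norm (u x))\<^sup>2) \<Longrightarrow> u \<in> L2 M"
  by (simp add: L2_def)

lemma L2_measurable: "u \<in> L2 M \<Longrightarrow> u \<in> borel_measurable M"
  by (simp add: L2_def)

lemma L2_square_integrable: "u \<in> L2 M \<Longrightarrow> integrable M (\<lambda>x. (norm (u x))\<^sup>2)"
  by (simp add: L2_def)

lemma L2_norm_mult_integrable: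
  assumes "u \<in> L2 M" "v \<in> L2 M"
  shows "integrable M (\<lambda>x. norm (u x) * norm (v x))"
proof (rule Bochner_Integration.integrable_bound)
  show "integrable M (\<lambda>x. (norm (u x))\<^sup>2 + (norm (v x))\<^sup>2)"
    using assms by (simp add: L2_square_integrable)
  show "(\<lambda>x. norm (u x) * norm (v x)) \<in> borel_measurable M"
    using assms[THEN L2_measurable] by measurable
  have "a * b \<le> a\<^sup>2 + b\<^sup>2" if "0 \<le> a" "0 \<le> b" for a b :: real
    using sum_squares_bound[of a b] mult_nonneg_nonneg[OF that] by simp
  then show "AE x in M. norm (norm (u x) * norm (v x)) \<le> norm ((norm (u x))\<^sup>2 + (norm (v x))\<^sup>2)"
    by simp
qed

lemma L2_inner_integrable:
  assumes "u \<in> L2 M" "v \<in> L2 M"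
  shows "integrable M (\<lambda>x. u x \<bullet> v x)"
proof (rule Bochner_Integration.integrable_bound[OF L2_norm_mult_integrable[OF assms]])
  show "(\<lambda>x. u x \<bullet> v x) \<in> borel_measurable M"
    using assms[THEN L2_measurable] by measurable
qed (simp add: Cauchy_Schwarz_ineq2)

lemma L2_mult_integrable:
  fixes u v :: "'a \<Rightarrow> real"
  shows "u \<in> L2 M \<Longrightarrow> v \<in> L2 M \<Longrightarrow> integrable M (\<lambda>x. u x * v x)"
  using L2_inner_integrable[of u M v] by simp

lemma L2_dominated:
  assumes "u \<in> L2 M" "v \<in> borel_measurable M" "AE x in M. norm (v x) \<le> C * norm (u x)"
  shows "v \<in> L2 M"
proof (rule L2_I[OF assms(2)])
  show "integrable M (\<lambda>x. (norm (v x))\<^sup>2)"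
  proof (rule Bochner_Integration.integrable_bound)
    show "integrable M (\<lambda>x. C\<^sup>2 * (norm (u x))\<^sup>2)"
      using assms(1) by (simp add: L2_square_integrable)
    show "(\<lambda>x. (norm (v x))\<^sup>2) \<in> borel_measurable M" using assms(2) by measurable
    show "AE x in M. norm ((norm (v x))\<^sup>2) \<le> norm (C\<^sup>2 * (norm (u x))\<^sup>2)"
      using assms(3)
    proof eventually_elim
      case (elim x)
      from power_mono[OF this, of 2] show ?case by (simp add: power_mult_distrib)
    qed
  qed
qed

lemma L2_scaleR: "u \<in> L2 M \<Longrightarrow> (\<lambda>x. c *\<^sub>R u x) \<in> L2 M"
  by (rule L2_dominated[where u=u and C="\<bar>c\<bar>"]) (auto dest: L2_measurable)

lemma L2_cmult:
  fixes u :: "'a \<Rightarrow> real"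
  shows "u \<in> L2 M \<Longrightarrow> (\<lambda>x. c * u x) \<in> L2 M"
  using L2_scaleR[of u M c] by simp

lemma L2_minus: "u \<in> L2 M \<Longrightarrow> (\<lambda>x. - u x) \<in> L2 M"
  by (rule L2_dominated[where u=u and C=1]) (auto dest: L2_measurable)

lemma L2_add:
  assumes "u \<in> L2 M" "v \<in> L2 M"
  shows "(\<lambda>x. u x + v x) \<in> L2 M"
proof (rule L2_I)
  show "(\<lambda>x. u x + v x) \<in> borel_measurable M" using assms[THEN L2_measurable] by measurable
  have "(norm (u x + v x))\<^sup>2 = (norm (u x))\<^sup>2 + (norm (v x))\<^sup>2 + 2 * (u x \<bullet> v x)" for x
    by (simp add: power2_norm_eq_inner inner_add inner_commute)
  then show "integrable M (\<lambda>x. (norm (u x + v x))\<^sup>2)"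
    using assms L2_inner_integrable[OF assms] by (simp add: L2_square_integrable)
qed

lemma L2_diff: "u \<in> L2 M \<Longrightarrow> v \<in> L2 M \<Longrightarrow> (\<lambda>x. u x - v x) \<in> L2 M"
  using L2_add[of u M "\<lambda>x. - v x"] L2_minus[of v M] by simp

lemma L2_zero: "(\<lambda>x. 0) \<in> L2 M"
  by (rule L2_I) auto

lemma L2_sum: "(\<And>i. i \<in> I \<Longrightarrow> u i \<in> L2 M) \<Longrightarrow> (\<lambda>x. \<Sum>i\<in>I. u i x) \<in> L2 M"
  by (induction I rule: infinite_finite_induct) (auto intro: L2_add L2_zero)

lemma L2_norm_eq: "(L2_norm M u)\<^sup>2 = (LINT x|M. (norm (u x))\<^sup>2)"
  unfolding L2_norm_def by (simp add: integral_nonneg_AE)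

lemma L2_norm_nonneg [simp]: "0 \<le> L2_norm M u"
  unfolding L2_norm_def by (simp add: integral_nonneg_AE)

lemma L2_norm_cong_AE:
  assumes "u \<in> borel_measurable M" "v \<in> borel_measurable M" "AE x in M. norm (u x) = norm (v x)"
  shows "L2_norm M u = L2_norm M v"
proof -
  have "(LINT x|M. (norm (u x))\<^sup>2) = (LINT x|M. (norm (v x))\<^sup>2)"
    by (rule integral_cong_AE) (use assms in \<open>auto\<close>)
  then show ?thesis by (simp add: L2_norm_def)
qed

lemma L2_norm_eq_0:
  assumes "u \<in> L2 M"
  shows "L2_norm M u = 0 \<longleftrightarrow> (AE x in M. u x = 0)"
proof -
  have "L2_norm M u = 0 \<longleftrightarrow> (LINT x|M. (norm (u x))\<^sup>2) = 0"
    by (simp add: L2_norm_def)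
  also have "\<dots> \<longleftrightarrow> (AE x in M. (norm (u x))\<^sup>2 = 0)"
    by (rule integral_nonneg_eq_0_iff_AE) (use assms L2_square_integrable in auto)
  finally show ?thesis by simp
qed

lemma L2_Cauchy_Schwarz_norm:
  assumes u: "u \<in> L2 M" and v: "v \<in> L2 M"
  shows "(LINT x|M. norm (u x) * norm (v x)) \<le> L2_norm M u * L2_norm M v"
proof -
  let ?a = "L2_norm M u" and ?b = "L2_norm M v"
  consider "?a = 0" | "?b = 0" | "?a > 0" "?b > 0"
    using L2_norm_nonneg[of M u] L2_norm_nonneg[of M v] by linarith
  then show ?thesis
  proof cases
    case 1
    then have "AE x in M. u x = 0" using L2_norm_eq_0[OF u] by simp
    then have "AE x in M. norm (u x) * norm (v x) = 0" by eventually_elim simp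
    then have "(LINT x|M. norm (u x) * norm (v x)) = 0" by (rule integral_eq_zero_AE)
    then show ?thesis using 1 by simp
  next
    case 2
    then have "AE x in M. v x = 0" using L2_norm_eq_0[OF v] by simp
    then have "AE x in M. norm (u x) * norm (v x) = 0" by eventually_elim simp
    then have "(LINT x|M. norm (u x) * norm (v x)) = 0" by (rule integral_eq_zero_AE)
    then show ?thesis using 2 by simp
  next
    case 3
    \<comment> \<open>With both norms normalised to 1, the integral of this square is 2 minus twice
      the normalised integral of the product, and it is nonnegative.\<close>
    have "(norm (u x) / ?a - norm (v x) / ?b)\<^sup>2 =
        (norm (u x))\<^sup>2 / ?a\<^sup>2 + (norm (v x))\<^sup>2 / ?b\<^sup>2 - (2 / (?a * ?b)) * (norm (u x) * norm (v x))" for x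
      by (simp add: power2_diff power_divide)
    then have "(LINT x|M. (norm (u x) / ?a - norm (v x) / ?b)\<^sup>2)
        = (LINT x|M. (norm (u x))\<^sup>2) / ?a\<^sup>2 + (LINT x|M. (norm (v x))\<^sup>2) / ?b\<^sup>2
          - (2 / (?a * ?b)) * (LINT x|M. norm (u x) * norm (v x))"
      using L2_norm_mult_integrable[OF u v] L2_square_integrable[OF u] L2_square_integrable[OF v]
      by simp
    also have "\<dots> = 2 - (2 / (?a * ?b)) * (LINT x|M. norm (u x) * norm (v x))"
      using 3 by (simp add: L2_norm_eq[symmetric])
    finally have eq: "(LINT x|M. (norm (u x) / ?a - norm (v x) / ?b)\<^sup>2)
        = 2 - (2 / (?a * ?b)) * (LINT x|M. norm (u x) * norm (v x))" .
    have "0 \<le> (LINT x|M. (norm (u x) / ?a - norm (v x) / ?b)\<^sup>2)"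
      by (rule integral_nonneg_AE) simp
    then have "0 \<le> 2 - (2 / (?a * ?b)) * (LINT x|M. norm (u x) * norm (v x))"
      unfolding eq .
    then have "(LINT x|M. norm (u x) * norm (v x)) / (?a * ?b) \<le> 1" by simp
    then show ?thesis using 3 by (simp add: divide_le_eq)
  qed
qed

lemma L2_Cauchy_Schwarz:
  assumes u: "u \<in> L2 M" and v: "v \<in> L2 M"
  shows "\<bar>LINT x|M. u x \<bullet> v x\<bar> \<le> L2_norm M u * L2_norm M v"
proof -
  have "\<bar>LINT x|M. u x \<bullet> v x\<bar> \<le> (LINT x|M. \<bar>u x \<bullet> v x\<bar>)" by (rule integral_abs_bound)
  also have "\<dots> \<le> (LINT x|M. norm (u x) * norm (v x))"
    using L2_inner_integrable[OF u v] L2_norm_mult_integrable[OF u v]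
    by (intro integral_mono) (auto simp: Cauchy_Schwarz_ineq2)
  also note L2_Cauchy_Schwarz_norm[OF u v]
  finally show ?thesis .
qed

lemma L2_norm_add_sq:
  assumes u: "u \<in> L2 M" and v: "v \<in> L2 M"
  shows "(L2_norm M (\<lambda>x. u x + v x))\<^sup>2 = (L2_norm M u)\<^sup>2 + (L2_norm M v)\<^sup>2 + 2 * (LINT x|M. u x \<bullet> v x)"
proof -
  have "(norm (u x + v x))\<^sup>2 = (norm (u x))\<^sup>2 + (norm (v x))\<^sup>2 + 2 * (u x \<bullet> v x)" for x
    by (simp add: power2_norm_eq_inner inner_add inner_commute)
  then show ?thesis
    using L2_inner_integrable[OF u v] L2_square_integrable[OF u] L2_square_integrable[OF v]
    by (simp add: L2_norm_eq)
qed

lemma L2_norm_triangle: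
  assumes u: "u \<in> L2 M" and v: "v \<in> L2 M"
  shows "L2_norm M (\<lambda>x. u x + v x) \<le> L2_norm M u + L2_norm M v"
proof (rule power2_le_imp_le)
  show "(L2_norm M (\<lambda>x. u x + v x))\<^sup>2 \<le> (L2_norm M u + L2_norm M v)\<^sup>2"
    using L2_Cauchy_Schwarz[OF u v] unfolding L2_norm_add_sq[OF u v] by (simp add: power2_sum)
qed simp

lemma L2_norm_minus [simp]: "L2_norm M (\<lambda>x. - u x) = L2_norm M u"
  by (simp add: L2_norm_def)

lemma L2_norm_diff_commute: "L2_norm M (\<lambda>x. u x - v x) = L2_norm M (\<lambda>x. v x - u x)"
  by (simp add: L2_norm_def norm_minus_commute)

lemma L2_norm_scaleR: "L2_norm M (\<lambda>x. c *\<^sub>R u x) = \<bar>c\<bar> * L2_norm M u"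
  by (simp add: L2_norm_def power_mult_distrib real_sqrt_mult)

lemma L2_norm_triangle_diff:
  assumes "u \<in> L2 M" "v \<in> L2 M" "w \<in> L2 M"
  shows "L2_norm M (\<lambda>x. u x - w x) \<le> L2_norm M (\<lambda>x. u x - v x) + L2_norm M (\<lambda>x. v x - w x)"
  using L2_norm_triangle[of "\<lambda>x. u x - v x" M "\<lambda>x. v x - w x"] assms by (simp add: L2_diff)

lemma L2_norm_diff_ge:
  assumes "u \<in> L2 M" "v \<in> L2 M"
  shows "\<bar>L2_norm M u - L2_norm M v\<bar> \<le> L2_norm M (\<lambda>x. u x - v x)"
  using L2_norm_triangle_diff[of u M v "\<lambda>x. 0"] L2_norm_triangle_diff[of v M u "\<lambda>x. 0"] assms
    L2_norm_diff_commute[of M u v] by (simp add: L2_zero)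

lemma L2_norm_mono:
  assumes "u \<in> L2 M" "v \<in> borel_measurable M" "AE x in M. norm (v x) \<le> C * norm (u x)" "0 \<le> C"
  shows "L2_norm M v \<le> C * L2_norm M u"
proof (rule power2_le_imp_le)
  have v: "v \<in> L2 M" using L2_dominated assms by blast
  have "(LINT x|M. (norm (v x))\<^sup>2) \<le> (LINT x|M. C\<^sup>2 * (norm (u x))\<^sup>2)"
  proof (rule integral_mono_AE)
    show "AE x in M. (norm (v x))\<^sup>2 \<le> C\<^sup>2 * (norm (u x))\<^sup>2"
      using assms(3)
    proof eventually_elim
      case (elim x)
      from power_mono[OF this, of 2] show ?case by (simp add: power_mult_distrib)
    qed
  qed (use assms v L2_square_integrable in auto)
  then show "(L2_norm M v)\<^sup>2 \<le> (C * L2_norm M u)\<^sup>2"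
    by (simp add: power_mult_distrib L2_norm_eq)
qed (use assms in simp)

lemma L2_limit_unique:
  assumes "F \<noteq> bot" "\<forall>\<^sub>F n in F. u n \<in> L2 M" "v \<in> L2 M" "w \<in> L2 M"
    and "((\<lambda>n. L2_norm M (\<lambda>x. u n x - v x)) \<longlongrightarrow> 0) F"
    and "((\<lambda>n. L2_norm M (\<lambda>x. u n x - w x)) \<longlongrightarrow> 0) F"
  shows "AE x in M. v x = w x"
proof -
  have "((\<lambda>n. L2_norm M (\<lambda>x. u n x - v x) + L2_norm M (\<lambda>x. u n x - w x)) \<longlongrightarrow> 0) F"
    using tendsto_add[OF assms(5,6)] by simp
  moreover have "\<forall>\<^sub>F n in F. L2_norm M (\<lambda>x. v x - w x)
      \<le> L2_norm M (\<lambda>x. u n x - v x) + L2_norm M (\<lambda>x. u n x - w x)"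
    using assms(2)
  proof eventually_elim
    case (elim n)
    then show ?case
      using L2_norm_triangle_diff[OF assms(3) elim assms(4)] L2_norm_diff_commute[of M "u n" v]
      by simp
  qed
  ultimately have "L2_norm M (\<lambda>x. v x - w x) \<le> 0"
    using tendsto_lowerbound assms(1) by blast
  then have "L2_norm M (\<lambda>x. v x - w x) = 0" by (simp add: antisym)
  then show ?thesis using L2_norm_eq_0[OF L2_diff[OF assms(3,4)]] by simp
qed

lemma L2_norm_tendsto:
  assumes "\<forall>\<^sub>F n in F. u n \<in> L2 M" "v \<in> L2 M"
    and "((\<lambda>n. L2_norm M (\<lambda>x. u n x - v x)) \<longlongrightarrow> 0) F"
  shows "((\<lambda>n. L2_norm M (u n)) \<longlongrightarrow> L2_norm M v) F"
proof (rule Lim_transform2[OF tendsto_const])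
  have "\<forall>\<^sub>F n in F. norm (L2_norm M v - L2_norm M (u n)) \<le> L2_norm M (\<lambda>x. u n x - v x)"
    using assms(1)
  proof eventually_elim
    case (elim n)
    then show ?case using L2_norm_diff_ge[OF elim assms(2)] by simp
  qed
  then show "((\<lambda>n. L2_norm M v - L2_norm M (u n)) \<longlongrightarrow> 0) F"
    by (rule Lim_null_comparison[OF _ assms(3)])
qed

lemma L2_inner_tendsto:
  assumes u: "\<forall>\<^sub>F n in F. u n \<in> L2 M" "u' \<in> L2 M"
    and v: "\<forall>\<^sub>F n in F. v n \<in> L2 M" "v' \<in> L2 M"
    and lu: "((\<lambda>n. L2_norm M (\<lambda>x. u n x - u' x)) \<longlongrightarrow> 0) F"
    and lv: "((\<lambda>n. L2_norm M (\<lambda>x. v n x - v' x)) \<longlongrightarrow> 0) F"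
  shows "((\<lambda>n. LINT x|M. u n x \<bullet> v n x) \<longlongrightarrow> (LINT x|M. u' x \<bullet> v' x)) F"
proof (rule Lim_transform2[OF tendsto_const])
  let ?b = "\<lambda>n. L2_norm M (\<lambda>x. u n x - u' x) * L2_norm M (v n)
      + L2_norm M u' * L2_norm M (\<lambda>x. v n x - v' x)"
  have "(?b \<longlongrightarrow> 0 * L2_norm M v' + L2_norm M u' * 0) F"
    by (intro tendsto_intros lu lv L2_norm_tendsto v)
  then have b: "(?b \<longlongrightarrow> 0) F" by simp
  have "\<forall>\<^sub>F n in F. norm ((LINT x|M. u' x \<bullet> v' x) - (LINT x|M. u n x \<bullet> v n x)) \<le> ?b n"
    using u(1) v(1)
  proof eventually_elim
    case (elim n)
    have "(LINT x|M. u n x \<bullet> v n x) - (LINT x|M. u' x \<bullet> v' x)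
       = (LINT x|M. (u n x - u' x) \<bullet> v n x) + (LINT x|M. u' x \<bullet> (v n x - v' x))"
      using elim u(2) v(2) by (simp add: inner_diff L2_inner_integrable)
    then show ?case
      using L2_Cauchy_Schwarz[OF L2_diff[OF elim(1) u(2)] elim(2)]
        L2_Cauchy_Schwarz[OF u(2) L2_diff[OF elim(2) v(2)]] by simp
  qed
  then show "((\<lambda>n. (LINT x|M. u' x \<bullet> v' x) - (LINT x|M. u n x \<bullet> v n x)) \<longlongrightarrow> 0) F"
    by (rule Lim_null_comparison[OF _ b])
qed

lemma L2_inner_tendsto_left:
  assumes "\<forall>\<^sub>F n in F. u n \<in> L2 M" "u' \<in> L2 M" "v \<in> L2 M"
    and "((\<lambda>n. L2_norm M (\<lambda>x. u n x - u' x)) \<longlongrightarrow> 0) F"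
  shows "((\<lambda>n. LINT x|M. u n x \<bullet> v x) \<longlongrightarrow> (LINT x|M. u' x \<bullet> v x)) F"
  by (rule L2_inner_tendsto) (use assms in \<open>auto simp: L2_norm_def\<close>)

lemma L2_componentwise:
  fixes u :: "'a \<Rightarrow> real^'n"
  assumes "\<And>i. (\<lambda>x. u x $ i) \<in> L2 M"
  shows "u \<in> L2 M"
proof (rule L2_I)
  show "u \<in> borel_measurable M"
    unfolding borel_measurable_euclidean_space[of u]
    using assms[THEN L2_measurable] by (auto simp: Basis_vec_def inner_axis)
  have "(norm (u x))\<^sup>2 = (\<Sum>i\<in>UNIV. (u x $ i)\<^sup>2)" for x
    by (simp add: norm_vec_def L2_set_def sum_nonneg)
  then show "integrable M (\<lambda>x. (norm (u x))\<^sup>2)"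
    using assms[THEN L2_square_integrable] by simp
qed

lemma borel_measurable_vec_nth [measurable]:
  fixes u :: "'a \<Rightarrow> real^'n"
  assumes "u \<in> borel_measurable M"
  shows "(\<lambda>x. u x $ i) \<in> borel_measurable M"
  using assms by (simp add: cart_eq_inner_axis)

lemma L2_component:
  fixes u :: "'a \<Rightarrow> real^'n"
  assumes "u \<in> L2 M"
  shows "(\<lambda>x. u x $ i) \<in> L2 M"
proof (rule L2_dominated[OF assms, where C=1])
  show "(\<lambda>x. u x $ i) \<in> borel_measurable M"
    using assms[THEN L2_measurable] by measurable
  show "AE x in M. norm (u x $ i) \<le> 1 * norm (u x)"
    using component_le_norm_cart by (auto simp: real_norm_def)
qed

lemma L2_norm_component_le:
  fixes u :: "'a \<Rightarrow> real^'n"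
  assumes "u \<in> L2 M"
  shows "L2_norm M (\<lambda>x. u x $ i) \<le> L2_norm M u"
proof -
  have "L2_norm M (\<lambda>x. u x $ i) \<le> 1 * L2_norm M u"
    by (rule L2_norm_mono[OF assms L2_measurable[OF L2_component[OF assms]]])
      (use component_le_norm_cart in \<open>auto simp: real_norm_def\<close>)
  then show ?thesis by simp
qed

lemma L2_norm_component_tendsto:
  fixes u :: "'b \<Rightarrow> 'a \<Rightarrow> real^'n"
  assumes "\<And>n. u n \<in> L2 M" "v \<in> L2 M" "((\<lambda>n. L2_norm M (\<lambda>x. u n x - v x)) \<longlongrightarrow> 0) F"
  shows "((\<lambda>n. L2_norm M (\<lambda>x. u n x $ i - v x $ i)) \<longlongrightarrow> 0) F"
proof (rule Lim_null_comparison[OF _ assms(3)])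
  show "\<forall>\<^sub>F n in F. norm (L2_norm M (\<lambda>x. u n x $ i - v x $ i)) \<le> L2_norm M (\<lambda>x. u n x - v x)"
    using L2_norm_component_le[OF L2_diff[OF assms(1,2)], of _ i]
    by (intro always_eventually) simp
qed

context finite_measure
begin

lemma L2_bounded:
  assumes "u \<in> borel_measurable M" "AE x in M. norm (u x) \<le> C"
  shows "u \<in> L2 M"
proof (rule L2_dominated[where u="\<lambda>x. 1::real" and C=C])
  show "(\<lambda>x. 1::real) \<in> L2 M" by (rule L2_I) auto
qed (use assms in auto)

lemma L2_const: "(\<lambda>x. c) \<in> L2 M"
  by (rule L2_bounded[where C="norm c"]) auto

lemma L2_integrable:
  assumes "u \<in> L2 M"
  shows "integrable M u"
proof (rule Bochner_Integration.integrable_bound)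
  show "integrable M (\<lambda>x. norm (u x) * norm (1::real))"
    by (rule L2_norm_mult_integrable[OF assms L2_const])
qed (use assms L2_measurable in auto)

text \<open>Bounded convergence in L2. It speaks of sequences because dominated convergence does;
  limits along continuous parameters are reduced to sequences before it is applied.\<close>

lemma L2_norm_bounded_tendsto:
  fixes u :: "nat \<Rightarrow> 'a \<Rightarrow> 'b::euclidean_space"
  assumes "\<And>n. u n \<in> borel_measurable M" "v \<in> borel_measurable M"
    and "\<And>n. AE x in M. norm (u n x) \<le> C"
    and "AE x in M. (\<lambda>n. u n x) \<longlonglongrightarrow> v x"
  shows "(\<lambda>n. L2_norm M (\<lambda>x. u n x - v x)) \<longlonglongrightarrow> 0"
proof -
  have a: "AE x in M. \<forall>n. norm (u n x) \<le> C" using assms(3) by (simp add: AE_all_countable)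
  then have b: "AE x in M. norm (v x) \<le> C"
    using assms(4)
  proof eventually_elim
    case (elim x)
    show ?case by (rule tendsto_upperbound[OF tendsto_norm[OF elim(2)]]) (use elim in auto)
  qed
  have "(\<lambda>n. LINT x|M. (norm (u n x - v x))\<^sup>2) \<longlonglongrightarrow> (LINT x|M. 0)"
  proof (rule integral_dominated_convergence[where w="\<lambda>x. (2 * C)\<^sup>2"])
    show "AE x in M. (\<lambda>n. (norm (u n x - v x))\<^sup>2) \<longlonglongrightarrow> 0"
      using assms(4)
    proof eventually_elim
      case (elim x)
      have "(\<lambda>n. (norm (u n x - v x))\<^sup>2) \<longlonglongrightarrow> (norm (v x - v x))\<^sup>2"
        by (intro tendsto_intros elim)
      then show ?case by simp
    qed
    show "AE x in M. norm ((norm (u n x - v x))\<^sup>2) \<le> (2 * C)\<^sup>2" for n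
      using a b
    proof eventually_elim
      case (elim x)
      then have "norm (u n x) \<le> C" "norm (v x) \<le> C" by auto
      then have "norm (u n x - v x) \<le> 2 * C" using norm_triangle_ineq4[of "u n x" "v x"] by linarith
      from power_mono[OF this, of 2] show ?case by simp
    qed
  qed (use assms in auto)
  then have "(\<lambda>n. sqrt (LINT x|M. (norm (u n x - v x))\<^sup>2)) \<longlonglongrightarrow> sqrt 0"
    by (intro tendsto_real_sqrt) simp
  then show ?thesis by (simp add: L2_norm_def)
qed

text \<open>On a finite measure the L1 norm is bounded by a multiple of the L2 norm, so a
  subsequence converges almost everywhere. Fatou's lemma along this subsequence turns the Cauchy
  estimate into convergence of the whole sequence.\<close>

lemma L2_complete:
  fixes u :: "nat \<Rightarrow> 'a \<Rightarrow> 'b::euclidean_space"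
  assumes u: "\<And>n. u n \<in> L2 M"
    and C: "\<And>e. e > 0 \<Longrightarrow> \<exists>N. \<forall>m\<ge>N. \<forall>n\<ge>N. L2_norm M (\<lambda>x. u m x - u n x) < e"
  obtains v where "v \<in> L2 M" "(\<lambda>n. L2_norm M (\<lambda>x. u n x - v x)) \<longlonglongrightarrow> 0"
proof -
  have L1: "(LINT x|M. norm (u m x - u n x)) \<le> L2_norm M (\<lambda>x. u m x - u n x) * L2_norm M (\<lambda>x. 1::real)" for m n
    using L2_Cauchy_Schwarz_norm[OF L2_diff[OF u u] L2_const[of "1::real"], of m n] by simp
  have "\<exists>N. \<forall>i\<ge>N. \<forall>j\<ge>N. (LINT x|M. norm (u i x - u j x)) < e" if "e > 0" for e
  proof -
    let ?k = "L2_norm M (\<lambda>x. 1::real)"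
    \<comment> \<open>The norm \<open>?k\<close> of the constant 1 vanishes on a measure of total
      mass zero; adding 1 allows the division.\<close>
    have "0 < e / (?k + 1)" using that by (simp add: add_nonneg_pos)
    then obtain N where N: "\<forall>m\<ge>N. \<forall>n\<ge>N. L2_norm M (\<lambda>x. u m x - u n x) < e / (?k + 1)"
      using C by blast
    have "(LINT x|M. norm (u m x - u n x)) < e" if "m \<ge> N" "n \<ge> N" for m n
    proof -
      have "L2_norm M (\<lambda>x. u m x - u n x) * ?k \<le> L2_norm M (\<lambda>x. u m x - u n x) * (?k + 1)"
        by (intro mult_left_mono) auto
      also have "\<dots> < e / (?k + 1) * (?k + 1)"
        using N that by (intro mult_strict_right_mono) (auto simp: add_nonneg_pos)
      also have "\<dots> = e" using L2_norm_nonneg[of M "\<lambda>x. 1::real"] by (simp add: add_nonneg_eq_0_iff)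
      finally show ?thesis using L1[of m n] by linarith
    qed
    then show ?thesis by blast
  qed
  then obtain r where r: "strict_mono r" "AE x in M. Cauchy (\<lambda>i. u (r i) x)"
    using cauchy_L1_AE_cauchy_subseq[of M u] L2_integrable[OF u] by blast
  define v where "v x = lim (\<lambda>i. u (r i) x)" for x
  have v_meas: "v \<in> borel_measurable M"
    unfolding v_def using u[THEN L2_measurable] by (intro borel_measurable_lim_metric) auto
  have lim: "AE x in M. (\<lambda>i. u (r i) x) \<longlonglongrightarrow> v x"
    using r(2)
  proof eventually_elim
    case (elim x)
    then show ?case by (simp add: v_def Cauchy_convergent convergent_LIMSEQ_iff[symmetric])
  qed
  have Fatou: "integrable M (\<lambda>x. (norm (u m x - v x))\<^sup>2) \<and> L2_norm M (\<lambda>x. u m x - v x) \<le> e"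
    if e: "e > 0" and m: "\<forall>n\<ge>N. L2_norm M (\<lambda>x. u m x - u n x) < e" for e m N
  proof -
    have "(\<integral>\<^sup>+x. ennreal ((norm (u m x - v x))\<^sup>2) \<partial>M)
        \<le> (\<integral>\<^sup>+x. liminf (\<lambda>i. ennreal ((norm (u m x - u (r i) x))\<^sup>2)) \<partial>M)"
    proof (rule nn_integral_mono_AE)
      show "AE x in M. ennreal ((norm (u m x - v x))\<^sup>2) \<le> liminf (\<lambda>i. ennreal ((norm (u m x - u (r i) x))\<^sup>2))"
        using lim
      proof eventually_elim
        case (elim x)
        have "(\<lambda>i. ennreal ((norm (u m x - u (r i) x))\<^sup>2)) \<longlonglongrightarrow> ennreal ((norm (u m x - v x))\<^sup>2)"
          by (intro tendsto_intros elim)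
        from lim_imp_Liminf[OF sequentially_bot this]
        show ?case by (metis order_refl)
      qed
    qed
    also have "\<dots> \<le> liminf (\<lambda>i. \<integral>\<^sup>+x. ennreal ((norm (u m x - u (r i) x))\<^sup>2) \<partial>M)"
      using u[THEN L2_measurable] by (intro nn_integral_liminf) auto
    also have "\<dots> \<le> ennreal (e\<^sup>2)"
    proof -
      have "\<forall>\<^sub>F i in sequentially. (\<integral>\<^sup>+x. ennreal ((norm (u m x - u (r i) x))\<^sup>2) \<partial>M) \<le> ennreal (e\<^sup>2)"
        using eventually_ge_at_top[of N]
      proof eventually_elim
        case (elim i)
        then have "r i \<ge> N" using seq_suble[OF r(1), of i] by linarith
        then have "L2_norm M (\<lambda>x. u m x - u (r i) x) \<le> e" using m by (simp add: less_imp_le)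
        then have "(L2_norm M (\<lambda>x. u m x - u (r i) x))\<^sup>2 \<le> e\<^sup>2" by (intro power_mono) auto
        then show ?case
          by (subst nn_integral_eq_integral)
            (auto simp: L2_norm_eq L2_square_integrable[OF L2_diff[OF u u]] intro!: ennreal_leI)
      qed
      then show ?thesis by (intro Liminf_le) auto
    qed
    finally have *: "(\<integral>\<^sup>+x. ennreal ((norm (u m x - v x))\<^sup>2) \<partial>M) \<le> ennreal (e\<^sup>2)" .
    have int: "integrable M (\<lambda>x. (norm (u m x - v x))\<^sup>2)"
      using u[THEN L2_measurable] v_meas le_less_trans[OF *, of \<infinity>]
      by (intro integrableI_nonneg) auto
    then have "ennreal (LINT x|M. (norm (u m x - v x))\<^sup>2) \<le> ennreal (e\<^sup>2)"
      using * by (subst (asm) nn_integral_eq_integral) auto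
    then have "(L2_norm M (\<lambda>x. u m x - v x))\<^sup>2 \<le> e\<^sup>2"
      by (subst (asm) ennreal_le_iff) (auto simp: L2_norm_eq)
    then show ?thesis using int e by (auto intro: power2_le_imp_le)
  qed
  show ?thesis
  proof (rule that)
    obtain N where N: "\<forall>m\<ge>N. \<forall>n\<ge>N. L2_norm M (\<lambda>x. u m x - u n x) < 1" using C[of 1] by auto
    \<comment> \<open>Fatou controls differences only, so \<open>v\<close> is recovered as
      \<open>u N\<close> minus a square-integrable difference.\<close>
    have "(\<lambda>x. u N x - v x) \<in> L2 M"
      using Fatou[of 1 N N] N u[THEN L2_measurable] v_meas by (intro L2_I) auto
    from L2_diff[OF u[of N] this] show "v \<in> L2 M" by simp
    show "(\<lambda>n. L2_norm M (\<lambda>x. u n x - v x)) \<longlonglongrightarrow> 0"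
    proof (rule LIMSEQ_I)
      fix e :: real assume "e > 0"
      then obtain N where N: "\<forall>m\<ge>N. \<forall>n\<ge>N. L2_norm M (\<lambda>x. u m x - u n x) < e/2"
        using C[of "e/2"] by auto
      have "L2_norm M (\<lambda>x. u m x - v x) \<le> e/2" if "m \<ge> N" for m
        using Fatou[of "e/2" N m] N that \<open>e > 0\<close> by auto
      then have "norm (L2_norm M (\<lambda>x. u m x - v x) - 0) < e" if "m \<ge> N" for m
        using \<open>e > 0\<close> that by fastforce
      then show "\<exists>N. \<forall>n\<ge>N. norm (L2_norm M (\<lambda>x. u n x - v x) - 0) < e" by blast
    qed
  qed
qed

end

section \<open>Translations of surfaces\<close>

lemma partial_shift: "partial i (shift x f) = shift x (partial i f)"
  by (rule ext) (simp add: partial_def shift_def algebra_simps)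

lemma partials_shift: "partials is (shift x f) = shift x (partials is f)"
  by (induction "is" arbitrary: f) (simp_all add: partial_shift)

lemma shift_apply: "shift x f y = f (y + x)"
  by (simp add: shift_def)

lemma shift_shift: "shift x (shift y f) = shift (x + y) f"
  by (rule ext) (simp add: shift_def add.assoc)

lemma shift_0 [simp]: "shift 0 f = f"
  by (rule ext) (simp add: shift_def)

lemma shift_diff: "shift x (\<lambda>y. f y - g y) = (\<lambda>y. shift x f y - shift x g y)"
  by (simp add: shift_def)

lemma Ck_shift: "Ck k f \<Longrightarrow> Ck k (shift x f)"
proof (induction k arbitrary: f)
  case 0
  have "continuous_on UNIV (\<lambda>y. f (y + x))"
    by (rule continuous_on_compose2[of UNIV f]) (use 0 in \<open>auto intro!: continuous_intros\<close>)
  then show ?case by (simp add: shift_def)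
next
  case (Suc k)
  have "(f \<circ> (\<lambda>y. y + x)) differentiable (at y)" for y
    using Suc.prems by (intro differentiable_chain_at) (auto intro!: derivative_intros)
  moreover have "f \<circ> (\<lambda>y. y + x) = shift x f" by (simp add: fun_eq_iff shift_def)
  ultimately show ?case using Suc by (simp add: partial_shift)
qed

lemma shift_Omega [simp, intro]: "h \<in> Omega \<Longrightarrow> shift x h \<in> Omega"
  by (simp add: Omega_def Ck_shift)

lemma tensor_norm_shift: "tensor_norm k (shift x f) y = tensor_norm k f (y + x)"
  by (simp add: tensor_norm_def partials_shift shift_apply)

lemma partials_le_tensor_norm: "\<bar>partials is f x\<bar> \<le> tensor_norm (length is) f x"
proof -
  have "\<bar>partials is f x\<bar> \<le> L2_set (\<lambda>is. \<bar>partials is f x\<bar>) {is'. length is' = length is}"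
    by (rule member_le_L2_set[OF finite_lists_length]) simp
  then show ?thesis by (simp add: tensor_norm_def L2_set_def)
qed

lemma seminorm_mono:
  assumes "Ck 3 f" "N \<le> M"
  shows "seminorm_N N f \<le> seminorm_N M f"
  unfolding seminorm_N_def
  by (rule cSUP_subset_mono) (use assms seminorm_bdd in auto)

text \<open>Translation by \<open>x\<close> carries the ball of radius \<open>N\<close> into the
  ball of radius \<open>N + m\<close>. Translations are therefore continuous for the metric, at the
  price of a larger index.\<close>

lemma seminorm_shift:
  assumes "Ck 3 f" "norm x \<le> real m"
  shows "seminorm_N N (shift x f) \<le> seminorm_N (N + m) f"
  unfolding seminorm_N_def[of N]
proof (rule cSUP_least)
  fix y :: "real^'a" assume y: "y \<in> cball 0 (real N)"
  then have "norm (y + x) \<le> real (N + m)" using norm_triangle_ineq[of y x] assms(2) by auto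
  then show "(\<Sum>k\<le>3. tensor_norm k (shift x f) y) \<le> seminorm_N (N + m) f"
    by (simp add: tensor_norm_shift seminorm_upper[OF assms(1)])
qed auto

section \<open>Comparison of the metric with the seminorms\<close>

lemma frechet_dist_term_le:
  assumes "f \<in> Omega" "g \<in> Omega"
  shows "(1/2) ^ N * (seminorm_N N (\<lambda>x. f x - g x) / (1 + seminorm_N N (\<lambda>x. f x - g x)))
    \<le> frechet_dist f g"
proof -
  let ?q = "\<lambda>N. (1/2::real) ^ N *
    (seminorm_N N (\<lambda>x. f x - g x) / (1 + seminorm_N N (\<lambda>x. f x - g x)))"
  have C: "Ck 3 (\<lambda>x. f x - g x)" using assms by (simp add: Omega_def Ck_diff)
  have nn: "0 \<le> ?q n" for n using seminorm_nonneg[OF C, of n] by simp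
  have "sum ?q {N} \<le> suminf ?q"
    by (rule sum_le_suminf[OF frechet_summable[OF C]]) (use nn in auto)
  then show ?thesis using assms by (simp add: frechet_dist_def)
qed

lemma frechet_dist_imp_seminorm:
  assumes "\<eta> > 0"
  obtains \<delta> where "\<delta> > 0"
    "\<And>f g. f \<in> Omega \<Longrightarrow> g \<in> Omega \<Longrightarrow> frechet_dist f g < \<delta> \<Longrightarrow> seminorm_N N (\<lambda>x. f x - g x) < \<eta>"
proof
  \<comment> \<open>This is the summand of index \<open>N\<close> at seminorm value
    \<open>\<eta>\<close>. As \<open>t / (1 + t)\<close> is increasing, a smaller distance forces a
    smaller seminorm.\<close>
  show "(1/2) ^ N * (\<eta> / (1 + \<eta>)) > 0" using assms by simp
  fix f g :: "real^'a \<Rightarrow> real"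
  assume fg: "f \<in> Omega" "g \<in> Omega" and d: "frechet_dist f g < (1/2) ^ N * (\<eta> / (1 + \<eta>))"
  let ?s = "seminorm_N N (\<lambda>x. f x - g x)"
  have s: "0 \<le> ?s" using fg by (simp add: seminorm_nonneg Omega_def Ck_diff)
  have "(1/2) ^ N * (?s / (1 + ?s)) < (1/2) ^ N * (\<eta> / (1 + \<eta>))"
    using frechet_dist_term_le[OF fg, of N] d by linarith
  then have "?s / (1 + ?s) < \<eta> / (1 + \<eta>)"
    by (subst (asm) mult_less_cancel_left_pos) auto
  then have "?s * (1 + \<eta>) < \<eta> * (1 + ?s)"
    using s assms by (simp add: divide_simps)
  then show "?s < \<eta>" by (simp add: algebra_simps)
qed

text \<open>The tail of the series is small by its geometric weights, and the seminorms increase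
  with the index, so the one at \<open>M\<close> controls all earlier terms.\<close>

lemma seminorm_imp_frechet_dist:
  assumes "\<epsilon> > 0"
  obtains M \<eta> where "\<eta> > 0"
    "\<And>f g. f \<in> Omega \<Longrightarrow> g \<in> Omega \<Longrightarrow> seminorm_N M (\<lambda>x. f x - g x) < \<eta> \<Longrightarrow> frechet_dist f g < \<epsilon>"
proof -
  obtain M where M: "(1/2::real) ^ M < \<epsilon> / 2"
    using real_arch_pow_inv[of "\<epsilon>/2" "1/2"] assms by auto
  show ?thesis
  proof (rule that)
    \<comment> \<open>The weights of the terms up to \<open>M\<close> add up to at most 2, so these
      terms contribute at most half of \<open>\<epsilon>\<close>. The tail contributes at most
      \<open>(1/2) ^ M\<close>, which is below the other half.\<close>
    show "\<epsilon> / 4 > 0" using assms by simp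
    fix f g :: "real^'a \<Rightarrow> real"
    assume fg: "f \<in> Omega" "g \<in> Omega" and d: "seminorm_N M (\<lambda>x. f x - g x) < \<epsilon> / 4"
    have C: "Ck 3 (\<lambda>x. f x - g x)" using fg by (simp add: Omega_def Ck_diff)
    let ?s = "\<lambda>N. seminorm_N N (\<lambda>x. f x - g x)"
    let ?q = "\<lambda>N. (1/2::real) ^ N * (?s N / (1 + ?s N))"
    note s = seminorm_nonneg[OF C]
    have summ: "summable ?q" by (rule frechet_summable[OF C])
    have le1: "?q n \<le> (1/2) ^ n" for n
    proof -
      have "?s n / (1 + ?s n) \<le> 1" using s[of n] by simp
      from mult_left_mono[OF this, of "(1/2) ^ n"] show ?thesis by simp
    qed
    have les: "?q n \<le> (1/2) ^ n * (\<epsilon> / 4)" if "n \<le> M" for n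
    proof -
      have "?s n / (1 + ?s n) \<le> ?s n" using s[of n] by (simp add: divide_le_eq mult_le_cancel_left1)
      also have "\<dots> \<le> \<epsilon> / 4" using seminorm_mono[OF C that] d by linarith
      finally show ?thesis by (intro mult_left_mono) auto
    qed
    have "frechet_dist f g = suminf ?q" using fg by (simp add: frechet_dist_def)
    also have "\<dots> = (\<Sum>n. ?q (n + Suc M)) + sum ?q {..<Suc M}"
      by (rule suminf_split_initial_segment[OF summ])
    also have "\<dots> \<le> (\<Sum>n. (1/2) ^ Suc M * (1/2) ^ n) + (\<Sum>n<Suc M. (1/2) ^ n * (\<epsilon> / 4))"
    proof (intro add_mono suminf_le sum_mono)
      show "?q (n + Suc M) \<le> (1/2) ^ Suc M * (1/2) ^ n" for n
        using le1[of "n + Suc M"] by (simp add: power_add mult_ac)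
      show "summable (\<lambda>n. ?q (n + Suc M))"
        using summ by (rule summable_ignore_initial_segment)
      show "summable (\<lambda>n. (1/2::real) ^ Suc M * (1/2) ^ n)"
        by (intro summable_mult summable_geometric) simp
    qed (use les in auto)
    also have "(\<Sum>n. (1/2::real) ^ Suc M * (1/2) ^ n) = (1/2) ^ M"
      by (subst suminf_mult) (auto simp: suminf_geometric summable_geometric)
    also have "(\<Sum>n<Suc M. (1/2) ^ n * (\<epsilon> / 4)) \<le> 2 * (\<epsilon> / 4)"
    proof -
      have "(\<Sum>n<Suc M. (1/2::real) ^ n) \<le> (\<Sum>n. (1/2) ^ n)"
        by (rule sum_le_suminf) (auto intro: summable_geometric)
      also have "\<dots> = 2" by (simp add: suminf_geometric)
      finally show ?thesis
        unfolding sum_distrib_right[symmetric] using assms by (intro mult_right_mono) auto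
    qed
    finally show "frechet_dist f g < \<epsilon>" using M by linarith
  qed
qed

interpretation Om: Metric_space Omega frechet_dist
  by (rule Metric_space_Omega)

lemma space_borel_Omega [simp]: "space borel_Omega = Omega"
  unfolding borel_Omega_def
  by (rule space_measure_of) (auto simp: Om.openin_mtopology)

lemma openin_subset_Omega: "{U. openin Om.mtopology U} \<subseteq> Pow Omega"
  by (auto simp: Om.openin_mtopology)

lemma sets_borel_Omega: "sets borel_Omega = sigma_sets Omega {U. openin Om.mtopology U}"
  unfolding borel_Omega_def by (rule sets_measure_of[OF openin_subset_Omega])

lemma open_in_borel_Omega: "openin Om.mtopology U \<Longrightarrow> U \<in> sets borel_Omega"
  by (auto simp: sets_borel_Omega)

lemma measurable_into_borel_Omega:
  assumes "f \<in> space M \<rightarrow> Omega"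
    and "\<And>U. openin Om.mtopology U \<Longrightarrow> f -` U \<inter> space M \<in> sets M"
  shows "f \<in> M \<rightarrow>\<^sub>M borel_Omega"
  unfolding borel_Omega_def
  by (rule measurable_measure_of[OF openin_subset_Omega]) (use assms in auto)

lemma measurable_borel_Omega_continuous:
  fixes f :: "(real^'n \<Rightarrow> real) \<Rightarrow> 'b::metric_space"
  assumes "\<And>h \<epsilon>. h \<in> Omega \<Longrightarrow> \<epsilon> > 0 \<Longrightarrow> \<exists>\<delta>>0. \<forall>k\<in>Omega. frechet_dist h k < \<delta> \<longrightarrow> dist (f k) (f h) < \<epsilon>"
  shows "f \<in> borel_measurable borel_Omega"
proof (rule borel_measurableI)
  fix S :: "'b set" assume S: "open S"
  have "openin Om.mtopology (f -` S \<inter> Omega)"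
    unfolding Om.openin_mtopology
  proof (intro conjI allI impI)
    fix h assume h: "h \<in> f -` S \<inter> Omega"
    then obtain \<epsilon> where e: "\<epsilon> > 0" "ball (f h) \<epsilon> \<subseteq> S" using S open_contains_ball by blast
    obtain \<delta> where d: "\<delta> > 0" "\<forall>k\<in>Omega. frechet_dist h k < \<delta> \<longrightarrow> dist (f k) (f h) < \<epsilon>"
      using assms[of h \<epsilon>] h e by auto
    have "Om.mball h \<delta> \<subseteq> f -` S \<inter> Omega"
    proof
      fix k assume k: "k \<in> Om.mball h \<delta>"
      then have "dist (f h) (f k) < \<epsilon>" using d by (auto simp: Om.in_mball dist_commute)
      then show "k \<in> f -` S \<inter> Omega" using e k by (auto simp: Om.in_mball)
    qed
    then show "\<exists>r>0. Om.mball h r \<subseteq> f -` S \<inter> Omega" using d by blast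
  qed auto
  then show "f -` S \<inter> space borel_Omega \<in> sets borel_Omega"
    by (simp add: open_in_borel_Omega)
qed

lemma partials_borel_Omega:
  assumes "length is \<le> 3"
  shows "(\<lambda>h. partials is h x) \<in> borel_measurable borel_Omega"
proof (rule measurable_borel_Omega_continuous)
  fix h :: "real^'a \<Rightarrow> real" and \<epsilon> :: real
  assume h: "h \<in> Omega" and e: "\<epsilon> > 0"
  obtain N where N: "norm x \<le> real N" using real_arch_simple by blast
  obtain \<delta> where d: "\<delta> > 0"
    "\<And>f g :: real^'a \<Rightarrow> real. f \<in> Omega \<Longrightarrow> g \<in> Omega \<Longrightarrow> frechet_dist f g < \<delta> \<Longrightarrow> seminorm_N N (\<lambda>x. f x - g x) < \<epsilon>"
    using frechet_dist_imp_seminorm[OF e] by metis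
  have "dist (partials is k x) (partials is h x) < \<epsilon>" if k: "k \<in> Omega" "frechet_dist h k < \<delta>" for k
  proof -
    have C: "Ck 3 (\<lambda>x. h x - k x)" using h k by (simp add: Omega_def Ck_diff)
    have "\<bar>partials is h x - partials is k x\<bar> = \<bar>partials is (\<lambda>x. h x - k x) x\<bar>"
      using h k assms by (subst partials_diff[of 3]) (auto simp: Omega_def)
    also have "\<dots> \<le> tensor_norm (length is) (\<lambda>x. h x - k x) x" by (rule partials_le_tensor_norm)
    also have "\<dots> \<le> (\<Sum>k'\<le>3. tensor_norm k' (\<lambda>x. h x - k x) x)"
      by (rule member_le_sum) (use assms tensor_norm_nonneg in auto)
    also have "\<dots> \<le> seminorm_N N (\<lambda>x. h x - k x)" by (rule seminorm_upper[OF C N])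
    also have "\<dots> < \<epsilon>" using d h k by blast
    finally show ?thesis by (simp add: dist_real_def abs_minus_commute)
  qed
  then show "\<exists>\<delta>>0. \<forall>k\<in>Omega. frechet_dist h k < \<delta> \<longrightarrow> dist (partials is k x) (partials is h x) < \<epsilon>"
    using d by blast
qed

lemma shift_measurable [measurable]: "shift x \<in> borel_Omega \<rightarrow>\<^sub>M borel_Omega"
proof (rule measurable_into_borel_Omega)
  fix U :: "(real^'a \<Rightarrow> real) set" assume U: "openin Om.mtopology U"
  have "openin Om.mtopology (shift x -` U \<inter> Omega)"
    unfolding Om.openin_mtopology
  proof (intro conjI allI impI)
    fix h assume h: "h \<in> shift x -` U \<inter> Omega"
    then obtain \<epsilon> where e: "\<epsilon> > 0" "Om.mball (shift x h) \<epsilon> \<subseteq> U"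
      using U unfolding Om.openin_mtopology by blast
    obtain M \<eta> where M: "\<eta> > 0"
      "\<And>f g :: real^'a \<Rightarrow> real. f \<in> Omega \<Longrightarrow> g \<in> Omega \<Longrightarrow> seminorm_N M (\<lambda>x. f x - g x) < \<eta> \<Longrightarrow> frechet_dist f g < \<epsilon>"
      using seminorm_imp_frechet_dist[OF e(1)] by metis
    obtain m where m: "norm x \<le> real m" using real_arch_simple by blast
    obtain \<delta> where d: "\<delta> > 0"
      "\<And>f g :: real^'a \<Rightarrow> real. f \<in> Omega \<Longrightarrow> g \<in> Omega \<Longrightarrow> frechet_dist f g < \<delta> \<Longrightarrow> seminorm_N (M + m) (\<lambda>x. f x - g x) < \<eta>"
      using frechet_dist_imp_seminorm[OF M(1)] by metis
    have "Om.mball h \<delta> \<subseteq> shift x -` U \<inter> Omega"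
    proof
      fix k assume k: "k \<in> Om.mball h \<delta>"
      then have kO: "k \<in> Omega" "h \<in> Omega" by (auto simp: Om.in_mball)
      have "seminorm_N (M + m) (\<lambda>x. h x - k x) < \<eta>" using d k kO by (simp add: Om.in_mball)
      moreover have "seminorm_N M (\<lambda>y. shift x h y - shift x k y) \<le> seminorm_N (M + m) (\<lambda>x. h x - k x)"
        unfolding shift_diff[symmetric] using kO m by (intro seminorm_shift) (auto simp: Omega_def Ck_diff)
      ultimately have "frechet_dist (shift x h) (shift x k) < \<epsilon>"
        using M(2)[of "shift x h" "shift x k"] kO by auto
      then show "k \<in> shift x -` U \<inter> Omega" using e kO by (auto simp: Om.in_mball)
    qed
    then show "\<exists>r>0. Om.mball h r \<subseteq> shift x -` U \<inter> Omega" using d by blast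
  qed auto
  then show "shift x -` U \<inter> space borel_Omega \<in> sets borel_Omega" by (simp add: open_in_borel_Omega)
qed simp

text \<open>The derivatives of \<open>h\<close> up to order three are uniformly continuous on
  compact sets, which controls the one seminorm of \<open>shift x h - shift x0 h\<close> that
  decides about the distance.\<close>

lemma shift_continuous:
  assumes h: "h \<in> Omega" and e: "\<epsilon> > 0"
  obtains \<delta> where "\<delta> > 0" "\<And>x. dist x x0 < \<delta> \<Longrightarrow> frechet_dist (shift x h) (shift x0 h) < \<epsilon>"
proof -
  obtain M \<eta> where M: "\<eta> > 0"
    "\<And>f g :: real^'a \<Rightarrow> real. f \<in> Omega \<Longrightarrow> g \<in> Omega \<Longrightarrow> seminorm_N M (\<lambda>x. f x - g x) < \<eta> \<Longrightarrow> frechet_dist f g < \<epsilon>"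
    using seminorm_imp_frechet_dist[OF e] by metis
  \<comment> \<open>The sum of the tensor norms of \<open>shift x h - shift x0 h\<close> at
    \<open>y\<close>, as a function of the pair. It vanishes at \<open>x = x0\<close>, so uniform
    continuity makes it small for all \<open>y\<close> in the ball at once.\<close>
  define \<Psi> where "\<Psi> = (\<lambda>(x, y). \<Sum>k\<le>3. L2_set (\<lambda>is. partials is h (y + x) - partials is h (y + x0)) {is. length is = k})"
  have "continuous_on (UNIV \<times> UNIV) \<Psi>"
    unfolding \<Psi>_def L2_set_def split_beta using h
    by (intro continuous_intros continuous_on_compose2[OF partials_continuous[of 3]])
      (auto simp: Omega_def intro!: continuous_intros)
  then have "continuous_on (cball x0 1 \<times> cball 0 (real M)) \<Psi>"
    by (rule continuous_on_subset) auto
  then have "uniformly_continuous_on (cball x0 1 \<times> cball 0 (real M)) \<Psi>"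
    by (intro compact_uniformly_continuous compact_Times) auto
  then obtain d where d: "d > 0"
    "\<And>p p'. p \<in> cball x0 1 \<times> cball 0 (real M) \<Longrightarrow> p' \<in> cball x0 1 \<times> cball 0 (real M) \<Longrightarrow>
      dist p' p < d \<Longrightarrow> dist (\<Psi> p') (\<Psi> p) < \<eta> / 2"
    unfolding uniformly_continuous_on_def using half_gt_zero[OF M(1)] by metis
  have pd: "partials is (\<lambda>y. shift x h y - shift x0 h y) y = partials is h (y + x) - partials is h (y + x0)"
    if "length is \<le> 3" for "is" x y
    using h that by (subst partials_diff[of 3]) (auto simp: Omega_def Ck_shift partials_shift shift_apply)
  show ?thesis
  proof (rule that)
    show "min d 1 > 0" using d by simp
    fix x assume x: "dist x x0 < min d 1"
    have "seminorm_N M (\<lambda>y. shift x h y - shift x0 h y) \<le> \<eta> / 2"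
      unfolding seminorm_N_def
    proof (rule cSUP_least)
      fix y :: "real^'a" assume y: "y \<in> cball 0 (real M)"
      have "(\<Sum>k\<le>3. tensor_norm k (\<lambda>y. shift x h y - shift x0 h y) y) = \<Psi> (x, y)"
        unfolding \<Psi>_def tensor_norm_def split
        by (intro sum.cong refl L2_set_cong) (auto simp: pd)
      also have "\<dots> = \<Psi> (x, y) - \<Psi> (x0, y)" by (simp add: \<Psi>_def L2_set_def)
      also have "\<dots> \<le> dist (\<Psi> (x, y)) (\<Psi> (x0, y))" by (simp add: dist_real_def)
      also have "\<dots> < \<eta> / 2"
        using x y by (intro d) (auto simp: dist_Pair_Pair dist_commute)
      finally show "(\<Sum>k\<le>3. tensor_norm k (\<lambda>y. shift x h y - shift x0 h y) y) \<le> \<eta> / 2" by simp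
    qed auto
    also have "\<dots> < \<eta>" using M by simp
    finally show "frechet_dist (shift x h) (shift x0 h) < \<epsilon>"
      using h by (intro M) auto
  qed
qed

section \<open>Distance to a set and joint measurability of translations\<close>

definition frechet_setdist :: "(real^'n \<Rightarrow> real) set \<Rightarrow> (real^'n \<Rightarrow> real) \<Rightarrow> real" where
  "frechet_setdist C h = (INF k\<in>C. frechet_dist h k)"

lemma frechet_setdist_Lipschitz:
  assumes "C \<subseteq> Omega" "C \<noteq> {}" "h \<in> Omega" "h' \<in> Omega"
  shows "\<bar>frechet_setdist C h - frechet_setdist C h'\<bar> \<le> frechet_dist h h'"
proof -
  have *: "frechet_setdist C h \<le> frechet_setdist C h' + frechet_dist h h'"
    if "h \<in> Omega" "h' \<in> Omega" for h h'
  proof -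
    have "frechet_setdist C h - frechet_dist h h' \<le> frechet_setdist C h'"
      unfolding frechet_setdist_def[of C h']
    proof (rule cINF_greatest[OF assms(2)])
      fix k assume k: "k \<in> C"
      have "frechet_setdist C h \<le> frechet_dist h k"
        unfolding frechet_setdist_def by (rule cINF_lower[OF _ k]) (auto intro!: bdd_belowI[of _ 0])
      also have "\<dots> \<le> frechet_dist h h' + frechet_dist h' k"
        using that k assms by (intro Om.triangle) auto
      finally show "frechet_setdist C h - frechet_dist h h' \<le> frechet_dist h' k" by simp
    qed
    then show ?thesis by simp
  qed
  from *[OF assms(3,4)] *[OF assms(4,3)] show ?thesis
    using Om.commute[of h h'] by simp
qed

lemma frechet_setdist_nonneg: "C \<noteq> {} \<Longrightarrow> 0 \<le> frechet_setdist C h"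
  unfolding frechet_setdist_def by (rule cINF_greatest) auto

text \<open>An open set other than the whole space is thus the nonzero set of a Lipschitz function.
  This reduces the joint measurability of translations, and later the approximation of indicators,
  to statements about real functions.\<close>

lemma frechet_setdist_eq_0_iff:
  assumes "openin Om.mtopology U" "Omega - U \<noteq> {}" "h \<in> Omega"
  shows "frechet_setdist (Omega - U) h = 0 \<longleftrightarrow> h \<notin> U"
proof
  assume "h \<notin> U"
  then have "frechet_setdist (Omega - U) h \<le> frechet_dist h h"
    unfolding frechet_setdist_def using assms(3)
    by (intro cINF_lower) (auto intro!: bdd_belowI[of _ 0])
  then show "frechet_setdist (Omega - U) h = 0"
    using frechet_setdist_nonneg[OF assms(2), of h] assms(3) by simp
next
  assume 0: "frechet_setdist (Omega - U) h = 0"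
  show "h \<notin> U"
  proof
    assume "h \<in> U"
    then obtain r where r: "r > 0" "Om.mball h r \<subseteq> U"
      using assms(1) unfolding Om.openin_mtopology by blast
    have "r \<le> frechet_setdist (Omega - U) h"
      unfolding frechet_setdist_def
      by (rule cINF_greatest[OF assms(2)]) (use r assms(3) in \<open>auto simp: Om.in_mball not_less[symmetric]\<close>)
    then show False using 0 r by simp
  qed
qed

lemma frechet_setdist_measurable:
  assumes "C \<subseteq> Omega" "C \<noteq> {}"
  shows "frechet_setdist C \<in> borel_measurable borel_Omega"
proof (rule measurable_borel_Omega_continuous)
  fix h :: "real^'a \<Rightarrow> real" and \<epsilon> :: real assume "h \<in> Omega" "\<epsilon> > 0"
  then show "\<exists>\<delta>>0. \<forall>k\<in>Omega. frechet_dist h k < \<delta> \<longrightarrow> dist (frechet_setdist C k) (frechet_setdist C h) < \<epsilon>"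
    using frechet_setdist_Lipschitz[OF assms, of _ h]
    by (intro exI[of _ \<epsilon>]) (auto simp: dist_real_def Om.commute intro: le_less_trans)
qed

lemma frechet_setdist_continuous:
  assumes "C \<subseteq> Omega" "C \<noteq> {}" "h \<in> Omega"
  shows "continuous_on UNIV (\<lambda>x. frechet_setdist C (shift x h))"
  unfolding continuous_on_iff
proof (intro ballI allI impI)
  fix x0 :: "real^'a" and \<epsilon> :: real assume "\<epsilon> > 0"
  then obtain \<delta> where d: "\<delta> > 0" "\<And>x. dist x x0 < \<delta> \<Longrightarrow> frechet_dist (shift x h) (shift x0 h) < \<epsilon>"
    using shift_continuous[OF assms(3)] by metis
  have "dist (frechet_setdist C (shift x' h)) (frechet_setdist C (shift x0 h)) < \<epsilon>" if "dist x' x0 < \<delta>" for x'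
    using frechet_setdist_Lipschitz[OF assms(1,2), of "shift x' h" "shift x0 h"] assms(3) d(2)[OF that]
    by (simp add: dist_real_def)
  then show "\<exists>d>0. \<forall>x'\<in>UNIV. dist x' x0 < d \<longrightarrow>
      dist (frechet_setdist C (shift x' h)) (frechet_setdist C (shift x0 h)) < \<epsilon>"
    using d(1) by blast
qed

text \<open>Replace \<open>x\<close> by the first point in an enumeration of a countable dense set
  that lies within \<open>1 / (n + 1)\<close>. The index found in this way is measurable in
  \<open>x\<close> and takes countably many values, so the resulting functions are jointly
  measurable; they converge pointwise by continuity in \<open>x\<close>.\<close>

lemma borel_measurable_Caratheodory:
  fixes g :: "'a::{metric_space, second_countable_topology} \<Rightarrow> 'b \<Rightarrow> real"
  assumes meas: "\<And>x. g x \<in> borel_measurable M"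
    and cont: "\<And>h. h \<in> space M \<Longrightarrow> continuous_on UNIV (\<lambda>x. g x h)"
  shows "(\<lambda>(x, h). g x h) \<in> borel_measurable (borel \<Otimes>\<^sub>M M)"
proof -
  obtain D :: "'a set" where D: "countable D" "\<And>X. open X \<Longrightarrow> X \<noteq> {} \<Longrightarrow> \<exists>d\<in>D. d \<in> X"
    using countable_dense_exists by metis
  have ne: "D \<noteq> {}" using D(2)[of UNIV] by auto
  define d where "d = from_nat_into D"
  define k where "k n x = (LEAST j. dist x (d j) < 1 / real (Suc n))" for n x
  have k: "dist x (d (k n x)) < 1 / real (Suc n)" for n x
  proof -
    have "\<exists>y\<in>D. y \<in> ball x (1 / real (Suc n))" by (rule D(2)) auto
    then obtain j where "dist x (d j) < 1 / real (Suc n)"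
      using from_nat_into_surj[OF D(1)] unfolding d_def by (metis mem_ball)
    then show ?thesis unfolding k_def by (rule LeastI)
  qed
  have km: "(\<lambda>p. k n (fst p)) \<in> (borel \<Otimes>\<^sub>M M) \<rightarrow>\<^sub>M count_space UNIV" for n
    unfolding k_def by measurable
  have "(\<lambda>p. g (d (k n (fst p))) (snd p)) \<in> borel_measurable (borel \<Otimes>\<^sub>M M)" for n
    by (rule measurable_compose_countable[OF _ km, where f="\<lambda>j p. g (d j) (snd p)"])
      (use meas in measurable)
  moreover have "(\<lambda>n. g (d (k n (fst p))) (snd p)) \<longlonglongrightarrow> (case p of (x, h) \<Rightarrow> g x h)"
    if "p \<in> space (borel \<Otimes>\<^sub>M M)" for p
  proof -
    obtain x h where p: "p = (x, h)" by (cases p)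
    have h: "h \<in> space M" using that p by (simp add: space_pair_measure)
    have "(\<lambda>n. dist (d (k n x)) x) \<longlonglongrightarrow> 0"
    proof (rule Lim_null_comparison)
      show "\<forall>\<^sub>F n in sequentially. norm (dist (d (k n x)) x) \<le> 1 / real (Suc n)"
        using k less_imp_le by (intro always_eventually) (auto simp: dist_commute)
      show "(\<lambda>n. 1 / real (Suc n)) \<longlonglongrightarrow> 0" using LIMSEQ_inverse_real_of_nat by (simp add: inverse_eq_divide)
    qed
    then have "(\<lambda>n. d (k n x)) \<longlonglongrightarrow> x" by (rule tendsto_dist_iff[THEN iffD2])
    from continuous_on_tendsto_compose[OF cont[OF h] this] show ?thesis by (simp add: p)
  qed
  ultimately show ?thesis by (rule borel_measurable_LIMSEQ_metric)
qed

text \<open>Since the distance to the complement of an open set is a Caratheodory function, no separability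
  of the space of surfaces is needed here.\<close>

lemma shift_pair_measurable [measurable]:
  "(\<lambda>(x, h). shift x h) \<in> borel \<Otimes>\<^sub>M borel_Omega \<rightarrow>\<^sub>M borel_Omega"
proof (rule measurable_into_borel_Omega)
  let ?B = "borel \<Otimes>\<^sub>M borel_Omega :: ((real^'a) \<times> (real^'a \<Rightarrow> real)) measure"
  let ?s = "\<lambda>(x :: real^'a, h). shift x h"
  fix U :: "(real^'a \<Rightarrow> real) set" assume U: "openin Om.mtopology U"
  show "?s -` U \<inter> space ?B \<in> sets ?B"
  proof (cases "Omega - U = {}")
    case True
    then have "?s -` U \<inter> space ?B = space ?B" by (auto simp: space_pair_measure)
    then show ?thesis by simp
  next
    case False
    have "(\<lambda>(x, h). frechet_setdist (Omega - U) (shift x h)) \<in> borel_measurable ?B"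
      using frechet_setdist_measurable[OF _ False] frechet_setdist_continuous[OF _ False]
      by (intro borel_measurable_Caratheodory measurable_compose[OF shift_measurable]) auto
    then have "{p \<in> space ?B. (case p of (x, h) \<Rightarrow> frechet_setdist (Omega - U) (shift x h)) \<noteq> 0} \<in> sets ?B"
      by measurable
    also have "{p \<in> space ?B. (case p of (x, h) \<Rightarrow> frechet_setdist (Omega - U) (shift x h)) \<noteq> 0}
        = ?s -` U \<inter> space ?B"
      using frechet_setdist_eq_0_iff[OF U False] by (auto simp: space_pair_measure)
    finally show ?thesis .
  qed
qed (auto simp: space_pair_measure)

section \<open>Continuity and ergodicity of the translation group\<close>

locale random_surface =
  fixes P :: "(real^'n::finite \<Rightarrow> real) measure"
  assumes admissible: "admissible P"
begin

sublocale prob_space P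
  using admissible by (simp add: admissible_def)

lemma space_P [simp]: "space P = Omega"
  using admissible by (simp add: admissible_def)

lemma prob_Omega [simp]: "prob Omega = 1"
  using prob_space by simp

lemma sets_P [measurable_cong]: "sets P = sets borel_Omega"
  using admissible by (simp add: admissible_def)

lemma shift_measurable_P [measurable]: "shift x \<in> P \<rightarrow>\<^sub>M P"
  using shift_measurable by (simp cong: measurable_cong_sets add: sets_P)

lemma shift_pair_measurable_P [measurable]: "(\<lambda>(x, h). shift x h) \<in> borel \<Otimes>\<^sub>M P \<rightarrow>\<^sub>M P"
proof -
  have "sets (borel \<Otimes>\<^sub>M P) = sets (borel \<Otimes>\<^sub>M borel_Omega :: ((real^'n) \<times> (real^'n \<Rightarrow> real)) measure)"
    by (rule sets_pair_measure_cong) (simp_all add: sets_P)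
  then show ?thesis using shift_pair_measurable by (simp cong: measurable_cong_sets add: sets_P)
qed

lemma distr_shift: "distr P P (shift x) = P"
proof (rule measure_eqI)
  fix B assume "B \<in> sets (distr P P (shift x))"
  then have B: "B \<in> sets P" by simp
  have "shift x -` B \<inter> space P = {h \<in> Omega. shift x h \<in> B}" by auto
  then have "emeasure (distr P P (shift x)) B = emeasure P {h \<in> Omega. shift x h \<in> B}"
    using B by (simp add: emeasure_distr)
  also have "\<dots> = emeasure P B"
    using admissible B by (simp add: admissible_def emeasure_eq_measure)
  finally show "emeasure (distr P P (shift x)) B = emeasure P B" .
qed simp

lemma AE_shift:
  assumes "AE h in P. Q h"
  shows "AE h in P. Q (shift x h)"
proof (rule AE_distrD[OF shift_measurable_P])
  show "AE h in distr P P (shift x). Q h" unfolding distr_shift by (rule assms)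
qed

lemma integral_shift:
  fixes f :: "_ \<Rightarrow> 'b::{banach, second_countable_topology}"
  shows "f \<in> borel_measurable P \<Longrightarrow> (LINT h|P. f (shift x h)) = (LINT h|P. f h)"
  using integral_distr[of "shift x" P P f] by (simp add: distr_shift)

lemma integrable_shift:
  fixes f :: "_ \<Rightarrow> 'b::{banach, second_countable_topology}"
  shows "integrable P f \<Longrightarrow> integrable P (\<lambda>h. f (shift x h))"
  using integrable_distr[of "shift x" P P f] by (simp add: distr_shift)

lemma L2_shift: "u \<in> L2 P \<Longrightarrow> (\<lambda>h. u (shift x h)) \<in> L2 P"
  using integrable_shift[of "\<lambda>h. (norm (u h))\<^sup>2"]
  by (auto simp: L2_def intro: measurable_compose[OF shift_measurable_P])

lemma L2_norm_shift: "u \<in> borel_measurable P \<Longrightarrow> L2_norm P (\<lambda>h. u (shift x h)) = L2_norm P u"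
  using integral_shift[of "\<lambda>h. (norm (u h))\<^sup>2"] by (simp add: L2_norm_def)

lemma integral_inner_shift:
  fixes u v :: "_ \<Rightarrow> 'b::euclidean_space"
  assumes "u \<in> borel_measurable P" "v \<in> borel_measurable P"
  shows "(LINT h|P. u h \<bullet> v (shift x h)) = (LINT h|P. u (shift (- x) h) \<bullet> v h)"
  using integral_shift[of "\<lambda>h. u (shift (- x) h) \<bullet> v h" x] assms
  by (simp add: shift_shift measurable_compose[OF shift_measurable_P])

section \<open>Density in L2 of bounded functions continuous along orbits\<close>

definition bounded_cts :: "((real^'n \<Rightarrow> real) \<Rightarrow> real) \<Rightarrow> bool" where
  "bounded_cts f \<longleftrightarrow> f \<in> borel_measurable P \<and> (\<exists>C. \<forall>h\<in>Omega. \<bar>f h\<bar> \<le> C) \<and>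
     (\<forall>h\<in>Omega. continuous_on UNIV (\<lambda>x. f (shift x h)))"

lemma bounded_cts_L2:
  assumes "bounded_cts f"
  shows "f \<in> L2 P"
proof -
  from assms obtain C where "\<forall>h\<in>Omega. \<bar>f h\<bar> \<le> C" by (auto simp: bounded_cts_def)
  then show ?thesis
    using assms by (intro L2_bounded[where C=C] AE_I2) (auto simp: bounded_cts_def)
qed

lemma bounded_cts_const: "bounded_cts (\<lambda>h. c)"
  by (auto simp: bounded_cts_def)

lemma bounded_cts_add: "bounded_cts f \<Longrightarrow> bounded_cts g \<Longrightarrow> bounded_cts (\<lambda>h. f h + g h)"
  unfolding bounded_cts_def
proof (elim conjE exE, intro conjI)
  fix C C' assume "\<forall>h\<in>Omega. \<bar>f h\<bar> \<le> C" "\<forall>h\<in>Omega. \<bar>g h\<bar> \<le> C'"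
  then have "\<forall>h\<in>Omega. \<bar>f h + g h\<bar> \<le> C + C'"
    by (meson abs_triangle_ineq add_mono order_trans)
  then show "\<exists>C. \<forall>h\<in>Omega. \<bar>f h + g h\<bar> \<le> C" by blast
qed (auto intro!: continuous_intros)

lemma bounded_cts_cmult: "bounded_cts f \<Longrightarrow> bounded_cts (\<lambda>h. c * f h)"
  unfolding bounded_cts_def
proof (elim conjE exE, intro conjI)
  fix C assume "\<forall>h\<in>Omega. \<bar>f h\<bar> \<le> C"
  then have "\<forall>h\<in>Omega. \<bar>c * f h\<bar> \<le> \<bar>c\<bar> * C"
    by (auto simp: abs_mult intro!: mult_left_mono)
  then show "\<exists>C. \<forall>h\<in>Omega. \<bar>c * f h\<bar> \<le> C" by blast
qed (auto intro!: continuous_intros)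

text \<open>The L2 closure of \<open>bounded_cts\<close>; it is shown to be everything by passing
  from open sets to measurable sets and to nonnegative functions. Continuity along orbits is the
  property that dominated convergence of translates and averaging over orbits call for.\<close>

definition approximable :: "((real^'n \<Rightarrow> real) \<Rightarrow> real) \<Rightarrow> bool" where
  "approximable u \<longleftrightarrow> u \<in> L2 P \<and> (\<forall>\<epsilon>>0. \<exists>f. bounded_cts f \<and> L2_norm P (\<lambda>h. u h - f h) < \<epsilon>)"

lemma approximable_bounded_cts: "bounded_cts f \<Longrightarrow> approximable f"
  unfolding approximable_def by (auto simp: bounded_cts_L2 L2_norm_def intro!: exI[of _ f])

lemma approximable_cong:
  assumes "approximable u" "v \<in> borel_measurable P" "\<And>h. h \<in> Omega \<Longrightarrow> u h = v h"
  shows "approximable v"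
  unfolding approximable_def
proof (intro conjI allI impI)
  have u: "u \<in> L2 P" using assms(1) by (simp add: approximable_def)
  show "v \<in> L2 P"
    by (rule L2_dominated[OF u assms(2), where C=1]) (use assms(3) in \<open>auto intro!: AE_I2\<close>)
  fix \<epsilon> :: real assume "\<epsilon> > 0"
  then obtain f where f: "bounded_cts f" "L2_norm P (\<lambda>h. u h - f h) < \<epsilon>"
    using assms(1) unfolding approximable_def by metis
  have "L2_norm P (\<lambda>h. u h - f h) = L2_norm P (\<lambda>h. v h - f h)"
  proof (intro L2_norm_cong_AE AE_I2)
    have "f \<in> borel_measurable P" using f(1) by (simp add: bounded_cts_def)
    then show "(\<lambda>h. u h - f h) \<in> borel_measurable P" "(\<lambda>h. v h - f h) \<in> borel_measurable P"
      using L2_measurable[OF u] assms(2) by auto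
  qed (use assms(3) in simp)
  then show "\<exists>f. bounded_cts f \<and> L2_norm P (\<lambda>h. v h - f h) < \<epsilon>" using f by auto
qed

lemma approximable_add:
  assumes "approximable u" "approximable v"
  shows "approximable (\<lambda>h. u h + v h)"
  unfolding approximable_def
proof (intro conjI allI impI)
  show "(\<lambda>h. u h + v h) \<in> L2 P" using assms by (auto simp: approximable_def L2_add)
  fix \<epsilon> :: real assume "\<epsilon> > 0"
  then obtain f g where f: "bounded_cts f" "L2_norm P (\<lambda>h. u h - f h) < \<epsilon>/2"
    and g: "bounded_cts g" "L2_norm P (\<lambda>h. v h - g h) < \<epsilon>/2"
    using assms half_gt_zero unfolding approximable_def by metis
  have "L2_norm P (\<lambda>h. (u h - f h) + (v h - g h)) < \<epsilon>"
    using L2_norm_triangle[of "\<lambda>h. u h - f h" P "\<lambda>h. v h - g h"] f g assms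
    by (auto simp: approximable_def bounded_cts_L2 L2_diff)
  then show "\<exists>k. bounded_cts k \<and> L2_norm P (\<lambda>h. u h + v h - k h) < \<epsilon>"
    using bounded_cts_add[OF f(1) g(1)] by (intro exI[of _ "\<lambda>h. f h + g h"]) (simp add: algebra_simps)
qed

lemma approximable_cmult:
  assumes "approximable u"
  shows "approximable (\<lambda>h. c * u h)"
  unfolding approximable_def
proof (intro conjI allI impI)
  show "(\<lambda>h. c * u h) \<in> L2 P" using assms by (auto simp: approximable_def L2_cmult)
  fix \<epsilon> :: real assume "\<epsilon> > 0"
  then have "\<epsilon> / (\<bar>c\<bar> + 1) > 0" by simp
  then obtain f where f: "bounded_cts f" "L2_norm P (\<lambda>h. u h - f h) < \<epsilon> / (\<bar>c\<bar> + 1)"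
    using assms unfolding approximable_def by metis
  have "L2_norm P (\<lambda>h. c * u h - c * f h) = \<bar>c\<bar> * L2_norm P (\<lambda>h. u h - f h)"
    using L2_norm_scaleR[of P c "\<lambda>h. u h - f h"] by (simp add: right_diff_distrib)
  also have "\<dots> \<le> (\<bar>c\<bar> + 1) * L2_norm P (\<lambda>h. u h - f h)" by (intro mult_right_mono) auto
  also have "\<dots> < \<epsilon>" using f(2) by (simp add: pos_less_divide_eq mult.commute)
  finally show "\<exists>k. bounded_cts k \<and> L2_norm P (\<lambda>h. c * u h - k h) < \<epsilon>"
    using bounded_cts_cmult[OF f(1)] by blast
qed

lemma approximable_limit:
  assumes u: "\<And>n::nat. approximable (u n)" and v: "v \<in> L2 P"
    and lim: "(\<lambda>n. L2_norm P (\<lambda>h. u n h - v h)) \<longlonglongrightarrow> 0"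
  shows "approximable v"
  unfolding approximable_def
proof (intro conjI allI impI)
  fix \<epsilon> :: real assume e: "\<epsilon> > 0"
  then obtain n where n: "L2_norm P (\<lambda>h. u n h - v h) < \<epsilon>/2"
    using LIMSEQ_D[OF lim, of "\<epsilon>/2"] by auto
  obtain f where f: "bounded_cts f" "L2_norm P (\<lambda>h. u n h - f h) < \<epsilon>/2"
    using u[of n] e half_gt_zero unfolding approximable_def by metis
  have "L2_norm P (\<lambda>h. v h - f h) \<le> L2_norm P (\<lambda>h. v h - u n h) + L2_norm P (\<lambda>h. u n h - f h)"
    using u[of n] v f by (intro L2_norm_triangle_diff) (auto simp: approximable_def bounded_cts_L2)
  also have "\<dots> < \<epsilon>" using n f by (simp add: L2_norm_diff_commute[of P v])
  finally show "\<exists>f. bounded_cts f \<and> L2_norm P (\<lambda>h. v h - f h) < \<epsilon>" using f by blast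
qed (rule v)

text \<open>With \<open>d\<close> the distance to the complement, the functions
  \<open>min 1 (n * d)\<close> are continuous along orbits and increase to the indicator.\<close>

lemma approximable_indicator_open:
  assumes U: "openin (Metric_space.mtopology Omega frechet_dist) U"
  shows "approximable (indicat_real U)"
proof (cases "Omega - U = {}")
  case True
  \<comment> \<open>The distance to the complement would be an infimum over the empty set here, so
    the whole space is treated apart.\<close>
  have "approximable (\<lambda>h. 1)" by (rule approximable_bounded_cts[OF bounded_cts_const])
  then show ?thesis
  proof (rule approximable_cong)
    show "indicat_real U \<in> borel_measurable P"
      using open_in_borel_Omega[OF U] by (intro borel_measurable_indicator) (simp add: sets_P)
  qed (use True in auto)
next
  case False
  let ?d = "frechet_setdist (Omega - U)"
  let ?f = "\<lambda>n h. min 1 (real n * ?d h)"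
  have dm: "?d \<in> borel_measurable P"
    using frechet_setdist_measurable[OF _ False] by (simp add: sets_P cong: measurable_cong_sets)
  have b: "\<bar>?f n h\<bar> \<le> 1" for n h
    using frechet_setdist_nonneg[OF False, of h] by (simp add: min_def)
  have m: "indicat_real U \<in> borel_measurable P"
    using open_in_borel_Omega[OF U] by (intro borel_measurable_indicator) (simp add: sets_P)
  show ?thesis
  proof (rule approximable_limit[of ?f])
    fix n
    have "bounded_cts (?f n)"
      unfolding bounded_cts_def
      using b dm frechet_setdist_continuous[OF _ False]
      by (auto intro!: continuous_intros exI[of _ 1])
    then show "approximable (?f n)" by (rule approximable_bounded_cts)
  next
    show "indicat_real U \<in> L2 P" using m by (intro L2_bounded[where C=1]) (auto simp: indicator_def)
    show "(\<lambda>n. L2_norm P (\<lambda>h. ?f n h - indicat_real U h)) \<longlonglongrightarrow> 0"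
    proof (rule L2_norm_bounded_tendsto[where C=1])
      show "AE h in P. (\<lambda>n. ?f n h) \<longlonglongrightarrow> indicat_real U h"
        using AE_space
      proof eventually_elim
        case (elim h)
        then have h: "h \<in> Omega" by simp
        show ?case
        proof (cases "h \<in> U")
          case True
          then have "?d h \<noteq> 0" using frechet_setdist_eq_0_iff[OF U False h] by simp
          then have pos: "?d h > 0" using frechet_setdist_nonneg[OF False, of h] by simp
          obtain N where N: "1 < real N * ?d h" using pos reals_Archimedean3 by blast
          have "\<forall>\<^sub>F n in sequentially. ?f n h = 1"
            using eventually_ge_at_top[of N]
          proof eventually_elim
            case (elim n)
            then have "real N * ?d h \<le> real n * ?d h" using pos by (intro mult_right_mono) auto
            then show ?case using N by simp
          qed
          then show ?thesis using True by (simp add: tendsto_eventually)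
        next
          case False
          then show ?thesis
            using frechet_setdist_eq_0_iff[OF U \<open>Omega - U \<noteq> {}\<close> h] by simp
        qed
      qed
    qed (use b dm m in auto)
  qed
qed

text \<open>A Dynkin argument: open sets are stable under intersection and generate, and the sets
  with approximable indicator are closed under complements and, by bounded convergence of the
  partial sums, under countable disjoint unions.\<close>

lemma approximable_indicator:
  assumes "A \<in> sets P"
  shows "approximable (indicator A)"
proof -
  interpret Om: Metric_space Omega frechet_dist by (rule Metric_space_Omega)
  let ?G = "{U. openin Om.mtopology U}"
  have A: "A \<in> sigma_sets Omega ?G" using assms by (simp add: sets_P sets_borel_Omega)
  have "Int_stable ?G" by (auto simp: Int_stable_def openin_Int)
  from this openin_subset_Omega A show ?thesis
  proof (induction rule: sigma_sets_induct_disjoint)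
    case basic
    then show ?case by (simp add: approximable_indicator_open)
  next
    case empty
    have "bounded_cts (\<lambda>h. 0)" by (rule bounded_cts_const)
    then show ?case by (simp add: approximable_bounded_cts)
  next
    case (compl A)
    have Am: "A \<in> sets P" using compl by (simp add: sets_P sets_borel_Omega)
    have "approximable (\<lambda>h. 1 + (- 1) * indicat_real A h)"
      by (intro approximable_add approximable_cmult compl approximable_bounded_cts[OF bounded_cts_const])
    then show ?case
    proof (rule approximable_cong)
      show "indicat_real (Omega - A) \<in> borel_measurable P"
        using sets.compl_sets[OF Am] by (intro borel_measurable_indicator) simp
    qed (auto simp: indicator_def)
  next
    case (union A)
    have Am: "A n \<in> sets P" for n using union by (auto simp: sets_P sets_borel_Omega)
    let ?s = "\<lambda>n h. \<Sum>i<n. indicat_real (A i) h :: real"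
    have s_eq: "?s n h = indicat_real (\<Union>i<n. A i) h" for n h
      by (rule indicator_UN_disjoint[symmetric])
        (use union(1) in \<open>auto intro: disjoint_family_on_mono[of _ UNIV]\<close>)
    show ?case
    proof (rule approximable_limit[of ?s])
      show "approximable (?s n)" for n
      proof (induction n)
        case 0
        have "bounded_cts (\<lambda>h. 0)" by (rule bounded_cts_const)
        then show ?case by (simp add: approximable_bounded_cts)
      next
        case (Suc n)
        then show ?case using union by (simp add: approximable_add)
      qed
      show "indicat_real (\<Union>i. A i) \<in> L2 P"
        using Am by (intro L2_bounded[where C=1] AE_I2) (auto intro!: borel_measurable_indicator simp: indicator_def)
      show "(\<lambda>n. L2_norm P (\<lambda>h. ?s n h - indicat_real (\<Union>i. A i) h)) \<longlonglongrightarrow> 0"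
      proof (rule L2_norm_bounded_tendsto[where C=1])
        show "AE h in P. (\<lambda>n. ?s n h) \<longlonglongrightarrow> indicat_real (\<Union>i. A i) h"
          unfolding s_eq by (intro AE_I2 LIMSEQ_indicator_UN)
        show "AE h in P. norm (?s n h) \<le> 1" for n
          unfolding s_eq by (intro AE_I2) (simp add: indicator_def)
        show "?s n \<in> borel_measurable P" for n
          using Am by (intro borel_measurable_sum borel_measurable_indicator)
        show "indicat_real (\<Union>i. A i) \<in> borel_measurable P"
          using Am by (intro borel_measurable_indicator) auto
      qed
    qed
  qed
qed

lemma approximable_L2_nonneg:
  assumes "u \<in> borel_measurable P" "\<And>h. 0 \<le> u h" "u \<in> L2 P"
  shows "approximable u"
proof -
  \<comment> \<open>Square-integrability becomes a premise of the induction formula, because it has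
    to be derived anew for the parts and approximants of \<open>u\<close> in each case.\<close>
  have "u \<in> L2 P \<longrightarrow> approximable u"
    using assms(1,2)
  proof (induction rule: borel_measurable_induct_real)
    case (set A)
    then show ?case by (simp add: approximable_indicator)
  next
    case (mult u c)
    show ?case
    proof (cases "c = 0")
      case True
      have "bounded_cts (\<lambda>h. 0)" by (rule bounded_cts_const)
      then show ?thesis using True by (simp add: approximable_bounded_cts)
    next
      case False
      have "u \<in> L2 P" if "(\<lambda>x. c * u x) \<in> L2 P"
        using L2_cmult[OF that, of "1 / c"] False by simp
      then show ?thesis using mult by (simp add: approximable_cmult)
    qed
  next
    case (add u v)
    have "u \<in> L2 P" "v \<in> L2 P" if "(\<lambda>x. v x + u x) \<in> L2 P"
      using add by (auto intro!: L2_dominated[OF that, where C=1])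
    then show ?case using add by (simp add: approximable_add)
  next
    case (seq U)
    show ?case
    proof
      assume u: "u \<in> L2 P"
      have le: "U i h \<le> u h" if "h \<in> Omega" for i h
        by (rule incseq_le[OF incseq_def[THEN iffD2]])
          (use seq that in \<open>auto simp: incseq_def le_fun_def\<close>)
      have UL: "U i \<in> L2 P" for i
        by (rule L2_dominated[OF u seq(1), where C=1])
          (use seq(2) le in \<open>auto intro!: AE_I2 order_trans[OF _ abs_ge_self]\<close>)
      have "(\<lambda>n. LINT h|P. (norm (U n h - u h))\<^sup>2) \<longlonglongrightarrow> (LINT h|P. 0)"
      proof (rule integral_dominated_convergence[where w="\<lambda>h. (norm (u h))\<^sup>2"])
        show "AE h in P. (\<lambda>n. (norm (U n h - u h))\<^sup>2) \<longlonglongrightarrow> 0"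
        proof (rule AE_I2)
          fix h assume "h \<in> space P"
          then have "(\<lambda>n. (norm (U n h - u h))\<^sup>2) \<longlonglongrightarrow> (norm (u h - u h))\<^sup>2"
            by (intro tendsto_intros) (use seq in simp)
          then show "(\<lambda>n. (norm (U n h - u h))\<^sup>2) \<longlonglongrightarrow> 0" by simp
        qed
        show "AE h in P. norm ((norm (U n h - u h))\<^sup>2) \<le> (norm (u h))\<^sup>2" for n
        proof (rule AE_I2)
          fix h assume "h \<in> space P"
          then have "\<bar>U n h - u h\<bar> \<le> \<bar>u h\<bar>" using le[of h n] seq(2)[of n h] by simp
          from power_mono[OF this, of 2] show "norm ((norm (U n h - u h))\<^sup>2) \<le> (norm (u h))\<^sup>2" by simp
        qed
        show "integrable P (\<lambda>h. (norm (u h))\<^sup>2)" by (rule L2_square_integrable[OF u])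
      qed (use seq L2_measurable[OF u] in auto)
      then have "(\<lambda>n. sqrt (LINT h|P. (norm (U n h - u h))\<^sup>2)) \<longlonglongrightarrow> sqrt 0"
        by (intro tendsto_real_sqrt) simp
      then have "(\<lambda>n. L2_norm P (\<lambda>h. U n h - u h)) \<longlonglongrightarrow> 0" by (simp add: L2_norm_def)
      then show "approximable u"
        by (rule approximable_limit[OF _ u, rotated]) (use seq.IH UL in blast)
    qed
  qed
  then show ?thesis using assms(3) by simp
qed

lemma approximable_L2:
  assumes "u \<in> L2 P"
  shows "approximable u"
proof -
  have m [measurable]: "u \<in> borel_measurable P" using assms by (rule L2_measurable)
  have "approximable (\<lambda>h. max 0 (u h) + (- 1) * max 0 (- u h))"
    by (intro approximable_add approximable_cmult approximable_L2_nonneg)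
      (auto intro!: L2_dominated[OF assms, where C=1])
  moreover have "(\<lambda>h. max 0 (u h) + (- 1) * max 0 (- u h)) = u" by (auto simp: max_def)
  ultimately show ?thesis by simp
qed

lemma L2_bounded_cts_sequence:
  assumes "u \<in> L2 P"
  shows "\<exists>f. (\<forall>n::nat. bounded_cts (f n)) \<and> (\<lambda>n. L2_norm P (\<lambda>h. f n h - u h)) \<longlonglongrightarrow> 0"
proof -
  have "\<exists>f. bounded_cts f \<and> L2_norm P (\<lambda>h. u h - f h) < inverse (real (Suc n))" for n
    using approximable_L2[OF assms] by (simp add: approximable_def)
  then obtain f where f: "\<And>n. bounded_cts (f n)" "\<And>n. L2_norm P (\<lambda>h. u h - f n h) < inverse (real (Suc n))"
    by metis
  have "(\<lambda>n. L2_norm P (\<lambda>h. f n h - u h)) \<longlonglongrightarrow> 0"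
    by (rule Lim_null_comparison[OF _ LIMSEQ_inverse_real_of_nat])
      (use f(2) less_imp_le in \<open>auto simp: L2_norm_diff_commute[of P _ u] intro!: always_eventually\<close>)
  with f(1) show ?thesis by blast
qed

end

text \<open>The projection argument for closed convex sets, for which midpoints suffice. Uniqueness
  is phrased for competitors whose norm does not exceed that of \<open>f\<close>, so that it applies
  directly to translates of \<open>f\<close>, which have the same norm.\<close>

lemma (in finite_measure) L2_min_norm:
  fixes K :: "('a \<Rightarrow> 'b::euclidean_space) set"
  assumes K: "K \<subseteq> L2 M" "K \<noteq> {}"
    and mid: "\<And>u v. u \<in> K \<Longrightarrow> v \<in> K \<Longrightarrow> (\<lambda>x. (1/2) *\<^sub>R (u x + v x)) \<in> K"
    and closed: "\<And>u v. (\<And>n::nat. u n \<in> K) \<Longrightarrow> v \<in> L2 M \<Longrightarrow>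
      (\<lambda>n. L2_norm M (\<lambda>x. u n x - v x)) \<longlonglongrightarrow> 0 \<Longrightarrow> v \<in> K"
  obtains f where "f \<in> K" "\<And>g. g \<in> K \<Longrightarrow> L2_norm M g \<le> L2_norm M f \<Longrightarrow> (AE x in M. f x = g x)"
proof -
  define d where "d = (INF u\<in>K. L2_norm M u)"
  have bdd: "bdd_below (L2_norm M ` K)" by (auto intro!: bdd_belowI[of _ 0])
  have d_le: "d \<le> L2_norm M u" if "u \<in> K" for u
    unfolding d_def by (rule cINF_lower[OF bdd that])
  have d0: "0 \<le> d" unfolding d_def by (rule cINF_greatest[OF K(2)]) simp
  \<comment> \<open>Parallelogram identity together with the lower bound \<open>d\<close> for the
    norm of the midpoint. It makes minimising sequences Cauchy and minimisers unique.\<close>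
  have par: "(L2_norm M (\<lambda>x. u x - v x))\<^sup>2 \<le> 2 * (L2_norm M u)\<^sup>2 + 2 * (L2_norm M v)\<^sup>2 - 4 * d\<^sup>2"
    if "u \<in> K" "v \<in> K" for u v
  proof -
    have uv: "u \<in> L2 M" "v \<in> L2 M" using K that by auto
    have s: "L2_norm M (\<lambda>x. (1/2) *\<^sub>R (u x + v x)) = L2_norm M (\<lambda>x. u x + v x) / 2"
      using L2_norm_scaleR[of M "1/2" "\<lambda>x. u x + v x"] by simp
    have "d \<le> L2_norm M (\<lambda>x. u x + v x) / 2" using d_le[OF mid[OF that]] unfolding s .
    then have "(2 * d)\<^sup>2 \<le> (L2_norm M (\<lambda>x. u x + v x))\<^sup>2" using d0 by (intro power_mono) auto
    moreover have "(L2_norm M (\<lambda>x. u x - v x))\<^sup>2 + (L2_norm M (\<lambda>x. u x + v x))\<^sup>2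
        = 2 * (L2_norm M u)\<^sup>2 + 2 * (L2_norm M v)\<^sup>2"
      using L2_norm_add_sq[OF uv] L2_norm_add_sq[OF uv(1) L2_minus[OF uv(2)]] by simp
    ultimately show ?thesis by (simp add: power_mult_distrib)
  qed
  have "\<exists>u\<in>K. L2_norm M u < d + inverse (real (Suc n))" for n
    using cINF_less_iff[OF K(2) bdd, of "d + inverse (real (Suc n))"] by (simp add: d_def[symmetric])
  then obtain u where u: "\<And>n. u n \<in> K" "\<And>n. L2_norm M (u n) < d + inverse (real (Suc n))" by metis
  have lim: "(\<lambda>n. L2_norm M (u n)) \<longlonglongrightarrow> d"
  proof (rule tendsto_sandwich[where f="\<lambda>_. d"])
    have "(\<lambda>n. d + inverse (real (Suc n))) \<longlonglongrightarrow> d + 0"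
      by (intro tendsto_intros LIMSEQ_inverse_real_of_nat)
    then show "(\<lambda>n. d + inverse (real (Suc n))) \<longlonglongrightarrow> d" by simp
  qed (use d_le u(1) u(2)[THEN less_imp_le] in auto)
  have uL: "u n \<in> L2 M" for n using u K by auto
  have Cau: "\<exists>N. \<forall>m\<ge>N. \<forall>n\<ge>N. L2_norm M (\<lambda>x. u m x - u n x) < e" if "e > 0" for e
  proof -
    have "(\<lambda>n. (L2_norm M (u n))\<^sup>2) \<longlonglongrightarrow> d\<^sup>2" by (intro tendsto_intros lim)
    then obtain N where N: "\<And>n. n \<ge> N \<Longrightarrow> \<bar>(L2_norm M (u n))\<^sup>2 - d\<^sup>2\<bar> < e\<^sup>2 / 4"
      using \<open>e > 0\<close> LIMSEQ_D[of "\<lambda>n. (L2_norm M (u n))\<^sup>2" "d\<^sup>2" "e\<^sup>2/4"] by auto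
    have "L2_norm M (\<lambda>x. u m x - u n x) < e" if "m \<ge> N" "n \<ge> N" for m n
    proof (rule power2_less_imp_less)
      show "(L2_norm M (\<lambda>x. u m x - u n x))\<^sup>2 < e\<^sup>2"
        using par[OF u(1) u(1), of m n] N[OF that(1)] N[OF that(2)] by linarith
    qed (use \<open>e > 0\<close> in simp)
    then show ?thesis by blast
  qed
  obtain f where f: "f \<in> L2 M" "(\<lambda>n. L2_norm M (\<lambda>x. u n x - f x)) \<longlonglongrightarrow> 0"
    using L2_complete[OF uL Cau] by blast
  have fK: "f \<in> K" by (rule closed[OF u(1) f])
  have "(\<lambda>n. L2_norm M (u n)) \<longlonglongrightarrow> L2_norm M f"
    by (rule L2_norm_tendsto) (use f uL in auto)
  then have fd: "L2_norm M f = d" using lim LIMSEQ_unique by blast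
  show ?thesis
  proof (rule that[OF fK])
    fix g assume g: "g \<in> K" "L2_norm M g \<le> L2_norm M f"
    then have "(L2_norm M g)\<^sup>2 \<le> d\<^sup>2" unfolding fd by (intro power_mono) auto
    then have "(L2_norm M (\<lambda>x. f x - g x))\<^sup>2 \<le> 0"
      using par[OF fK g(1)] unfolding fd by linarith
    then have "L2_norm M (\<lambda>x. f x - g x) = 0" by simp
    then show "AE x in M. f x = g x"
      using L2_norm_eq_0[OF L2_diff[of f M g]] f(1) g(1) K by auto
  qed
qed

section \<open>Strong continuity of translations, ergodicity and correlations\<close>

lemma AE_lborel_const: "(AE x in (lborel :: 'a::euclidean_space measure). Q) \<longleftrightarrow> Q"
  by (subst AE_iff_measurable[OF _ refl]) auto

lemma AE_lborel_translate:
  fixes c :: "'a::euclidean_space"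
  assumes "AE x in lborel. Q x"
  shows "AE x in lborel. Q (x + c)"
proof -
  have "AE x in distr lborel borel ((+) c). Q x" using assms by (subst lborel_distr_plus)
  then have "AE x in lborel. Q (c + x)" by (rule AE_distrD[rotated]) simp
  then show ?thesis by (simp add: add.commute)
qed

context random_surface
begin

text \<open>Translations are isometries of L2, so a three-epsilon argument reduces the claim to a
  dense class. For functions continuous along orbits it is bounded convergence.\<close>

lemma L2_shift_continuous:
  fixes u :: "_ \<Rightarrow> real"
  assumes u: "u \<in> L2 P"
  shows "((\<lambda>x. L2_norm P (\<lambda>h. u (shift x h) - u h)) \<longlongrightarrow> 0) (at 0)"
proof (rule tendstoI)
  fix \<epsilon> :: real assume e: "\<epsilon> > 0"
  then obtain f where f: "bounded_cts f" "L2_norm P (\<lambda>h. u h - f h) < \<epsilon>/3"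
    using approximable_L2[OF u] unfolding approximable_def
    by (meson divide_pos_pos zero_less_numeral)
  obtain C where C: "\<And>h. h \<in> Omega \<Longrightarrow> \<bar>f h\<bar> \<le> C" using f(1) by (auto simp: bounded_cts_def)
  have fm [measurable]: "f \<in> borel_measurable P" using f(1) by (simp add: bounded_cts_def)
  have um [measurable]: "u \<in> borel_measurable P" using u by (rule L2_measurable)
  have fL: "f \<in> L2 P" by (rule bounded_cts_L2[OF f(1)])
  have "((\<lambda>x. L2_norm P (\<lambda>h. f (shift x h) - f h)) \<longlongrightarrow> 0) (at 0)"
    unfolding tendsto_at_iff_sequentially o_def
  proof (intro allI impI)
    fix X :: "nat \<Rightarrow> real^'n" assume X: "\<forall>i. X i \<in> UNIV - {0}" "X \<longlonglongrightarrow> 0"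
    show "(\<lambda>n. L2_norm P (\<lambda>h. f (shift (X n) h) - f h)) \<longlonglongrightarrow> 0"
    proof (rule L2_norm_bounded_tendsto[where C=C])
      show "AE h in P. (\<lambda>n. f (shift (X n) h)) \<longlonglongrightarrow> f h"
      proof (rule AE_I2)
        fix h assume "h \<in> space P"
        then have "continuous_on UNIV (\<lambda>x. f (shift x h))" using f(1) by (simp add: bounded_cts_def)
        from continuous_on_tendsto_compose[OF this X(2)] show "(\<lambda>n. f (shift (X n) h)) \<longlonglongrightarrow> f h" by simp
      qed
    qed (use C in \<open>auto intro!: AE_I2\<close>)
  qed
  then have "\<forall>\<^sub>F x in at 0. dist (L2_norm P (\<lambda>h. f (shift x h) - f h)) 0 < \<epsilon>/3"
    using e by (intro tendstoD) auto
  then show "\<forall>\<^sub>F x in at 0. dist (L2_norm P (\<lambda>h. u (shift x h) - u h)) 0 < \<epsilon>"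
  proof eventually_elim
    case (elim x)
    note sL = L2_shift[of _ x]
    have "L2_norm P (\<lambda>h. u (shift x h) - u h)
        \<le> L2_norm P (\<lambda>h. u (shift x h) - f (shift x h)) + L2_norm P (\<lambda>h. f (shift x h) - u h)"
      by (intro L2_norm_triangle_diff sL u fL)
    also have "L2_norm P (\<lambda>h. f (shift x h) - u h) \<le> L2_norm P (\<lambda>h. f (shift x h) - f h) + L2_norm P (\<lambda>h. f h - u h)"
      by (intro L2_norm_triangle_diff sL u fL)
    also have "L2_norm P (\<lambda>h. u (shift x h) - f (shift x h)) = L2_norm P (\<lambda>h. u h - f h)"
      using L2_norm_shift[of "\<lambda>h. u h - f h" x] by simp
    finally show ?case using elim f(2) by (simp add: L2_norm_diff_commute[of P f u])
  qed
qed

lemma correlation_continuous: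
  fixes u v :: "_ \<Rightarrow> real"
  assumes u: "u \<in> L2 P" and v: "v \<in> L2 P"
  shows "continuous_on UNIV (\<lambda>x. LINT h|P. u h * v (shift x h))"
  unfolding continuous_on_eq_continuous_at[OF open_UNIV] continuous_at
proof
  fix x0 :: "real^'n"
  have vm [measurable]: "v \<in> borel_measurable P" using v by (rule L2_measurable)
  have "((\<lambda>y. L2_norm P u * L2_norm P (\<lambda>h. v (shift y h) - v h)) \<longlongrightarrow> L2_norm P u * 0) (at 0)"
    by (intro tendsto_intros L2_shift_continuous v)
  then have l: "((\<lambda>y. L2_norm P u * L2_norm P (\<lambda>h. v (shift y h) - v h)) \<longlongrightarrow> 0) (at 0)" by simp
  have bd: "\<bar>(LINT h|P. u h * v (shift (x0 + y) h)) - (LINT h|P. u h * v (shift x0 h))\<bar>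
      \<le> L2_norm P u * L2_norm P (\<lambda>h. v (shift y h) - v h)" for y
  proof -
    have "(LINT h|P. u h * v (shift (x0 + y) h)) - (LINT h|P. u h * v (shift x0 h))
        = (LINT h|P. u h \<bullet> (v (shift (x0 + y) h) - v (shift x0 h)))"
      using u v by (simp add: L2_mult_integrable L2_shift right_diff_distrib)
    also have "\<bar>\<dots>\<bar> \<le> L2_norm P u * L2_norm P (\<lambda>h. v (shift (x0 + y) h) - v (shift x0 h))"
      by (intro L2_Cauchy_Schwarz u L2_diff L2_shift v)
    also have "L2_norm P (\<lambda>h. v (shift (x0 + y) h) - v (shift x0 h)) = L2_norm P (\<lambda>h. v (shift y h) - v h)"
      using L2_norm_shift[of "\<lambda>h. v (shift y h) - v h" x0] by (simp add: shift_shift add.commute)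
    finally show ?thesis .
  qed
  have "((\<lambda>y. (LINT h|P. u h * v (shift (x0 + y) h)) - (LINT h|P. u h * v (shift x0 h))) \<longlongrightarrow> 0) (at 0)"
    by (rule Lim_null_comparison[OF _ l]) (use bd in \<open>auto intro!: always_eventually\<close>)
  then have "((\<lambda>y. LINT h|P. u h * v (shift (x0 + y) h)) \<longlongrightarrow> (LINT h|P. u h * v (shift x0 h))) (at 0)"
    by (simp add: LIM_zero_iff)
  then show "((\<lambda>x. LINT h|P. u h * v (shift x h)) \<longlongrightarrow> (LINT h|P. u h * v (shift x0 h))) (at x0)"
    by (subst LIM_offset_zero_iff) auto
qed

text \<open>Ergodicity is assumed for strictly invariant sets, whereas the sublevel set of
  \<open>u\<close> is invariant only up to a null set that depends on the translation. The set
  \<open>B\<close> asks for \<open>u (shift x h) \<le> t\<close> at Lebesgue almost every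
  \<open>x\<close>; it is strictly invariant because Lebesgue null sets are, and by Fubini it
  differs from the sublevel set by a null set.\<close>

lemma ergodic_sublevel:
  fixes u :: "_ \<Rightarrow> real"
  assumes um [measurable]: "u \<in> borel_measurable P" and inv: "\<And>x. AE h in P. u (shift x h) = u h"
  shows "(AE h in P. u h \<le> t) \<or> (AE h in P. t < u h)"
proof -
  define B where "B = {h\<in>space P. AE x in lborel. u (shift x h) \<le> t}"
  interpret pair_sigma_finite lborel P ..
  have pm: "(\<lambda>p. u (shift (fst p) (snd p))) \<in> borel_measurable (lborel \<Otimes>\<^sub>M P)"
    using measurable_compose[OF shift_pair_measurable_P um] by (simp add: split_beta')
  have "B = {h\<in>space P. emeasure lborel {x. t < u (shift x h)} = 0}"
    unfolding B_def
  proof (intro Collect_cong conj_cong refl)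
    fix h assume h: "h \<in> space P"
    have "(\<lambda>x. u (shift x h)) \<in> borel_measurable lborel"
      using measurable_compose[OF measurable_Pair2'[OF h] pm] by simp
    then have "{x. t < u (shift x h)} \<in> sets lborel" by measurable
    then show "(AE x in lborel. u (shift x h) \<le> t) = (emeasure lborel {x. t < u (shift x h)} = 0)"
      by (subst AE_iff_measurable[OF _ refl]) (auto simp: not_le)
  qed
  also have "\<dots> \<in> sets P"
  proof -
    have "{p \<in> space (lborel \<Otimes>\<^sub>M P). t < u (shift (fst p) (snd p))} \<in> sets (lborel \<Otimes>\<^sub>M P)"
      using pm by measurable
    from measurable_emeasure_Pair2[OF this]
    have "(\<lambda>h. emeasure lborel ((\<lambda>x. (x, h)) -` {p \<in> space (lborel \<Otimes>\<^sub>M P). t < u (shift (fst p) (snd p))})) \<in> borel_measurable P" .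
    then have "{h \<in> space P. emeasure lborel ((\<lambda>x. (x, h)) -` {p \<in> space (lborel \<Otimes>\<^sub>M P). t < u (shift (fst p) (snd p))}) = 0} \<in> sets P"
      by measurable
    also have "{h \<in> space P. emeasure lborel ((\<lambda>x. (x, h)) -` {p \<in> space (lborel \<Otimes>\<^sub>M P). t < u (shift (fst p) (snd p))}) = 0}
        = {h\<in>space P. emeasure lborel {x. t < u (shift x h)} = 0}"
      by (intro Collect_cong conj_cong refl arg_cong2[where f="(=)"] arg_cong2[where f=emeasure])
        (auto simp: space_pair_measure)
    finally show ?thesis .
  qed
  finally have B: "B \<in> sets P" .
  have sub: "shift y ` B \<subseteq> B" for y
  proof
    fix h' assume "h' \<in> shift y ` B"
    then obtain h where h: "h \<in> Omega" "AE x in lborel. u (shift x h) \<le> t" "h' = shift y h"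
      by (auto simp: B_def)
    have "AE x in lborel. u (shift (x + y) h) \<le> t" by (rule AE_lborel_translate[OF h(2)])
    then show "h' \<in> B" using h by (simp add: B_def shift_shift)
  qed
  have "shift y ` B = B" for y
  proof
    show "B \<subseteq> shift y ` B"
    proof
      fix h assume "h \<in> B"
      then have "shift (- y) h \<in> B" using sub by blast
      then have "shift y (shift (- y) h) \<in> shift y ` B" by blast
      then show "h \<in> shift y ` B" by (simp add: shift_shift)
    qed
  qed (rule sub)
  then have B01: "measure P B = 0 \<or> measure P B = 1"
    using admissible B by (auto simp: admissible_def)
  \<comment> \<open>Fubini exchanges the quantifiers: from every \<open>x\<close> and almost every
    \<open>h\<close> to almost every \<open>h\<close> and almost every \<open>x\<close>.\<close>
  have "{p\<in>space (lborel \<Otimes>\<^sub>M P). u (shift (fst p) (snd p)) = u (snd p)} \<in> sets (lborel \<Otimes>\<^sub>M P)"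
    using pm by measurable
  from AE_commute[OF this] inv
  have "AE h in P. AE x in lborel. u (shift x h) = u h" by simp
  then have iff: "AE h in P. (h \<in> B \<longleftrightarrow> u h \<le> t)"
    using AE_space
  proof eventually_elim
    case (elim h)
    have "(AE x in (lborel :: (real^'n) measure). u (shift x h) \<le> t) \<longleftrightarrow> (AE x in (lborel :: (real^'n) measure). u h \<le> t)"
    proof
      assume "AE x in (lborel :: (real^'n) measure). u (shift x h) \<le> t"
      with elim(1) show "AE x in (lborel :: (real^'n) measure). u h \<le> t" by eventually_elim simp
    next
      assume "AE x in (lborel :: (real^'n) measure). u h \<le> t"
      with elim(1) show "AE x in (lborel :: (real^'n) measure). u (shift x h) \<le> t" by eventually_elim simp
    qed
    then show ?case using elim(2) by (simp add: B_def AE_lborel_const)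
  qed
  from B01 show ?thesis
  proof
    assume "measure P B = 0"
    then have "AE h in P. h \<notin> B"
      using B by (intro AE_not_in) (simp add: null_sets_def emeasure_eq_measure)
    with iff have "AE h in P. t < u h" by eventually_elim auto
    then show ?thesis ..
  next
    assume "measure P B = 1"
    then have "AE h in P. h \<in> B" using B prob_eq_1 by blast
    with iff have "AE h in P. u h \<le> t" by eventually_elim auto
    then show ?thesis ..
  qed
qed

text \<open>Almost surely \<open>u\<close> stays on one side of each threshold. For thresholds
  slightly below and slightly above the mean, the mean itself decides on which side.\<close>

lemma invariant_AE_const:
  fixes u :: "_ \<Rightarrow> real"
  assumes int: "integrable P u" and inv: "\<And>x. AE h in P. u (shift x h) = u h"
  shows "AE h in P. u h = (LINT h|P. u h)"
proof -
  let ?c = "LINT h|P. u h"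
  have um [measurable]: "u \<in> borel_measurable P" using int by auto
  have lo: "AE h in P. ?c - inverse (real (Suc n)) < u h" for n
  proof -
    let ?t = "?c - inverse (real (Suc n))"
    have False if "AE h in P. u h \<le> ?t"
    proof -
      have "?c \<le> (LINT h|P. ?t)" using that int by (intro integral_mono_AE) auto
      then show False by (simp add: prob_space)
    qed
    then show ?thesis using ergodic_sublevel[OF um inv, of ?t] by blast
  qed
  have hi: "AE h in P. u h \<le> ?c + inverse (real (Suc n))" for n
  proof -
    let ?t = "?c + inverse (real (Suc n))"
    have False if "AE h in P. ?t < u h"
    proof -
      have "(LINT h|P. ?t) \<le> ?c" using that int by (intro integral_mono_AE) auto
      then show False by (simp add: prob_space)
    qed
    then show ?thesis using ergodic_sublevel[OF um inv, of ?t] by blast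
  qed
  have "AE h in P. \<forall>n. \<bar>u h - ?c\<bar> \<le> inverse (real (Suc n))"
    unfolding AE_all_countable
  proof
    fix n show "AE h in P. \<bar>u h - ?c\<bar> \<le> inverse (real (Suc n))"
      using lo[of n] hi[of n] by eventually_elim auto
  qed
  then show ?thesis
  proof eventually_elim
    case (elim h)
    have "\<bar>u h - ?c\<bar> \<le> 0"
      by (rule LIMSEQ_le_const[OF LIMSEQ_inverse_real_of_nat]) (use elim in auto)
    then show ?case by simp
  qed
qed

text \<open>The element of minimal norm among all fields with the same correlation with \<open>q\<close> and the same
  mean is unique, hence invariant under translations, hence constant by ergodicity.\<close>

lemma correlation_eq_product_of_means:
  fixes q p :: "_ \<Rightarrow> real^'m"
  assumes q: "q \<in> L2 P" and p: "p \<in> L2 P"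
    and const: "\<And>x. (LINT h|P. q h \<bullet> p (shift x h)) = c"
  shows "c = (LINT h|P. q h) \<bullet> (LINT h|P. p h)"
proof -
  let ?m = "LINT h|P. p h"
  \<comment> \<open>Besides being closed under midpoints and L2 limits, \<open>K\<close> is
    invariant under translations, because the correlation is prescribed at every
    \<open>x\<close>.\<close>
  define K where "K = {u \<in> L2 P. (\<forall>x. (LINT h|P. q h \<bullet> u (shift x h)) = c) \<and> (LINT h|P. u h) = ?m}"
  obtain f where f: "f \<in> K" "\<And>g. g \<in> K \<Longrightarrow> L2_norm P g \<le> L2_norm P f \<Longrightarrow> (AE x in P. f x = g x)"
  proof (rule L2_min_norm[of K])
    show "K \<subseteq> L2 P" by (auto simp: K_def)
    show "K \<noteq> {}" using p const by (auto simp: K_def)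
  next
    fix u v assume uv: "u \<in> K" "v \<in> K"
    then have L: "u \<in> L2 P" "v \<in> L2 P" by (auto simp: K_def)
    have "(LINT h|P. q h \<bullet> ((1/2) *\<^sub>R (u (shift x h) + v (shift x h)))) = c" for x
    proof -
      have "(LINT h|P. q h \<bullet> ((1/2) *\<^sub>R (u (shift x h) + v (shift x h))))
          = (LINT h|P. (1/2) * (q h \<bullet> u (shift x h)) + (1/2) * (q h \<bullet> v (shift x h)))"
        by (simp add: inner_add_right algebra_simps)
      also have "\<dots> = (1/2) * (LINT h|P. q h \<bullet> u (shift x h)) + (1/2) * (LINT h|P. q h \<bullet> v (shift x h))"
        using L2_inner_integrable[OF q L2_shift[OF L(1)]] L2_inner_integrable[OF q L2_shift[OF L(2)]]
        by (subst Bochner_Integration.integral_add) auto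
      also have "\<dots> = c" using uv by (simp add: K_def)
      finally show ?thesis .
    qed
    moreover have "(LINT h|P. (1/2) *\<^sub>R (u h + v h)) = ?m"
    proof -
      have "(LINT h|P. (1/2) *\<^sub>R (u h + v h)) = (1/2) *\<^sub>R ((LINT h|P. u h) + (LINT h|P. v h))"
        using L[THEN L2_integrable] by simp
      also have "\<dots> = ?m" using uv by (simp add: K_def scaleR_2[symmetric])
      finally show ?thesis .
    qed
    ultimately show "(\<lambda>h. (1/2) *\<^sub>R (u h + v h)) \<in> K"
      using L by (simp add: K_def L2_scaleR L2_add)
  next
    fix u :: "nat \<Rightarrow> _" and v
    assume u: "\<And>n. u n \<in> K" and v: "v \<in> L2 P" and lim: "(\<lambda>n. L2_norm P (\<lambda>h. u n h - v h)) \<longlonglongrightarrow> 0"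
    have uL: "u n \<in> L2 P" for n using u by (auto simp: K_def)
    have qv: "(\<lambda>n. LINT h|P. w h \<bullet> u n (shift x h)) \<longlonglongrightarrow> (LINT h|P. w h \<bullet> v (shift x h))" if "w \<in> L2 P" for x w
    proof (rule L2_inner_tendsto)
      have "L2_norm P (\<lambda>h. u n (shift x h) - v (shift x h)) = L2_norm P (\<lambda>h. u n h - v h)" for n
        using L2_norm_shift[of "\<lambda>h. u n h - v h" x] L2_measurable[OF L2_diff[OF uL v]] by blast
      then show "(\<lambda>n. L2_norm P (\<lambda>h. u n (shift x h) - v (shift x h))) \<longlonglongrightarrow> 0" using lim by simp
    qed (use that uL v in \<open>auto simp: L2_shift L2_norm_def\<close>)
    have "(LINT h|P. q h \<bullet> v (shift x h)) = c" for x
      using qv[OF q, of x] u by (simp add: K_def LIMSEQ_const_iff)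
    moreover have "(LINT h|P. v h) = ?m"
    proof (rule vector_eq_rdot[THEN iffD1], rule allI)
      fix z :: "real^'m"
      have "(\<lambda>n. LINT h|P. z \<bullet> u n (shift 0 h)) \<longlonglongrightarrow> (LINT h|P. z \<bullet> v (shift 0 h))"
        by (rule qv[OF L2_const])
      then have "(\<lambda>n. z \<bullet> (LINT h|P. u n h)) \<longlonglongrightarrow> z \<bullet> (LINT h|P. v h)"
        using L2_integrable[OF uL] L2_integrable[OF v] by simp
      then show "(LINT h|P. v h) \<bullet> z = ?m \<bullet> z"
        using u by (simp add: K_def LIMSEQ_const_iff inner_commute)
    qed
    ultimately show "v \<in> K" using v by (simp add: K_def)
  qed blast
  then have fL: "f \<in> L2 P" and fc: "\<And>x. (LINT h|P. q h \<bullet> f (shift x h)) = c" and fm: "(LINT h|P. f h) = ?m"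
    by (auto simp: K_def)
  have inv: "AE h in P. f (shift x h) = f h" for x
  proof -
    have "(\<lambda>h. f (shift x h)) \<in> K"
      using fL fc fm integral_shift[OF L2_measurable[OF fL]] by (simp add: K_def L2_shift shift_shift add.commute)
    then have "AE h in P. f h = f (shift x h)"
      using f(2) L2_norm_shift[OF L2_measurable[OF fL]] by simp
    then show ?thesis by eventually_elim simp
  qed
  have "AE h in P. \<forall>i. f h $ i = ?m $ i"
    unfolding AE_all_countable
  proof
    fix i
    have comp: "(LINT h|P. f h $ i) = ?m $ i"
      using L2_integrable[OF fL] by (simp add: cart_eq_inner_axis fm[symmetric])
    have "AE h in P. f h $ i = (LINT h|P. f h $ i)"
    proof (rule invariant_AE_const)
      show "integrable P (\<lambda>h. f h $ i)" by (rule L2_integrable[OF L2_component[OF fL]])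
      show "AE h in P. f (shift x h) $ i = f h $ i" for x using inv[of x] by eventually_elim simp
    qed
    then show "AE h in P. f h $ i = ?m $ i" unfolding comp .
  qed
  then have fconst: "AE h in P. f h = ?m" by eventually_elim (simp add: vec_eq_iff)
  have "c = (LINT h|P. q h \<bullet> f h)" using fc[of 0] by simp
  also have "\<dots> = (LINT h|P. q h \<bullet> ?m)"
    by (rule integral_cong_AE) (use fconst q[THEN L2_measurable] fL[THEN L2_measurable] in \<open>auto elim!: eventually_mono\<close>)
  also have "\<dots> = (LINT h|P. q h) \<bullet> ?m" using L2_integrable[OF q] by simp
  finally show ?thesis .
qed

end

section \<open>Stochastic derivatives\<close>

lemma has_real_derivative_along_axis:
  fixes F :: "real^'n::finite \<Rightarrow> real"
  assumes "F differentiable (at (t *\<^sub>R axis i 1))"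
  shows "((\<lambda>s. F (s *\<^sub>R axis i 1)) has_real_derivative partial i F (t *\<^sub>R axis i 1)) (at t)"
proof -
  let ?e = "axis i 1 :: real^'n"
  have "(\<lambda>s::real. s *\<^sub>R ?e) differentiable (at t)" by (intro derivative_intros)
  then have "(F \<circ> (\<lambda>s::real. s *\<^sub>R ?e)) differentiable (at t)"
    using assms by (intro differentiable_chain_at) auto
  then obtain D where D: "((\<lambda>s. F (s *\<^sub>R ?e)) has_real_derivative D) (at t)"
    by (auto simp: o_def real_differentiable_def)
  then have "((\<lambda>s. F (t *\<^sub>R ?e + s *\<^sub>R ?e)) has_real_derivative D) (at 0)"
    using DERIV_shift[of "\<lambda>s. F (s *\<^sub>R ?e)" D 0 t] by (simp add: scaleR_add_left add.commute)
  then have "partial i F (t *\<^sub>R ?e) = D" unfolding partial_def by (rule DERIV_imp_deriv)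
  with D show ?thesis by simp
qed

lemma partial_eqI:
  fixes F :: "real^'n::finite \<Rightarrow> real"
  assumes "(F has_derivative F') (at x)"
  shows "partial i F x = F' (axis i 1)"
proof -
  have "((\<lambda>t::real. x + t *\<^sub>R axis i 1) has_derivative (\<lambda>t. t *\<^sub>R axis i 1)) (at 0)"
    by (auto intro!: derivative_eq_intros)
  then have "((\<lambda>t. F (x + t *\<^sub>R axis i 1)) has_derivative (\<lambda>t. F' (t *\<^sub>R axis i 1))) (at 0)"
    by (rule has_derivative_compose) (simp add: assms)
  moreover have "F' (t *\<^sub>R axis i 1) = F' (axis i 1) * t" for t
    using linear_cmul[OF has_derivative_linear[OF assms]] by (simp add: mult.commute)
  ultimately have "((\<lambda>t. F (x + t *\<^sub>R axis i 1)) has_real_derivative F' (axis i 1)) (at 0)"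
    by (simp add: has_field_derivative_def)
  then show ?thesis unfolding partial_def by (rule DERIV_imp_deriv)
qed

abbreviation along :: "'n::finite \<Rightarrow> real \<Rightarrow> (real^'n \<Rightarrow> real) \<Rightarrow> real^'n \<Rightarrow> real" where
  "along i t \<equiv> shift (t *\<^sub>R axis i 1)"

context random_surface
begin

abbreviation diff_quot :: "'n \<Rightarrow> real \<Rightarrow> ((real^'n \<Rightarrow> real) \<Rightarrow> real) \<Rightarrow> (real^'n \<Rightarrow> real) \<Rightarrow> real" where
  "diff_quot i t V h \<equiv> (V (along i t h) - V h) / t"

lemma diff_quot_L2: "V \<in> L2 P \<Longrightarrow> diff_quot i t V \<in> L2 P"
  using L2_cmult[OF L2_diff[OF L2_shift[of V "t *\<^sub>R axis i 1"]], of V "1/t"] by simp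

lemma has_stoch_deriv_sequentially:
  assumes "has_stoch_deriv P i V W" "\<And>n::nat. X n \<noteq> 0" "X \<longlonglongrightarrow> 0"
  shows "(\<lambda>n. L2_norm P (\<lambda>h. diff_quot i (X n) V h - W h)) \<longlonglongrightarrow> 0"
  using assms unfolding has_stoch_deriv_def tendsto_at_iff_sequentially by (auto simp: o_def)

lemma has_stoch_deriv_unique:
  assumes "has_stoch_deriv P i V W" "has_stoch_deriv P i V W'"
  shows "AE h in P. W h = W' h"
  by (rule L2_limit_unique[of "at (0::real)" "\<lambda>t. diff_quot i t V"])
    (use assms in \<open>auto simp: has_stoch_deriv_def intro!: always_eventually diff_quot_L2\<close>)

lemma has_stoch_deriv_stoch_deriv:
  assumes "has_stoch_deriv P i V W"
  shows "has_stoch_deriv P i V (stoch_deriv P i V)"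
  unfolding stoch_deriv_def by (rule someI[of "has_stoch_deriv P i V" W, OF assms])

lemma stoch_deriv_AE_eq:
  assumes "has_stoch_deriv P i V W"
  shows "AE h in P. stoch_deriv P i V h = W h"
  by (rule has_stoch_deriv_unique[OF has_stoch_deriv_stoch_deriv[OF assms] assms])

text \<open>The difference quotients in the two directions commute, so no second derivatives are needed.\<close>

lemma has_stoch_deriv_by_parts_mixed:
  assumes V: "has_stoch_deriv P i V Wi" "has_stoch_deriv P j V Wj"
    and V': "has_stoch_deriv P i V' Wi'" "has_stoch_deriv P j V' Wj'"
  shows "(LINT h|P. Wi h * Wj' h) = (LINT h|P. Wj h * Wi' h)"
proof -
  let ?X = "\<lambda>n. inverse (real (Suc n))"
  let ?R = "\<lambda>x. LINT h|P. V (shift x h) * V' h"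
  have L: "V \<in> L2 P" "V' \<in> L2 P" "Wi \<in> L2 P" "Wj \<in> L2 P" "Wi' \<in> L2 P" "Wj' \<in> L2 P"
    using V V' by (auto simp: has_stoch_deriv_def)
  note [measurable] = L(1,2)[THEN L2_measurable]
  have Xneg: "(\<lambda>n. - ?X n) \<longlonglongrightarrow> 0"
    using tendsto_minus[OF LIMSEQ_inverse_real_of_nat] by simp
  have R: "(LINT h|P. V (shift x h) * V' (shift y h)) = ?R (x - y)" for x y
    using integral_shift[of "\<lambda>h. V (shift (x - y) h) * V' h" y]
    by (simp add: shift_shift measurable_compose[OF shift_measurable_P])
  have alg: "(a - b) / t * ((c - d) / t) = (a * c - a * d - b * c + b * d) / t\<^sup>2" for a b c d t :: real
    by (simp add: power2_eq_square algebra_simps diff_divide_distrib add_divide_distrib)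
  have quot: "(LINT h|P. diff_quot i t V h * diff_quot j t V' h)
      = (?R (t *\<^sub>R axis i 1 - t *\<^sub>R axis j 1) - ?R (t *\<^sub>R axis i 1) - ?R (- (t *\<^sub>R axis j 1)) + ?R 0) / t\<^sup>2" for i j t
  proof -
    let ?x = "t *\<^sub>R axis i 1 :: real^'n" and ?y = "t *\<^sub>R axis j 1 :: real^'n"
    note [simp] = L2_mult_integrable[OF L2_shift[OF L(1)] L2_shift[OF L(2)]]
      L2_mult_integrable[OF L2_shift[OF L(1)] L(2)] L2_mult_integrable[OF L(1) L2_shift[OF L(2)]]
      L2_mult_integrable[OF L(1) L(2)]
    have "(LINT h|P. diff_quot i t V h * diff_quot j t V' h)
        = (LINT h|P. (V (shift ?x h) * V' (shift ?y h) - V (shift ?x h) * V' h - V h * V' (shift ?y h) + V h * V' h) / t\<^sup>2)"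
      unfolding alg ..
    also have "\<dots> = ((LINT h|P. V (shift ?x h) * V' (shift ?y h)) - (LINT h|P. V (shift ?x h) * V' h)
        - (LINT h|P. V h * V' (shift ?y h)) + (LINT h|P. V h * V' h)) / t\<^sup>2"
      by simp
    finally show ?thesis
      using R[of ?x ?y] R[of 0 ?y] by simp
  qed
  have "(\<lambda>n. LINT h|P. diff_quot i (?X n) V h \<bullet> diff_quot j (?X n) V' h) \<longlonglongrightarrow> (LINT h|P. Wi h \<bullet> Wj' h)"
    using L by (intro L2_inner_tendsto always_eventually allI diff_quot_L2
        has_stoch_deriv_sequentially[OF V(1)] has_stoch_deriv_sequentially[OF V'(2)] LIMSEQ_inverse_real_of_nat) auto
  \<comment> \<open>By stationarity the products depend only on differences of shifts. Exchanging
    the two directions and reversing both steps leaves these differences the same, so this sequence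
    coincides with the previous one.\<close>
  moreover have "(\<lambda>n. LINT h|P. diff_quot j (- ?X n) V h \<bullet> diff_quot i (- ?X n) V' h) \<longlonglongrightarrow> (LINT h|P. Wj h \<bullet> Wi' h)"
    using L Xneg by (intro L2_inner_tendsto always_eventually allI diff_quot_L2
        has_stoch_deriv_sequentially[OF V(2)] has_stoch_deriv_sequentially[OF V'(1)]) auto
  moreover have "(LINT h|P. diff_quot j (- t) V h \<bullet> diff_quot i (- t) V' h) = (LINT h|P. diff_quot i t V h \<bullet> diff_quot j t V' h)" for t
    unfolding inner_real_def quot by (simp add: algebra_simps)
  ultimately have "(LINT h|P. Wi h \<bullet> Wj' h) = (LINT h|P. Wj h \<bullet> Wi' h)"
    using LIMSEQ_unique by (simp only:) blast
  then show ?thesis by simp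
qed

lemma has_stoch_deriv_const: "has_stoch_deriv P i (\<lambda>h. c) (\<lambda>h. 0)"
  by (simp add: has_stoch_deriv_def L2_const L2_norm_def)

text \<open>Stationarity moves a translation to the other factor with opposite sign, so the
  difference quotient of step \<open>t\<close> on \<open>V\<close> becomes the negative of that of
  step \<open>- t\<close> on \<open>V'\<close>.\<close>

lemma has_stoch_deriv_by_parts:
  assumes V: "has_stoch_deriv P i V W" and V': "has_stoch_deriv P i V' W'"
  shows "(LINT h|P. W h * V' h) = - (LINT h|P. V h * W' h)"
proof -
  let ?X = "\<lambda>n. inverse (real (Suc n))"
  have L: "V \<in> L2 P" "V' \<in> L2 P" "W \<in> L2 P" "W' \<in> L2 P"
    using V V' by (auto simp: has_stoch_deriv_def)
  note [measurable] = L[THEN L2_measurable]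
  have Xneg: "(\<lambda>n. - ?X n) \<longlonglongrightarrow> 0"
    using tendsto_minus[OF LIMSEQ_inverse_real_of_nat] by simp
  have quot: "(LINT h|P. diff_quot i t V h \<bullet> V' h) = - (LINT h|P. diff_quot i (- t) V' h \<bullet> V h)" for t
  proof -
    let ?x = "t *\<^sub>R axis i 1 :: real^'n"
    note [simp] = L2_mult_integrable[OF L2_shift[OF L(1)] L(2)] L2_mult_integrable[OF L(1) L2_shift[OF L(2)]]
      L2_mult_integrable[OF L(1) L(2)]
    have "(LINT h|P. diff_quot i t V h \<bullet> V' h) = (LINT h|P. (V (shift ?x h) * V' h - V h * V' h) / t)"
      by (simp add: left_diff_distrib)
    also have "\<dots> = ((LINT h|P. V (shift ?x h) * V' h) - (LINT h|P. V h * V' h)) / t" by simp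
    also have "(LINT h|P. V (shift ?x h) * V' h) = (LINT h|P. V h * V' (shift (- ?x) h))"
      using integral_shift[of "\<lambda>h. V h * V' (shift (- ?x) h)" ?x]
      by (simp add: shift_shift measurable_compose[OF shift_measurable_P])
    also have "((LINT h|P. V h * V' (shift (- ?x) h)) - (LINT h|P. V h * V' h)) / t
        = (LINT h|P. (V h * V' (shift (- ?x) h) - V h * V' h) / t)"
      by simp
    also have "\<dots> = (LINT h|P. - (diff_quot i (- t) V' h \<bullet> V h))"
      by (intro Bochner_Integration.integral_cong refl) (simp add: algebra_simps diff_divide_distrib)
    finally show ?thesis by simp
  qed
  have "(\<lambda>n. LINT h|P. diff_quot i (?X n) V h \<bullet> V' h) \<longlonglongrightarrow> (LINT h|P. W h \<bullet> V' h)"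
    using L by (intro L2_inner_tendsto_left always_eventually allI diff_quot_L2
        has_stoch_deriv_sequentially[OF V] LIMSEQ_inverse_real_of_nat) auto
  moreover have "(\<lambda>n. LINT h|P. diff_quot i (- ?X n) V' h \<bullet> V h) \<longlonglongrightarrow> (LINT h|P. W' h \<bullet> V h)"
    using L Xneg by (intro L2_inner_tendsto_left always_eventually allI diff_quot_L2
        has_stoch_deriv_sequentially[OF V']) auto
  then have "(\<lambda>n. LINT h|P. diff_quot i (?X n) V h \<bullet> V' h) \<longlonglongrightarrow> - (LINT h|P. W' h \<bullet> V h)"
    unfolding quot by (rule tendsto_minus)
  ultimately have "(LINT h|P. W h \<bullet> V' h) = - (LINT h|P. W' h \<bullet> V h)"
    by (rule LIMSEQ_unique)
  then show ?thesis by (simp add: mult.commute)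
qed

lemma has_stoch_deriv_mean_zero:
  assumes "has_stoch_deriv P i V W"
  shows "(LINT h|P. W h) = 0"
  using has_stoch_deriv_by_parts[OF assms has_stoch_deriv_const[of i 1]] by simp

section \<open>Functions that are smooth along lines of translations\<close>

abbreviation line_regular :: "'n \<Rightarrow> real \<Rightarrow> ((real^'n \<Rightarrow> real) \<Rightarrow> real) \<Rightarrow> ((real^'n \<Rightarrow> real) \<Rightarrow> real)
    \<Rightarrow> (real^'n \<Rightarrow> real) \<Rightarrow> bool" where
  "line_regular i C V W h \<equiv> \<forall>t. \<bar>V (along i t h)\<bar> \<le> C \<and> \<bar>W (along i t h)\<bar> \<le> C \<and>
     ((\<lambda>s. V (along i s h)) has_real_derivative W (along i t h)) (at t)"

text \<open>A pointwise criterion for stochastic differentiability that is stable under sums and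
  products. It is required only for almost every \<open>h\<close>, because the coefficients inherit
  their bounds from the boundedness in \<open>admissible\<close>, which holds almost surely; for
  such \<open>h\<close> the bounds extend over the whole line.\<close>

definition line_smooth :: "'n \<Rightarrow> ((real^'n \<Rightarrow> real) \<Rightarrow> real) \<Rightarrow> ((real^'n \<Rightarrow> real) \<Rightarrow> real) \<Rightarrow> bool" where
  "line_smooth i V W \<longleftrightarrow> V \<in> borel_measurable P \<and> W \<in> borel_measurable P \<and>
     (\<exists>C. AE h in P. line_regular i C V W h)"

lemma line_smoothE:
  assumes "line_smooth i V W"
  obtains C where "V \<in> borel_measurable P" "W \<in> borel_measurable P"
    "AE h in P. line_regular i C V W h"
  using assms unfolding line_smooth_def by blast

text \<open>The mean value theorem bounds the difference quotients by the bound on \<open>W\<close>,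
  so their pointwise convergence implies convergence in L2.\<close>

lemma line_smooth_imp_has_stoch_deriv:
  assumes "line_smooth i V W"
  shows "has_stoch_deriv P i V W"
proof -
  obtain C where [measurable]: "V \<in> borel_measurable P" "W \<in> borel_measurable P"
    and C: "AE h in P. line_regular i C V W h"
    using assms by (rule line_smoothE)
  have "AE h in P. norm (V h) \<le> C"
    using C
  proof eventually_elim
    case (elim h)
    from elim[rule_format, of 0] show ?case by simp
  qed
  then have VL: "V \<in> L2 P" by (rule L2_bounded[rotated]) simp
  have "AE h in P. norm (W h) \<le> C"
    using C
  proof eventually_elim
    case (elim h)
    from elim[rule_format, of 0] show ?case by simp
  qed
  then have WL: "W \<in> L2 P" by (rule L2_bounded[rotated]) simp
  have "((\<lambda>t. L2_norm P (\<lambda>h. diff_quot i t V h - W h)) \<longlongrightarrow> 0) (at 0)"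
    unfolding tendsto_at_iff_sequentially o_def
  proof (intro allI impI)
    fix X :: "nat \<Rightarrow> real" assume X: "\<forall>i. X i \<in> UNIV - {0}" "X \<longlonglongrightarrow> 0"
    show "(\<lambda>n. L2_norm P (\<lambda>h. diff_quot i (X n) V h - W h)) \<longlonglongrightarrow> 0"
    proof (rule L2_norm_bounded_tendsto[where C=C])
      show "AE h in P. norm (diff_quot i (X n) V h) \<le> C" for n
        using C
      proof eventually_elim
        case (elim h)
        let ?f = "\<lambda>s. V (along i s h)"
        have "norm (?f (X n) - ?f 0) \<le> C * norm (X n - 0)"
          by (rule field_differentiable_bound[of UNIV ?f "\<lambda>t. W (along i t h)"])
            (use elim in \<open>auto intro: DERIV_subset\<close>)
        then show ?case using X by (simp add: divide_le_eq)
      qed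
      show "AE h in P. (\<lambda>n. diff_quot i (X n) V h) \<longlonglongrightarrow> W h"
        using C
      proof eventually_elim
        case (elim h)
        have "((\<lambda>s. V (along i s h)) has_real_derivative W (shift (0 *\<^sub>R axis i 1) h)) (at 0)"
          using elim by blast
        then have "((\<lambda>t. diff_quot i t V h) \<longlongrightarrow> W h) (at 0)"
          by (simp add: has_field_derivative_iff)
        then show ?case using X unfolding tendsto_at_iff_sequentially by (auto simp: o_def)
      qed
    qed simp_all
  qed
  then show ?thesis using VL WL by (simp add: has_stoch_deriv_def)
qed

lemma line_smooth_add:
  assumes "line_smooth i V W" "line_smooth i V' W'"
  shows "line_smooth i (\<lambda>h. V h + V' h) (\<lambda>h. W h + W' h)"
proof -
  obtain C where 1: "V \<in> borel_measurable P" "W \<in> borel_measurable P"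
    and C: "AE h in P. line_regular i C V W h"
    using assms(1) by (rule line_smoothE)
  obtain C' where 2: "V' \<in> borel_measurable P" "W' \<in> borel_measurable P"
    and C': "AE h in P. line_regular i C' V' W' h"
    using assms(2) by (rule line_smoothE)
  show ?thesis
    unfolding line_smooth_def
  proof (intro conjI exI)
    show "AE h in P. \<forall>t. \<bar>V (along i t h) + V' (along i t h)\<bar> \<le> C + C' \<and>
        \<bar>W (along i t h) + W' (along i t h)\<bar> \<le> C + C' \<and>
        ((\<lambda>s. V (along i s h) + V' (along i s h)) has_real_derivative
          W (along i t h) + W' (along i t h)) (at t)"
      using C C'
    proof eventually_elim
      case (elim h)
      show ?case
      proof (intro allI conjI)
        fix t
        note e = elim(1)[THEN spec, of t] elim(2)[THEN spec, of t]
        show "((\<lambda>s. V (along i s h) + V' (along i s h)) has_real_derivative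
            W (along i t h) + W' (along i t h)) (at t)"
          using e by (intro DERIV_add) blast+
        show "\<bar>V (along i t h) + V' (along i t h)\<bar> \<le> C + C'"
          by (rule order_trans[OF abs_triangle_ineq]) (intro add_mono conjunct1[OF e(1)] conjunct1[OF e(2)])
        show "\<bar>W (along i t h) + W' (along i t h)\<bar> \<le> C + C'"
          by (rule order_trans[OF abs_triangle_ineq]) (intro add_mono conjunct1[OF conjunct2[OF e(1)]] conjunct1[OF conjunct2[OF e(2)]])
      qed
    qed
  qed (use 1 2 in auto)
qed

lemma line_smooth_mult:
  assumes "line_smooth i V W" "line_smooth i V' W'"
  shows "line_smooth i (\<lambda>h. V h * V' h) (\<lambda>h. W h * V' h + W' h * V h)"
proof -
  obtain C where 1: "V \<in> borel_measurable P" "W \<in> borel_measurable P"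
    and C: "AE h in P. line_regular i C V W h"
    using assms(1) by (rule line_smoothE)
  obtain C' where 2: "V' \<in> borel_measurable P" "W' \<in> borel_measurable P"
    and C': "AE h in P. line_regular i C' V' W' h"
    using assms(2) by (rule line_smoothE)
  have bd: "\<bar>a * b\<bar> \<le> D * D'" if "\<bar>a\<bar> \<le> D" "\<bar>b\<bar> \<le> D'" for a b D D' :: real
    using that by (simp add: abs_mult mult_mono')
  show ?thesis
    unfolding line_smooth_def
  proof (intro conjI exI)
    show "AE h in P. \<forall>t. \<bar>V (along i t h) * V' (along i t h)\<bar> \<le> C * C' + C' * C \<and>
        \<bar>W (along i t h) * V' (along i t h)
          + W' (along i t h) * V (along i t h)\<bar> \<le> C * C' + C' * C \<and>
        ((\<lambda>s. V (along i s h) * V' (along i s h)) has_real_derivative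
          W (along i t h) * V' (along i t h)
          + W' (along i t h) * V (along i t h)) (at t)"
      using C C'
    proof eventually_elim
      case (elim h)
      show ?case
      proof (intro allI conjI)
        fix t
        note e = elim(1)[THEN spec, of t] elim(2)[THEN spec, of t]
        have "\<bar>V (along i t h) * V' (along i t h)\<bar> \<le> C * C'"
          by (rule bd[OF conjunct1[OF e(1)] conjunct1[OF e(2)]])
        moreover have "0 \<le> C' * C" 
          using order_trans[OF abs_ge_zero conjunct1[OF e(1)]] order_trans[OF abs_ge_zero conjunct1[OF e(2)]]
          by simp
        ultimately show "\<bar>V (along i t h) * V' (along i t h)\<bar> \<le> C * C' + C' * C"
          by linarith
        show "\<bar>W (along i t h) * V' (along i t h)
          + W' (along i t h) * V (along i t h)\<bar> \<le> C * C' + C' * C"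
          by (rule order_trans[OF abs_triangle_ineq]) 
            (intro add_mono bd conjunct1[OF e(1)] conjunct1[OF e(2)]
              conjunct1[OF conjunct2[OF e(1)]] conjunct1[OF conjunct2[OF e(2)]])
        show "((\<lambda>s. V (along i s h) * V' (along i s h)) has_real_derivative
            W (along i t h) * V' (along i t h)
            + W' (along i t h) * V (along i t h)) (at t)"
          using e by (intro DERIV_mult) blast+
      qed
    qed
  qed (use 1 2 in auto)
qed

lemma line_smooth_const: "line_smooth i (\<lambda>h. c) (\<lambda>h. 0)"
  unfolding line_smooth_def by (auto intro!: exI[of _ "\<bar>c\<bar>"])

lemma line_smooth_sum:
  assumes "\<And>j. j \<in> J \<Longrightarrow> line_smooth i (V j) (W j)"
  shows "line_smooth i (\<lambda>h. \<Sum>j\<in>J. V j h) (\<lambda>h. \<Sum>j\<in>J. W j h)"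
  using assms
  by (induction J rule: infinite_finite_induct) (auto intro: line_smooth_add line_smooth_const)

lemma line_smooth_measurable_deriv:
  assumes "V \<in> borel_measurable P"
    and "\<And>h. h \<in> Omega \<Longrightarrow> ((\<lambda>s. V (along i s h)) has_real_derivative W h) (at 0)"
  shows "W \<in> borel_measurable P"
proof (rule borel_measurable_LIMSEQ_metric)
  let ?X = "\<lambda>n. inverse (real (Suc n))"
  show "diff_quot i (?X n) V \<in> borel_measurable P" for n
    using assms(1) by (simp add: measurable_compose[OF shift_measurable_P])
  fix h assume "h \<in> space P"
  then have "((\<lambda>s. V (along i s h)) has_real_derivative W h) (at 0)" using assms(2) by simp
  then have "((\<lambda>t. diff_quot i t V h) \<longlongrightarrow> W h) (at 0)"
    by (simp add: has_field_derivative_iff)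
  moreover have "\<forall>n. ?X n \<in> UNIV - {0}" by simp
  ultimately show "(\<lambda>n. diff_quot i (?X n) V h) \<longlonglongrightarrow> W h"
    using LIMSEQ_inverse_real_of_nat unfolding tendsto_at_iff_sequentially by (auto simp: o_def)
qed

text \<open>For functions in \<open>Cb\<close> with at least one derivative this is a version of
  \<open>stoch_deriv\<close> with a meaning at every surface. It can be translated and
  differentiated again, unlike a version fixed by \<open>SOME\<close>.\<close>

definition path_deriv :: "'n \<Rightarrow> ((real^'n \<Rightarrow> real) \<Rightarrow> real) \<Rightarrow> (real^'n \<Rightarrow> real) \<Rightarrow> real" where
  "path_deriv i V h = partial i (\<lambda>x. V (shift x h)) 0"

lemma path_deriv_shift: "path_deriv i V (shift x h) = partial i (\<lambda>y. V (shift y h)) x"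
proof -
  have "(\<lambda>z. V (shift z (shift x h))) = shift x (\<lambda>y. V (shift y h))"
    by (rule ext) (simp add: shift_shift shift_apply)
  then show ?thesis by (simp add: path_deriv_def partial_shift shift_apply)
qed

lemma Cb_measurable: "V \<in> Cb k \<Longrightarrow> V \<in> borel_measurable P"
  by (simp add: Cb_def sets_P cong: measurable_cong_sets)

lemma Cb_path_deriv_DERIV:
  assumes "V \<in> Cb (Suc k)" "h \<in> Omega"
  shows "((\<lambda>s. V (along i s h)) has_real_derivative path_deriv i V (along i t h)) (at t)"
  unfolding path_deriv_shift
  using assms by (intro has_real_derivative_along_axis) (auto simp: Cb_def)

lemma Cb_path_deriv_measurable:
  assumes "V \<in> Cb (Suc k)"
  shows "path_deriv i V \<in> borel_measurable P"
proof (rule line_smooth_measurable_deriv[OF Cb_measurable[OF assms]])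
  show "((\<lambda>s. V (along i s h)) has_real_derivative path_deriv i V h) (at 0)"
    if "h \<in> Omega" for h
    using Cb_path_deriv_DERIV[OF assms that, of i 0] by simp
qed

lemma Cb_path_deriv:
  assumes V: "V \<in> Cb (Suc k)"
  shows "path_deriv i V \<in> Cb k"
proof -
  have eq: "(\<lambda>x. path_deriv i V (shift x h)) = partial i (\<lambda>x. V (shift x h))" for h
    by (rule ext) (rule path_deriv_shift)
  have *: "\<exists>C. \<forall>h\<in>Omega. \<forall>x. \<bar>partials is (\<lambda>y. path_deriv i V (shift y h)) x\<bar> \<le> C" if "length is \<le> k" for "is"
  proof -
    have "length (i # is) \<le> Suc k" using that by simp
    then have "\<exists>C. \<forall>h\<in>Omega. \<forall>x. \<bar>partials (i # is) (\<lambda>y. V (shift y h)) x\<bar> \<le> C"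
      using V unfolding Cb_def by blast
    then show ?thesis by (simp add: eq)
  qed
  obtain C where C: "\<forall>h\<in>Omega. \<forall>x. \<bar>path_deriv i V (shift x h)\<bar> \<le> C" using *[of "[]"] by auto
  have "\<bar>path_deriv i V h\<bar> \<le> C" if "h \<in> Omega" for h
    using C[rule_format, OF that, of 0] by simp
  moreover have "path_deriv i V \<in> borel_measurable borel_Omega"
    using Cb_path_deriv_measurable[OF V] by (simp add: sets_P cong: measurable_cong_sets)
  moreover have "Ck k (\<lambda>x. path_deriv i V (shift x h))" if "h \<in> Omega" for h
    using V that unfolding eq Cb_def by simp
  ultimately show ?thesis using * unfolding Cb_def by blast
qed

lemma Cb_line_smooth:
  assumes V: "V \<in> Cb (Suc k)"
  shows "line_smooth i V (path_deriv i V)"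
proof -
  obtain C where C: "\<And>h. h \<in> Omega \<Longrightarrow> \<bar>V h\<bar> \<le> C" using V by (auto simp: Cb_def)
  obtain C' where C': "\<And>h. h \<in> Omega \<Longrightarrow> \<bar>path_deriv i V h\<bar> \<le> C'"
    using Cb_path_deriv[OF V, of i] by (auto simp: Cb_def)
  show ?thesis
    unfolding line_smooth_def
  proof (intro conjI exI AE_I2 allI)
    fix h t assume "h \<in> space P"
    then have h: "h \<in> Omega" by simp
    show "\<bar>V (along i t h)\<bar> \<le> max C C'" using C[OF shift_Omega[OF h]] by (simp add: le_max_iff_disj)
    show "\<bar>path_deriv i V (along i t h)\<bar> \<le> max C C'"
      using C'[OF shift_Omega[OF h]] by (simp add: le_max_iff_disj)
    show "((\<lambda>s. V (along i s h)) has_real_derivative path_deriv i V (along i t h)) (at t)"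
      by (rule Cb_path_deriv_DERIV[OF V h])
  qed (use V Cb_measurable Cb_path_deriv_measurable in auto)
qed

lemma Cb_has_stoch_deriv: "V \<in> Cb (Suc k) \<Longrightarrow> has_stoch_deriv P i V (path_deriv i V)"
  by (rule line_smooth_imp_has_stoch_deriv[OF Cb_line_smooth])

lemma Cb_L2: "V \<in> Cb (Suc k) \<Longrightarrow> V \<in> L2 P"
  using Cb_has_stoch_deriv by (auto simp: has_stoch_deriv_def)

definition path_grad :: "((real^'n \<Rightarrow> real) \<Rightarrow> real) \<Rightarrow> (real^'n \<Rightarrow> real) \<Rightarrow> real^'n" where
  "path_grad V h = (\<chi> i. path_deriv i V h)"

lemma path_grad_component [simp]: "path_grad V h $ i = path_deriv i V h"
  by (simp add: path_grad_def)

lemma path_grad_L2: "V \<in> Cb (Suc k) \<Longrightarrow> path_grad V \<in> L2 P"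
  by (rule L2_componentwise) (use Cb_has_stoch_deriv in \<open>auto simp: has_stoch_deriv_def\<close>)

lemma stoch_grad_component [simp]: "stoch_grad P V h $ i = stoch_deriv P i V h"
  by (simp add: stoch_grad_def)

lemma stoch_grad_AE_eq: "V \<in> Cb (Suc k) \<Longrightarrow> AE h in P. stoch_grad P V h = path_grad V h"
  using stoch_deriv_AE_eq[OF Cb_has_stoch_deriv] by (simp add: vec_eq_iff AE_all_countable)

lemma stoch_grad_L2: "V \<in> Cb (Suc k) \<Longrightarrow> stoch_grad P V \<in> L2 P"
  by (rule L2_componentwise)
    (use has_stoch_deriv_stoch_deriv[OF Cb_has_stoch_deriv] in \<open>auto simp: has_stoch_deriv_def\<close>)

end

section \<open>Mollification\<close>

lemma partial_const: "partial i (\<lambda>x. c) = (\<lambda>x. 0)"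
  by (rule ext) (simp add: partial_def)

lemma Ck_const: "Ck k (\<lambda>x. c)"
  by (induction k arbitrary: c) (simp_all add: partial_const)

lemma Ck_minus: "Ck k f \<Longrightarrow> Ck k (\<lambda>x. - f x)"
  using Ck_diff[OF Ck_const[of k 0], of f] by simp

lemma Ck_has_derivative:
  assumes "Ck (Suc k) f"
  shows "(f has_derivative (\<lambda>v. (\<chi> i. partial i f x) \<bullet> v)) (at x)"
proof -
  have "f differentiable (at x)" using assms by simp
  then obtain f' where f': "(f has_derivative f') (at x)" by (auto simp: differentiable_def)
  have "f' v = (\<chi> i. partial i f x) \<bullet> v" for v
  proof -
    have "f' v = f' (\<Sum>i\<in>UNIV. v $ i *\<^sub>R axis i 1)"
      using basis_expansion[of v] by (simp add: scalar_mult_eq_scaleR)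
    also have "\<dots> = (\<Sum>i\<in>UNIV. v $ i * f' (axis i 1))"
      using has_derivative_linear[OF f'] by (simp add: linear_sum linear_cmul)
    finally show ?thesis
      by (simp add: inner_vec_def partial_eqI[OF f'] mult.commute)
  qed
  then have "f' = (\<lambda>v. (\<chi> i. partial i f x) \<bullet> v)" by blast
  then show ?thesis using f' by simp
qed

definition vanishes_outside :: "real \<Rightarrow> ('a::real_normed_vector \<Rightarrow> real) \<Rightarrow> bool" where
  "vanishes_outside r f \<longleftrightarrow> (\<forall>y. norm y > r \<longrightarrow> f y = 0)"

lemma vanishes_outsideD: "vanishes_outside r f \<Longrightarrow> norm y > r \<Longrightarrow> f y = 0"
  by (simp add: vanishes_outside_def)

lemma partial_vanishes_outside:
  assumes "vanishes_outside r f"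
  shows "vanishes_outside r (partial i f)"
  unfolding vanishes_outside_def
proof (intro allI impI)
  fix y :: "real^'a" assume y: "norm y > r"
  have "open {y :: real^'a. norm y > r}" by (intro open_Collect_less continuous_intros)
  then have "(f has_derivative (\<lambda>v. 0)) (at y)"
    using assms y
    by (intro has_derivative_transform_within_open[of "\<lambda>y. 0" _ _ _ "{y. norm y > r}" f])
      (auto simp: vanishes_outside_def)
  from partial_eqI[OF this] show "partial i f y = 0" by simp
qed

lemma partial_uminus:
  assumes "\<And>x. f differentiable (at x)"
  shows "partial i (\<lambda>y. f (- y)) = (\<lambda>y. - partial i f (- y))"
proof
  fix y
  obtain f' where f': "(f has_derivative f') (at (- y))" using assms by (auto simp: differentiable_def)
  have "((\<lambda>y. - y) has_derivative (\<lambda>v. - v)) (at y)" by (auto intro!: derivative_eq_intros)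
  then have "((\<lambda>y. f (- y)) has_derivative (\<lambda>v. f' (- v))) (at y)"
    by (rule has_derivative_compose) (rule f')
  from partial_eqI[OF this, of i] partial_eqI[OF f', of i]
  show "partial i (\<lambda>y. f (- y)) y = - partial i f (- y)"
    using linear_neg[OF has_derivative_linear[OF f']] by simp
qed

lemma Ck_uminus: "Ck k f \<Longrightarrow> Ck k (\<lambda>y. f (- y))"
proof (induction k arbitrary: f)
  case 0
  have "continuous_on UNIV (\<lambda>y. f (- y))"
    by (rule continuous_on_compose2[of UNIV f]) (use 0 in \<open>auto intro!: continuous_intros\<close>)
  then show ?case by simp
next
  case (Suc k)
  have d: "f differentiable (at x)" for x using Suc.prems by simp
  have "(f \<circ> uminus) differentiable (at y)" for y
    using d by (intro differentiable_chain_at) (auto intro!: derivative_intros)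
  then have "(\<lambda>y. f (- y)) differentiable (at y)" for y by (simp add: o_def)
  moreover have "Ck k (partial i (\<lambda>y. f (- y)))" for i
    unfolding partial_uminus[OF d] using Suc by (intro Ck_minus Suc.IH) simp
  ultimately show ?case by simp
qed

lemma integral_lborel_translate:
  fixes f :: "'a::euclidean_space \<Rightarrow> real"
  assumes "f \<in> borel_measurable borel"
  shows "(LINT z|lborel. f (z + c)) = (LINT z|lborel. f z)"
  using integral_distr[of "(+) c" lborel borel f] assms
  by (simp add: lborel_distr_plus add.commute)

lemma integral_lborel_uminus:
  fixes f :: "'a::euclidean_space \<Rightarrow> real"
  assumes "f \<in> borel_measurable borel"
  shows "(LINT z|lborel. f (- z)) = (LINT z|lborel. f z)"
proof -
  have "lborel = distr lborel borel (uminus :: 'a \<Rightarrow> 'a)"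
    using lborel_affine[of "-1" "0 :: 'a"] by (simp add: density_1 one_ennreal_def[symmetric])
  then have "(LINT z|lborel. f z) = (LINT z|distr lborel borel uminus. f z)" by simp
  also have "\<dots> = (LINT z|lborel. f (- z))"
    by (rule integral_distr) (use assms in auto)
  finally show ?thesis by simp
qed

lemma integrable_compact_support:
  fixes f :: "'a::euclidean_space \<Rightarrow> real"
  assumes "continuous_on UNIV f" "vanishes_outside r f"
  shows "integrable lborel f"
proof -
  have "integrable lborel (\<lambda>x. indicator (cball 0 r) x *\<^sub>R f x)"
    by (rule borel_integrable_compact) (use assms(1) continuous_on_subset in auto)
  also have "(\<lambda>x. indicator (cball 0 r) x *\<^sub>R f x) = f"
    using assms(2) by (auto simp: indicator_def fun_eq_iff vanishes_outside_def)
  finally show ?thesis .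
qed

text \<open>Convolution of \<open>F\<close> with the reflection of \<open>\<rho>\<close>. The
  dependence on \<open>x\<close> sits in the kernel alone, so \<open>F\<close> need only be
  continuous; the sign in \<open>z - x\<close> accounts for the minus signs in the derivatives
  below.\<close>

definition moll :: "(real^'n::finite \<Rightarrow> real) \<Rightarrow> (real^'n \<Rightarrow> real) \<Rightarrow> real^'n \<Rightarrow> real" where
  "moll \<rho> F x = (LINT z|lborel. \<rho> (z - x) * F z)"

lemma moll_translate:
  assumes "continuous_on UNIV \<rho>" "continuous_on UNIV F"
  shows "moll \<rho> F x = (LINT z|lborel. \<rho> z * F (z + x))"
proof -
  have "continuous_on UNIV (\<lambda>z. \<rho> (z - x) * F z)"
    by (intro continuous_intros continuous_on_compose2[OF assms(1)] assms(2)) auto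
  then have "(\<lambda>z. \<rho> (z - x) * F z) \<in> borel_measurable borel"
    by (rule borel_measurable_continuous_onI)
  from integral_lborel_translate[OF this, of x] show ?thesis by (simp add: moll_def)
qed

lemma moll_bound:
  assumes \<rho>: "continuous_on UNIV \<rho>" "vanishes_outside r \<rho>"
    and F: "continuous_on UNIV F" "\<And>x. \<bar>F x\<bar> \<le> M"
  shows "\<bar>moll \<rho> F x\<bar> \<le> M * (LINT z|lborel. \<bar>\<rho> z\<bar>)"
proof -
  have c: "continuous_on UNIV (\<lambda>z. \<rho> z * F (z + x))"
    by (intro continuous_intros \<rho>(1) continuous_on_compose2[OF F(1)]) auto
  have "\<bar>moll \<rho> F x\<bar> \<le> (LINT z|lborel. \<bar>\<rho> z * F (z + x)\<bar>)"
    unfolding moll_translate[OF \<rho>(1) F(1)] by (rule integral_abs_bound)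
  also have "\<dots> \<le> (LINT z|lborel. M * \<bar>\<rho> z\<bar>)"
  proof (rule integral_mono)
    show "integrable lborel (\<lambda>z. \<bar>\<rho> z * F (z + x)\<bar>)"
      by (rule integrable_compact_support[of _ r]) (use c \<rho> in \<open>auto simp: vanishes_outside_def intro!: continuous_intros\<close>)
    show "integrable lborel (\<lambda>z. M * \<bar>\<rho> z\<bar>)"
      by (rule integrable_compact_support[of _ r]) (use \<rho> in \<open>auto simp: vanishes_outside_def intro!: continuous_intros\<close>)
    show "\<bar>\<rho> z * F (z + x)\<bar> \<le> M * \<bar>\<rho> z\<bar>" for z
      using mult_right_mono[OF F(2)[of "z + x"], of "\<bar>\<rho> z\<bar>"] by (simp add: abs_mult mult.commute)
  qed
  finally show ?thesis by simp
qed

text \<open>For all \<open>x\<close> near a given point one box serves, and over a fixed box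
  continuity of the integral in a parameter and differentiation under the integral sign are
  available.\<close>

lemma moll_eq_integral_cbox:
  assumes \<rho>: "continuous_on UNIV \<rho>" "vanishes_outside r \<rho>"
    and F: "continuous_on UNIV F"
    and sub: "cball x r \<subseteq> cbox a b"
  shows "moll \<rho> F x = integral (cbox a b) (\<lambda>z. \<rho> (z - x) * F z)"
proof -
  let ?f = "\<lambda>z. \<rho> (z - x) * F z"
  have c: "continuous_on UNIV ?f"
    by (intro continuous_intros continuous_on_compose2[OF \<rho>(1)] F) auto
  have 0: "?f z = 0" if "z \<notin> cbox a b" for z
  proof -
    have "z \<notin> cball x r" using sub that by blast
    then show ?thesis using vanishes_outsideD[OF \<rho>(2), of "z - x"] by (simp add: dist_norm norm_minus_commute)
  qed
  have "integrable lborel (\<lambda>z. indicator (cbox a b) z *\<^sub>R ?f z)"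
    by (rule borel_integrable_compact) (use c continuous_on_subset in auto)
  also have "(\<lambda>z. indicator (cbox a b) z *\<^sub>R ?f z) = ?f"
    using 0 by (auto simp: indicator_def fun_eq_iff)
  finally have int: "integrable lborel ?f" .
  have "moll \<rho> F x = integral UNIV ?f"
    unfolding moll_def using integral_lborel[OF int] by simp
  also have "\<dots> = integral UNIV (\<lambda>z. if z \<in> cbox a b then ?f z else 0)"
    using 0 by (intro arg_cong[where f="integral UNIV"]) auto
  also have "\<dots> = integral (cbox a b) ?f" by (rule integral_restrict_UNIV)
  finally show ?thesis .
qed

lemma ex_cbox_superset_cball:
  fixes x0 :: "'a::euclidean_space"
  shows "\<exists>a b. \<forall>x\<in>ball x0 1. cball x r \<subseteq> cbox a b"
proof -
  obtain a b :: 'a where ab: "cball x0 (r + 1) \<subseteq> cbox a b"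
    using bounded_subset_cbox_symmetric[OF bounded_cball] by blast
  have "cball x r \<subseteq> cball x0 (r + 1)" if "x \<in> ball x0 1" for x
  proof
    fix y assume "y \<in> cball x r"
    then show "y \<in> cball x0 (r + 1)" using dist_triangle[of x0 y x] that by simp
  qed
  then show ?thesis using ab by blast
qed

lemma moll_continuous:
  assumes \<rho>: "continuous_on UNIV \<rho>" "vanishes_outside r \<rho>"
    and F: "continuous_on UNIV F"
  shows "continuous_on UNIV (moll \<rho> F)"
  unfolding continuous_on_eq_continuous_at[OF open_UNIV]
proof
  fix x0 :: "real^'a"
  obtain a b where "\<forall>x\<in>ball x0 1. cball x r \<subseteq> cbox a b"
    using ex_cbox_superset_cball by blast
  note ab = this[rule_format]
  have "continuous_on (ball x0 1) (\<lambda>x. integral (cbox a b) (\<lambda>z. \<rho> (z - x) * F z))"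
    by (rule integral_continuous_on_param)
      (auto simp: split_beta intro!: continuous_intros continuous_on_compose2[OF \<rho>(1)] continuous_on_compose2[OF F])
  then have "continuous_on (ball x0 1) (moll \<rho> F)"
    by (rule continuous_on_eq) (use moll_eq_integral_cbox[OF \<rho> F ab] in auto)
  then show "isCont (moll \<rho> F) x0"
    by (rule continuous_on_interior) simp
qed

lemma moll_has_derivative:
  assumes \<rho>: "Ck (Suc k) \<rho>" "vanishes_outside r \<rho>"
    and F: "continuous_on UNIV F"
  shows "(moll \<rho> F has_derivative (\<lambda>v. - ((\<chi> i. moll (partial i \<rho>) F x0) \<bullet> v))) (at x0)"
proof -
  obtain a b where "\<forall>x\<in>ball x0 1. cball x r \<subseteq> cbox a b"
    using ex_cbox_superset_cball by blast
  note ab = this[rule_format]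
  have c: "continuous_on UNIV \<rho>" by (rule Ck_continuous[OF \<rho>(1)])
  have cp: "continuous_on UNIV (partial i \<rho>)" for i using \<rho>(1) by (auto intro: Ck_continuous)
  have sp: "vanishes_outside r (partial i \<rho>)" for i by (rule partial_vanishes_outside[OF \<rho>(2)])
  \<comment> \<open>The gradient in \<open>x\<close> of the integrand
    \<open>\<rho> (z - x) * F z\<close>. The Leibniz rule takes it as a bounded linear functional,
    hence the detour through \<open>blinfun_inner_right\<close>.\<close>
  let ?G = "\<lambda>x z. - F z *\<^sub>R (\<chi> i. partial i \<rho> (z - x))"
  have "((\<lambda>x. integral (cbox a b) (\<lambda>z. \<rho> (z - x) * F z)) has_derivative
      integral (cbox a b) (\<lambda>z. blinfun_inner_right (?G x0 z))) (at x0 within ball x0 1)"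
  proof (rule leibniz_rule[where U="ball x0 1" and fx="\<lambda>x z. blinfun_inner_right (?G x z)"])
    fix x z :: "real^'a"
    have "((\<lambda>x. z - x) has_derivative (\<lambda>v. - v)) (at x)" by (auto intro!: derivative_eq_intros)
    from has_derivative_compose[OF this Ck_has_derivative[OF \<rho>(1)]]
    have "((\<lambda>x. \<rho> (z - x) * F z) has_derivative (\<lambda>v. ((\<chi> i. partial i \<rho> (z - x)) \<bullet> - v) * F z)) (at x)"
      by (rule has_derivative_mult_left)
    moreover have "(\<lambda>v. ((\<chi> i. partial i \<rho> (z - x)) \<bullet> - v) * F z) = blinfun_apply (blinfun_inner_right (?G x z))"
      by (auto simp: fun_eq_iff)
    ultimately show "((\<lambda>x. \<rho> (z - x) * F z) has_derivative blinfun_apply (blinfun_inner_right (?G x z))) (at x within ball x0 1)"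
      by (simp add: has_derivative_at_withinI)
  next
    fix x
    have "continuous_on (cbox a b) (\<lambda>z. \<rho> (z - x) * F z)"
      by (intro continuous_intros continuous_on_compose2[OF c] continuous_on_subset[OF F]) auto
    then show "(\<lambda>z. \<rho> (z - x) * F z) integrable_on cbox a b" by (rule integrable_continuous)
  next
    have cG: "continuous_on (ball x0 1 \<times> cbox a b) (\<lambda>p. ?G (fst p) (snd p))"
      by (intro continuous_intros continuous_on_vec_lambda continuous_on_compose2[OF cp] continuous_on_compose2[OF F]) auto
    show "continuous_on (ball x0 1 \<times> cbox a b) (\<lambda>(x, z). blinfun_inner_right (?G x z))"
      unfolding split_beta
      by (rule bounded_linear.continuous_on[OF bounded_linear_blinfun_inner_right cG])
  qed auto
  moreover have "at x0 within ball x0 1 = at x0" by (rule at_within_open) auto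
  ultimately have D: "((\<lambda>x. integral (cbox a b) (\<lambda>z. \<rho> (z - x) * F z)) has_derivative
      integral (cbox a b) (\<lambda>z. blinfun_inner_right (?G x0 z))) (at x0)"
    by (simp only:)
  have "blinfun_apply (integral (cbox a b) (\<lambda>z. blinfun_inner_right (?G x0 z))) v
      = - ((\<chi> i. moll (partial i \<rho>) F x0) \<bullet> v)" for v
  proof -
    have cG: "continuous_on (cbox a b) (\<lambda>z. ?G x0 z)"
      by (intro continuous_intros continuous_on_vec_lambda continuous_on_compose2[OF cp] continuous_on_subset[OF F]) auto
    have "(\<lambda>z. blinfun_inner_right (?G x0 z)) integrable_on cbox a b"
      by (intro integrable_continuous bounded_linear.continuous_on[OF bounded_linear_blinfun_inner_right cG])
    then have "blinfun_apply (integral (cbox a b) (\<lambda>z. blinfun_inner_right (?G x0 z))) v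
        = integral (cbox a b) (\<lambda>z. ?G x0 z \<bullet> v)"
      using integral_linear[of "\<lambda>z. blinfun_inner_right (?G x0 z)" "cbox a b" "\<lambda>f. blinfun_apply f v"]
      by (simp add: o_def bounded_linear_intros)
    also have "\<dots> = integral (cbox a b) (\<lambda>z. \<Sum>i\<in>UNIV. - v $ i * (partial i \<rho> (z - x0) * F z))"
      by (intro integral_cong) (simp add: inner_vec_def sum_distrib_left sum_negf mult_ac)
    also have "\<dots> = (\<Sum>i\<in>UNIV. integral (cbox a b) (\<lambda>z. - v $ i * (partial i \<rho> (z - x0) * F z)))"
      by (intro integral_sum integrable_continuous continuous_intros continuous_on_compose2[OF cp]
          continuous_on_subset[OF F]) auto
    also have "\<dots> = (\<Sum>i\<in>UNIV. - v $ i * moll (partial i \<rho>) F x0)"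
      using moll_eq_integral_cbox[OF cp sp F ab[of x0]] by (intro sum.cong refl) simp
    finally show ?thesis by (simp add: inner_vec_def sum_negf mult.commute)
  qed
  then have eq: "blinfun_apply (integral (cbox a b) (\<lambda>z. blinfun_inner_right (?G x0 z)))
      = (\<lambda>v. - ((\<chi> i. moll (partial i \<rho>) F x0) \<bullet> v))" by (rule ext)
  from D[unfolded eq] show ?thesis
  proof (rule has_derivative_transform_within_open[of _ _ _ _ "ball x0 1"])
    show "integral (cbox a b) (\<lambda>z. \<rho> (z - x) * F z) = moll \<rho> F x" if "x \<in> ball x0 1" for x
      by (rule moll_eq_integral_cbox[OF c \<rho>(2) F ab[OF that], symmetric])
  qed auto
qed

lemma partial_moll:
  assumes "Ck (Suc k) \<rho>" "vanishes_outside r \<rho>" "continuous_on UNIV F"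
  shows "partial i (moll \<rho> F) = (\<lambda>x. - moll (partial i \<rho>) F x)"
  using partial_eqI[OF moll_has_derivative[OF assms]] by (auto simp: fun_eq_iff inner_axis)

lemma Ck_moll:
  assumes "Ck k \<rho>" "vanishes_outside r \<rho>" "continuous_on UNIV F"
  shows "Ck k (moll \<rho> F)"
  using assms(1,2)
proof (induction k arbitrary: \<rho>)
  case 0
  then show ?case using moll_continuous[OF _ _ assms(3), of \<rho> r] by simp
next
  case (Suc k)
  have "moll \<rho> F differentiable (at x)" for x
    using moll_has_derivative[OF Suc.prems assms(3)] by (auto simp: differentiable_def)
  moreover have "Ck k (partial i (moll \<rho> F))" for i
  proof -
    have "Ck k (moll (partial i \<rho>) F)"
      by (rule Suc.IH) (use Suc.prems partial_vanishes_outside[OF Suc.prems(2)] in auto)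
    then show ?thesis
      using partial_moll[OF Suc.prems assms(3), of i] Ck_minus by simp
  qed
  ultimately show ?case by simp
qed

lemma partials_minus:
  assumes "Ck k f" "length is \<le> k"
  shows "partials is (\<lambda>x. - f x) = (\<lambda>x. - partials is f x)"
  using assms
proof (induction "is" arbitrary: f k)
  case (Cons i "is")
  then obtain k' where k: "k = Suc k'" by (cases k) auto
  have "partial i (\<lambda>x. - f x) = (\<lambda>x. - partial i f x)"
  proof
    fix x
    have "partial i (\<lambda>x. 0 - f x) x = partial i (\<lambda>x. 0) x - partial i f x"
      using Cons.prems k by (intro partial_diff) auto
    then show "partial i (\<lambda>x. - f x) x = - partial i f x" by (simp add: partial_const)
  qed
  then show ?case using Cons.IH[of k' "partial i f"] Cons.prems k by simp
qed simp

text \<open>The constant, an L1 norm of a derivative of \<open>\<rho>\<close>, precedes the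
  quantifier over \<open>F\<close>. In the application \<open>F\<close> runs through the orbit
  functions of all surfaces, and \<open>Cb\<close> asks for bounds that are uniform over
  them.\<close>

lemma partials_moll_bound:
  assumes "Ck k \<rho>" "vanishes_outside r \<rho>" "length is \<le> k"
  shows "\<exists>C. \<forall>F M x. continuous_on UNIV F \<longrightarrow> (\<forall>x. \<bar>F x\<bar> \<le> M) \<longrightarrow> \<bar>partials is (moll \<rho> F) x\<bar> \<le> M * C"
  using assms
proof (induction "is" arbitrary: \<rho> k)
  case Nil
  show ?case
    by (rule exI[of _ "LINT z|lborel. \<bar>\<rho> z\<bar>"]) (auto intro!: moll_bound[OF Ck_continuous[OF Nil(1)] Nil(2)])
next
  case (Cons i "is")
  then obtain k' where k: "k = Suc k'" by (cases k) auto
  have p: "Ck k' (partial i \<rho>)" "vanishes_outside r (partial i \<rho>)"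
    using Cons.prems k by (auto intro: partial_vanishes_outside)
  have "length is \<le> k'" using Cons.prems k by simp
  from Cons.IH[OF p this] obtain C where
    C: "\<And>F M x. continuous_on UNIV F \<Longrightarrow> (\<forall>x. \<bar>F x\<bar> \<le> M) \<Longrightarrow> \<bar>partials is (moll (partial i \<rho>) F) x\<bar> \<le> M * C"
    by blast
  have "\<bar>partials (i # is) (moll \<rho> F) x\<bar> \<le> M * C" if F: "continuous_on UNIV F" "\<forall>x. \<bar>F x\<bar> \<le> M" for F M x
  proof -
    have "partials (i # is) (moll \<rho> F) = (\<lambda>x. - partials is (moll (partial i \<rho>) F) x)"
      using partial_moll[of k' \<rho> r F i] partials_minus[OF Ck_moll[OF p F(1)] \<open>length is \<le> k'\<close>]
        Cons.prems k F by simp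
    then show ?thesis using C[OF F] by simp
  qed
  then show ?case by blast
qed

text \<open>Test functions of class C^2 suffice, so a truncated power of a polynomial serves as
  bump. Each derivative lowers the exponent by one and exponent 1 is still continuous, whence the
  exponent 3 below.\<close>

definition bump :: "real \<Rightarrow> nat \<Rightarrow> real^'n::finite \<Rightarrow> real" where
  "bump r n y = (max 0 (r\<^sup>2 - y \<bullet> y)) ^ n"

lemma bump_nonneg: "0 \<le> bump r n y"
  by (simp add: bump_def)

lemma bump_vanishes_outside:
  assumes "0 \<le> r" "0 < n"
  shows "vanishes_outside r (bump r n)"
  unfolding vanishes_outside_def
proof (intro allI impI)
  fix y :: "real^'a" assume "norm y > r"
  then have "r\<^sup>2 < y \<bullet> y"
    using power_strict_mono[of r "norm y" 2] assms by (simp add: power2_norm_eq_inner)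
  then show "bump r n y = 0" using assms by (simp add: bump_def)
qed

lemma bump_continuous: "continuous_on A (bump r n)"
  unfolding bump_def by (intro continuous_intros)

lemma max_power_has_real_derivative:
  "((\<lambda>s. (max 0 s) ^ (Suc (Suc n))) has_real_derivative real (n + 2) * (max 0 s) ^ (Suc n)) (at s)"
proof -
  consider "s > 0" | "s < 0" | "s = 0" by linarith
  then show ?thesis
  proof cases
    case 1
    have "((\<lambda>s. s ^ (Suc (Suc n))) has_real_derivative real (n + 2) * s ^ (Suc n)) (at s)"
      using DERIV_pow[of "Suc (Suc n)" s UNIV] by simp
    then have "((\<lambda>s. (max 0 s) ^ (Suc (Suc n))) has_real_derivative real (n + 2) * s ^ (Suc n)) (at s)"
      by (rule has_field_derivative_transform_within_open[where S="{0<..}"]) (use 1 in auto)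
    then show ?thesis using 1 by simp
  next
    case 2
    have "((\<lambda>s. 0) has_real_derivative 0) (at s)" by simp
    then have "((\<lambda>s. (max 0 s) ^ (Suc (Suc n))) has_real_derivative 0) (at s)"
      by (rule has_field_derivative_transform_within_open[where S="{..<0}"]) (use 2 in auto)
    then show ?thesis using 2 by simp
  next
    case 3
    have "((\<lambda>h. (max 0 h) ^ (Suc n)) \<longlongrightarrow> (max 0 0) ^ (Suc n)) (at (0::real))"
      by (intro tendsto_intros)
    then have "((\<lambda>h. (max 0 h) ^ (Suc n)) \<longlongrightarrow> 0) (at (0::real))" by simp
    moreover have "(\<lambda>h. (max 0 h) ^ (Suc n)) = (\<lambda>h::real. ((max 0 (0 + h)) ^ (Suc (Suc n)) - (max 0 0) ^ (Suc (Suc n))) / h)"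
      by (auto simp: fun_eq_iff max_def)
    ultimately have "((\<lambda>s. (max 0 s) ^ (Suc (Suc n))) has_real_derivative 0) (at 0)"
      unfolding DERIV_def by simp
    then show ?thesis using 3 by simp
  qed
qed

lemma bump_has_derivative:
  "(bump r (Suc (Suc n)) has_derivative (\<lambda>v. - 2 * real (n + 2) * bump r (Suc n) y * (y \<bullet> v))) (at y)"
proof -
  have "((\<lambda>y. r\<^sup>2 - y \<bullet> y) has_derivative (\<lambda>v. - (2 * (y \<bullet> v)))) (at y)"
    by (auto intro!: derivative_eq_intros simp: inner_commute)
  from has_derivative_compose[OF this max_power_has_real_derivative[of n "r\<^sup>2 - y \<bullet> y", unfolded has_field_derivative_def]]
  have "(bump r (Suc (Suc n)) has_derivative (\<lambda>v. real (n + 2) * bump r (Suc n) y * - (2 * (y \<bullet> v)))) (at y)"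
    by (simp only: bump_def[abs_def])
  moreover have "(\<lambda>v. real (n + 2) * bump r (Suc n) y * - (2 * (y \<bullet> v)))
      = (\<lambda>v. - 2 * real (n + 2) * bump r (Suc n) y * (y \<bullet> v))"
    by (rule ext) (simp add: algebra_simps)
  ultimately show ?thesis by simp
qed

lemma partial_bump:
  "partial i (bump r (Suc (Suc n))) = (\<lambda>y. - 2 * real (n + 2) * bump r (Suc n) y * y $ i)"
  using partial_eqI[OF bump_has_derivative] by (auto simp: fun_eq_iff inner_axis)

lemma Ck_bump: "Ck 2 (bump r 3)"
proof -
  have d3: "bump r (Suc (Suc 1)) differentiable (at y)" for y
    using bump_has_derivative by (auto simp: differentiable_def)
  have d2: "((\<lambda>y. - 2 * real (1 + 2) * bump r (Suc (Suc 0)) y * y $ i) has_derivative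
      (\<lambda>v. - 6 * (bump r 2 y * v $ i + - 4 * bump r 1 y * (y \<bullet> v) * y $ i))) (at y)" for i y
    using bump_has_derivative[of r 0 y]
    by (auto intro!: derivative_eq_intros bounded_linear.has_derivative[OF bounded_linear_vec_nth]
        simp: numeral_2_eq_2 algebra_simps)
  have "Ck (Suc 0) (\<lambda>y. - 2 * real (1 + 2) * bump r (Suc (Suc 0)) y * y $ i)" for i
    unfolding Ck.simps
  proof (intro conjI allI)
    fix y j
    show "(\<lambda>y. - 2 * real (1 + 2) * bump r (Suc (Suc 0)) y * y $ i) differentiable (at y)"
      using d2 unfolding differentiable_def by blast
    have "partial j (\<lambda>y. - 2 * real (1 + 2) * bump r (Suc (Suc 0)) y * y $ i)
        = (\<lambda>y. - 6 * (bump r 2 y * axis j 1 $ i + - 4 * bump r 1 y * (y \<bullet> axis j 1) * y $ i))"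
      by (rule ext) (rule partial_eqI[OF d2])
    moreover have "continuous_on UNIV (\<lambda>y. - 6 * (bump r 2 y * axis j 1 $ i + - 4 * bump r 1 y * (y \<bullet> axis j 1) * y $ i))"
      by (intro continuous_intros bump_continuous)
    ultimately show "continuous_on UNIV (partial j (\<lambda>y. - 2 * real (1 + 2) * bump r (Suc (Suc 0)) y * y $ i))"
      by (simp only:)
  qed
  then have "Ck (Suc 0) (partial i (bump r (Suc (Suc 1))))" for i
    unfolding partial_bump One_nat_def .
  then have "Ck (Suc (Suc 0)) (bump r (Suc (Suc 1)))"
    unfolding Ck.simps(2)[of "Suc 0"] using d3 by blast
  then show ?thesis by (simp add: numeral_eq_Suc)
qed

text \<open>Translated bumps are again test functions, so the mollification of \<open>c\<close> has
  zero gradient and is constant. If \<open>c\<close> took different values at \<open>x\<close> and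
  \<open>y\<close>, the difference \<open>g\<close> of the two translates would integrate to zero
  against a bump at the origin although it has a strict sign there.\<close>

lemma weak_gradient_zero_imp_const:
  fixes c :: "real^'n::finite \<Rightarrow> real"
  assumes c: "continuous_on UNIV c"
    and weak: "\<And>\<rho> r i. Ck 2 \<rho> \<Longrightarrow> vanishes_outside r \<rho> \<Longrightarrow> (LINT z|lborel. partial i \<rho> z * c z) = 0"
  shows "c x = c y"
proof (rule ccontr)
  assume "c x \<noteq> c y"
  define g where "g z = c (z + x) - c (z + y)" for z
  have g: "continuous_on UNIV g"
    unfolding g_def by (intro continuous_intros continuous_on_compose2[OF c]) auto
  have g0: "g 0 \<noteq> 0" using \<open>c x \<noteq> c y\<close> by (simp add: g_def)
  have "isCont g 0" using g by (simp add: continuous_on_eq_continuous_at)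
  then obtain r where r: "r > 0" "\<And>z. dist z 0 < r \<Longrightarrow> dist (g z) (g 0) < \<bar>g 0\<bar>"
    using g0 unfolding continuous_at_eps_delta by (metis zero_less_abs_iff)
  let ?\<rho> = "bump (r / 2) 3 :: real^'n \<Rightarrow> real"
  have \<rho>s: "vanishes_outside (r / 2) ?\<rho>" by (rule bump_vanishes_outside) (use r in auto)
  note \<rho>0 = vanishes_outsideD[OF \<rho>s]
  have k: "Ck (Suc 1) ?\<rho>" using Ck_bump by (simp add: numeral_2_eq_2)
  have \<rho>c: "continuous_on UNIV ?\<rho>" by (rule bump_continuous)
  have "moll (partial i ?\<rho>) c z = 0" for i and z :: "real^'n"
  proof -
    have "partial i (shift (- z) ?\<rho>) = shift (- z) (partial i ?\<rho>)" by (rule partial_shift)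
    moreover have "(LINT w|lborel. partial i (shift (- z) ?\<rho>) w * c w) = 0"
    proof (rule weak[OF Ck_shift[OF Ck_bump], where r="r / 2 + norm z"], unfold vanishes_outside_def, intro allI impI)
      fix w :: "real^'n" assume "norm w > r / 2 + norm z"
      then have "norm (w - z) > r / 2" using norm_triangle_ineq2[of w z] by linarith
      then show "shift (- z) ?\<rho> w = 0" using \<rho>0 by (simp add: shift_apply)
    qed
    ultimately show ?thesis by (simp add: moll_def shift_apply)
  qed
  then have D: "(moll ?\<rho> c has_derivative (\<lambda>v. 0)) (at z within UNIV)" for z
    using moll_has_derivative[OF k \<rho>s c, of z] by (simp add: inner_vec_def)
  have "moll ?\<rho> c x = moll ?\<rho> c y"
    using has_derivative_zero_unique[of UNIV "moll ?\<rho> c" x y] D by simp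
  then have "(LINT z|lborel. ?\<rho> z * c (z + x)) = (LINT z|lborel. ?\<rho> z * c (z + y))"
    by (simp add: moll_translate[OF \<rho>c c])
  moreover have int: "integrable lborel (\<lambda>z. ?\<rho> z * c (z + x))" for x
    by (rule integrable_compact_support[of _ "r/2"])
      (use \<rho>0 in \<open>auto simp: vanishes_outside_def intro!: continuous_intros \<rho>c continuous_on_compose2[OF c]\<close>)
  ultimately have 0: "(LINT z|lborel. ?\<rho> z * g z) = 0"
    by (simp add: g_def right_diff_distrib)
  \<comment> \<open>On the support of the bump, of radius \<open>r / 2\<close>, the function
    \<open>g\<close> keeps the sign of \<open>g 0\<close>.\<close>
  have nn: "0 \<le> sgn (g 0) * (?\<rho> z * g z)" for z
  proof (cases "norm z > r / 2")
    case True then show ?thesis using \<rho>0 by simp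
  next
    case False
    then have "dist (g z) (g 0) < \<bar>g 0\<bar>" using r by (intro r(2)) auto
    then have "0 \<le> sgn (g 0) * g z" using g0 by (auto simp: dist_real_def sgn_if split: if_splits)
    then have "0 \<le> ?\<rho> z * (sgn (g 0) * g z)" by (rule mult_nonneg_nonneg[OF bump_nonneg])
    then show ?thesis by (simp add: mult_ac)
  qed
  have cc: "continuous_on UNIV (\<lambda>z. sgn (g 0) * (?\<rho> z * g z))"
    by (intro continuous_intros \<rho>c g)
  have "(LINT z|lborel. sgn (g 0) * (?\<rho> z * g z)) = 0" using 0 by simp
  then have "AE z in lborel. sgn (g 0) * (?\<rho> z * g z) = 0"
  proof (subst (asm) integral_nonneg_eq_0_iff_AE)
    show "integrable lborel (\<lambda>z. sgn (g 0) * (?\<rho> z * g z))"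
      by (rule integrable_compact_support[OF cc, of "r/2"]) (use \<rho>0 in \<open>simp add: vanishes_outside_def\<close>)
  qed (use nn in auto)
  then have "AE z in lborel. z \<notin> {z. sgn (g 0) * (?\<rho> z * g z) \<noteq> 0}"
    by (rule eventually_mono) (simp only: mem_Collect_eq not_not)
  \<comment> \<open>The set where the integrand does not vanish is open and null but contains the
    origin.\<close>
  moreover have op: "open {z. sgn (g 0) * (?\<rho> z * g z) \<noteq> 0}"
    by (intro open_Collect_neq cc continuous_on_const)
  then have "{z. sgn (g 0) * (?\<rho> z * g z) \<noteq> 0} \<in> sets lborel"
    unfolding sets_lborel by (rule borel_open)
  ultimately have "{z. sgn (g 0) * (?\<rho> z * g z) \<noteq> 0} \<in> null_sets lborel"
    using AE_iff_null_sets by blast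
  then have "negligible {z. sgn (g 0) * (?\<rho> z * g z) \<noteq> 0}"
    unfolding negligible_iff_null_sets by (rule null_sets_completionI)
  moreover have "0 \<in> {z. sgn (g 0) * (?\<rho> z * g z) \<noteq> 0}"
    using g0 r(1) by (simp add: bump_def sgn_if)
  ultimately show False
    using open_not_negligible[OF op] by blast
qed

section \<open>Divergence-free fields\<close>

context random_surface
begin

text \<open>The average of \<open>f\<close> over the orbit of \<open>h\<close> with weight
  \<open>\<rho>\<close>. Derivatives along the orbit fall on \<open>\<rho>\<close>, so a function
  that is merely continuous along orbits yields test functions in \<open>Cb\<close>.\<close>

definition smooth_avg :: "(real^'n \<Rightarrow> real) \<Rightarrow> ((real^'n \<Rightarrow> real) \<Rightarrow> real) \<Rightarrow> (real^'n \<Rightarrow> real) \<Rightarrow> real" where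
  "smooth_avg \<rho> f h = moll \<rho> (\<lambda>x. f (shift x h)) 0"

lemma smooth_avg_shift:
  assumes "continuous_on UNIV \<rho>" "bounded_cts f" "h \<in> Omega"
  shows "smooth_avg \<rho> f (shift x h) = moll \<rho> (\<lambda>z. f (shift z h)) x"
proof -
  have "continuous_on UNIV (\<lambda>z. f (shift z h))" using assms by (simp add: bounded_cts_def)
  from moll_translate[OF assms(1) this, of x] show ?thesis
    by (simp add: smooth_avg_def moll_def shift_shift)
qed

lemma shift_pair_measurable_P': "(\<lambda>p. shift (snd p) (fst p)) \<in> P \<Otimes>\<^sub>M lborel \<rightarrow>\<^sub>M P"
proof -
  have "(\<lambda>p. (snd p, fst p)) \<in> P \<Otimes>\<^sub>M lborel \<rightarrow>\<^sub>M borel \<Otimes>\<^sub>M P" by measurable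
  from measurable_compose[OF this shift_pair_measurable_P] show ?thesis by simp
qed

lemma weighted_shift_measurable:
  fixes k :: "real^'n \<Rightarrow> real"
  assumes "continuous_on UNIV k" "f \<in> borel_measurable P"
  shows "(\<lambda>p. k (snd p) * f (shift (snd p) (fst p))) \<in> borel_measurable (P \<Otimes>\<^sub>M lborel)"
proof -
  have [measurable]: "k \<in> borel_measurable borel" using assms(1) by (rule borel_measurable_continuous_onI)
  have [measurable]: "(\<lambda>p. f (shift (snd p) (fst p))) \<in> borel_measurable (P \<Otimes>\<^sub>M lborel)"
    by (rule measurable_compose[OF shift_pair_measurable_P' assms(2)])
  show ?thesis by measurable
qed

lemma smooth_avg_measurable:
  assumes "continuous_on UNIV \<rho>" "f \<in> borel_measurable P"
  shows "smooth_avg \<rho> f \<in> borel_measurable P"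
proof -
  have "(\<lambda>h. LINT z|lborel. \<rho> z * f (shift z h)) \<in> borel_measurable P"
    by (rule lborel.borel_measurable_lebesgue_integral)
      (use weighted_shift_measurable[OF assms] in \<open>simp add: split_beta'\<close>)
  then show ?thesis by (simp add: smooth_avg_def[abs_def] moll_def)
qed

lemma smooth_avg_Cb:
  assumes \<rho>: "Ck k \<rho>" "vanishes_outside r \<rho>" and f: "bounded_cts f"
  shows "smooth_avg \<rho> f \<in> Cb k"
proof -
  have c: "continuous_on UNIV \<rho>" by (rule Ck_continuous[OF \<rho>(1)])
  obtain M where M: "\<And>h. h \<in> Omega \<Longrightarrow> \<bar>f h\<bar> \<le> M" using f by (auto simp: bounded_cts_def)
  have Fc: "continuous_on UNIV (\<lambda>z. f (shift z h))" if "h \<in> Omega" for h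
    using f that by (simp add: bounded_cts_def)
  have eq: "(\<lambda>x. smooth_avg \<rho> f (shift x h)) = moll \<rho> (\<lambda>z. f (shift z h))" if "h \<in> Omega" for h
    by (rule ext) (rule smooth_avg_shift[OF c f that])
  have bd: "\<exists>C. \<forall>h\<in>Omega. \<forall>x. \<bar>partials is (\<lambda>y. smooth_avg \<rho> f (shift y h)) x\<bar> \<le> C" if l: "length is \<le> k" for "is"
  proof -
    obtain C where C: "\<And>F M x. continuous_on UNIV F \<Longrightarrow> (\<forall>x. \<bar>F x\<bar> \<le> M) \<Longrightarrow> \<bar>partials is (moll \<rho> F) x\<bar> \<le> M * C"
      using partials_moll_bound[OF \<rho> l] by blast
    have "\<bar>partials is (\<lambda>y. smooth_avg \<rho> f (shift y h)) x\<bar> \<le> M * C" if "h \<in> Omega" for h x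
      unfolding eq[OF that] using M that by (intro C Fc) auto
    then show ?thesis by blast
  qed
  have "\<exists>C. \<forall>h\<in>Omega. \<bar>smooth_avg \<rho> f h\<bar> \<le> C"
  proof -
    obtain C where C: "\<forall>h\<in>Omega. \<forall>x. \<bar>smooth_avg \<rho> f (shift x h)\<bar> \<le> C" using bd[of "[]"] by auto
    have "\<bar>smooth_avg \<rho> f h\<bar> \<le> C" if "h \<in> Omega" for h
      using C[rule_format, OF that, of 0] by simp
    then show ?thesis by blast
  qed
  moreover have "smooth_avg \<rho> f \<in> borel_measurable borel_Omega"
    using smooth_avg_measurable[OF c] f by (simp add: bounded_cts_def sets_P cong: measurable_cong_sets)
  moreover have "Ck k (\<lambda>x. smooth_avg \<rho> f (shift x h))" if "h \<in> Omega" for h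
    unfolding eq[OF that] by (rule Ck_moll[OF \<rho> Fc[OF that]])
  ultimately show ?thesis using bd unfolding Cb_def by blast
qed

lemma path_deriv_smooth_avg:
  assumes \<rho>: "Ck (Suc k) \<rho>" "vanishes_outside r \<rho>" and f: "bounded_cts f" and h: "h \<in> Omega"
  shows "path_deriv i (smooth_avg \<rho> f) h = - (LINT z|lborel. partial i \<rho> z * f (shift z h))"
proof -
  have c: "continuous_on UNIV \<rho>" by (rule Ck_continuous[OF \<rho>(1)])
  have Fc: "continuous_on UNIV (\<lambda>z. f (shift z h))" using f h by (simp add: bounded_cts_def)
  have "path_deriv i (smooth_avg \<rho> f) h = partial i (moll \<rho> (\<lambda>z. f (shift z h))) 0"
    by (simp add: path_deriv_def smooth_avg_shift[OF c f h])
  also have "\<dots> = - moll (partial i \<rho>) (\<lambda>z. f (shift z h)) 0"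
    by (simp add: partial_moll[OF \<rho> Fc])
  finally show ?thesis by (simp add: moll_def)
qed

lemma Fubini_weighted_shift:
  fixes k :: "real^'n \<Rightarrow> real"
  assumes a: "a \<in> L2 P" and k: "continuous_on UNIV k" "vanishes_outside r k" and f: "bounded_cts f"
  shows "(LINT h|P. a h * (LINT z|lborel. k z * f (shift z h))) = (LINT z|lborel. k z * (LINT h|P. a h * f (shift z h)))"
proof -
  interpret pair_sigma_finite P lborel ..
  obtain M where M: "\<And>h. h \<in> Omega \<Longrightarrow> \<bar>f h\<bar> \<le> M" using f by (auto simp: bounded_cts_def)
  have fm: "f \<in> borel_measurable P" using f by (simp add: bounded_cts_def)
  have am [measurable]: "a \<in> borel_measurable P" using a by (rule L2_measurable)
  note [measurable] = weighted_shift_measurable[OF k(1) fm]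
  let ?g = "\<lambda>h z. a h * (k z * f (shift z h))"
  have meas: "(\<lambda>p. a (fst p) * (k (snd p) * f (shift (snd p) (fst p)))) \<in> borel_measurable (P \<Otimes>\<^sub>M lborel)"
    by measurable
  have int_z: "integrable lborel (\<lambda>z. k z * f (shift z h))" if "h \<in> Omega" for h
    by (rule integrable_compact_support[of _ r])
      (use k f that in \<open>auto simp: bounded_cts_def vanishes_outside_def intro!: continuous_intros\<close>)
  have int_k: "integrable lborel (\<lambda>z. \<bar>k z\<bar>)"
    by (rule integrable_compact_support[of _ r]) (use k in \<open>auto simp: vanishes_outside_def intro!: continuous_intros\<close>)
  have "integrable (P \<Otimes>\<^sub>M lborel) (case_prod ?g)"
  proof (rule Fubini_integrable)
    show "case_prod ?g \<in> borel_measurable (P \<Otimes>\<^sub>M lborel)" using meas by (simp add: split_beta')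
    show "AE h in P. integrable lborel (\<lambda>z. case (h, z) of (h, z) \<Rightarrow> ?g h z)"
      using int_z by (intro AE_I2) auto
    show "integrable P (\<lambda>h. LINT z|lborel. norm (case (h, z) of (h, z) \<Rightarrow> ?g h z))"
    proof (rule Bochner_Integration.integrable_bound)
      show "integrable P (\<lambda>h. a h * (M * (LINT z|lborel. \<bar>k z\<bar>)))"
        using L2_integrable[OF a] by simp
      have "(\<lambda>p. norm (a (fst p) * (k (snd p) * f (shift (snd p) (fst p))))) \<in> borel_measurable (P \<Otimes>\<^sub>M lborel)"
        using meas by measurable
      then show "(\<lambda>h. LINT z|lborel. norm (case (h, z) of (h, z) \<Rightarrow> ?g h z)) \<in> borel_measurable P"
        by (intro lborel.borel_measurable_lebesgue_integral) (simp add: split_beta')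
      show "AE h in P. norm (LINT z|lborel. norm (case (h, z) of (h, z) \<Rightarrow> ?g h z)) \<le> norm (a h * (M * (LINT z|lborel. \<bar>k z\<bar>)))"
      proof (rule AE_I2)
        fix h assume "h \<in> space P"
        then have h: "h \<in> Omega" by simp
        have M0: "0 \<le> M" using M[OF h] by linarith
        have "(LINT z|lborel. \<bar>k z * f (shift z h)\<bar>) \<le> (LINT z|lborel. M * \<bar>k z\<bar>)"
        proof (rule integral_mono)
          show "integrable lborel (\<lambda>z. \<bar>k z * f (shift z h)\<bar>)" using int_z[OF h] by (rule integrable_abs)
          show "integrable lborel (\<lambda>z. M * \<bar>k z\<bar>)" using int_k by simp
          show "\<bar>k z * f (shift z h)\<bar> \<le> M * \<bar>k z\<bar>" for z
            using mult_right_mono[OF M[OF shift_Omega[OF h]], of "\<bar>k z\<bar>" z] by (simp add: abs_mult mult.commute)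
        qed
        then have "\<bar>a h\<bar> * (LINT z|lborel. \<bar>k z * f (shift z h)\<bar>) \<le> \<bar>a h\<bar> * (M * (LINT z|lborel. \<bar>k z\<bar>))"
          by (intro mult_left_mono) auto
        then show "norm (LINT z|lborel. norm (case (h, z) of (h, z) \<Rightarrow> ?g h z)) \<le> norm (a h * (M * (LINT z|lborel. \<bar>k z\<bar>)))"
          using M0 by (simp add: abs_mult integral_nonneg_AE)
      qed
    qed
  qed
  from Fubini_integral[OF this] have "(LINT z|lborel. LINT h|P. ?g h z) = (LINT h|P. LINT z|lborel. ?g h z)" .
  moreover have "(LINT h|P. ?g h z) = k z * (LINT h|P. a h * f (shift z h))" for z
  proof -
    have "(LINT h|P. ?g h z) = (LINT h|P. k z * (a h * f (shift z h)))" by (simp add: mult_ac)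
    also have "\<dots> = k z * (LINT h|P. a h * f (shift z h))" by (rule integral_mult_right_zero)
    finally show ?thesis .
  qed
  ultimately show ?thesis by simp
qed

text \<open>If \<open>a\<close> is orthogonal to all gradients, then for every \<open>v\<close> the vector of correlation functions of
  its components with \<open>v\<close> is divergence free in the weak sense.\<close>

lemma weak_divergence_correlation:
  fixes a :: "(real^'n \<Rightarrow> real) \<Rightarrow> real^'n"
  assumes a: "a \<in> L2 P" and orth: "\<And>\<phi>. \<phi> \<in> Cb 2 \<Longrightarrow> (LINT h|P. a h \<bullet> path_grad \<phi> h) = 0"
    and v: "v \<in> L2 P" and \<rho>: "Ck 2 \<rho>" "vanishes_outside r \<rho>"
  shows "(\<Sum>i\<in>UNIV. LINT z|lborel. partial i \<rho> z * (LINT h|P. a h $ i * v (shift z h))) = 0"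
proof -
  have k: "Ck (Suc 1) \<rho>" using \<rho>(1) by (simp add: numeral_2_eq_2)
  have cp: "continuous_on UNIV (partial i \<rho>)" for i
    using k unfolding Ck.simps(2) using Ck_continuous by blast
  have sp: "vanishes_outside r (partial i \<rho>)" for i by (rule partial_vanishes_outside[OF \<rho>(2)])
  note ai = L2_component[OF a]
  obtain f where f: "\<And>n::nat. bounded_cts (f n)" "(\<lambda>n. L2_norm P (\<lambda>h. f n h - v h)) \<longlonglongrightarrow> 0"
    using L2_bounded_cts_sequence[OF v] by blast
  have zero: "(\<Sum>i\<in>UNIV. LINT z|lborel. partial i \<rho> z * (LINT h|P. a h $ i * f n (shift z h))) = 0" for n
  proof -
    \<comment> \<open>Testing the orthogonality with an orbit average puts the derivative on
      \<open>\<rho>\<close>, and Fubini then produces the correlations of \<open>a\<close> with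
      \<open>f n\<close>.\<close>
    let ?\<phi> = "smooth_avg \<rho> (f n)"
    have \<phi>: "?\<phi> \<in> Cb 2" by (rule smooth_avg_Cb[OF \<rho> f(1)])
    then have \<phi>': "?\<phi> \<in> Cb (Suc 1)" by (simp add: numeral_2_eq_2)
    note gi = L2_component[OF path_grad_L2[OF \<phi>']]
    have "0 = (LINT h|P. (\<Sum>i\<in>UNIV. a h $ i * path_deriv i ?\<phi> h))"
      using orth[OF \<phi>] by (simp add: inner_vec_def)
    also have "\<dots> = (\<Sum>i\<in>UNIV. LINT h|P. a h $ i * path_deriv i ?\<phi> h)"
      using L2_mult_integrable[OF ai gi] by (intro Bochner_Integration.integral_sum) simp
    also have "\<dots> = (\<Sum>i\<in>UNIV. - (LINT z|lborel. partial i \<rho> z * (LINT h|P. a h $ i * f n (shift z h))))"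
    proof (rule sum.cong[OF refl])
      fix i
      have "(LINT h|P. a h $ i * path_deriv i ?\<phi> h) = (LINT h|P. - (a h $ i * (LINT z|lborel. partial i \<rho> z * f n (shift z h))))"
        by (rule Bochner_Integration.integral_cong[OF refl]) (simp add: path_deriv_smooth_avg[OF k \<rho>(2) f(1)])
      also have "\<dots> = - (LINT h|P. a h $ i * (LINT z|lborel. partial i \<rho> z * f n (shift z h)))" by simp
      also have "(LINT h|P. a h $ i * (LINT z|lborel. partial i \<rho> z * f n (shift z h)))
          = (LINT z|lborel. partial i \<rho> z * (LINT h|P. a h $ i * f n (shift z h)))"
        by (rule Fubini_weighted_shift[OF ai cp sp f(1)])
      finally show "(LINT h|P. a h $ i * path_deriv i ?\<phi> h)
          = - (LINT z|lborel. partial i \<rho> z * (LINT h|P. a h $ i * f n (shift z h)))" .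
    qed
    finally show ?thesis by (simp add: sum_negf)
  qed
  \<comment> \<open>By Cauchy-Schwarz and stationarity the correlations with \<open>f n\<close>
    approach those with \<open>v\<close> uniformly in \<open>z\<close>, and the kernel is
    integrable.\<close>
  have "(\<lambda>n. LINT z|lborel. partial i \<rho> z * (LINT h|P. a h $ i * f n (shift z h)))
      \<longlonglongrightarrow> (LINT z|lborel. partial i \<rho> z * (LINT h|P. a h $ i * v (shift z h)))" for i
  proof (rule Lim_transform2[OF tendsto_const])
    let ?d = "\<lambda>n. L2_norm P (\<lambda>h. f n h - v h)"
    let ?I = "LINT z|lborel. \<bar>partial i \<rho> z\<bar>"
    have "(\<lambda>n. L2_norm P (\<lambda>h. a h $ i) * ?d n * ?I) \<longlonglongrightarrow> L2_norm P (\<lambda>h. a h $ i) * 0 * ?I"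
      by (intro tendsto_intros f(2))
    then have lim: "(\<lambda>n. L2_norm P (\<lambda>h. a h $ i) * ?d n * ?I) \<longlonglongrightarrow> 0" by simp
    have int: "integrable lborel (\<lambda>z. partial i \<rho> z * (LINT h|P. a h $ i * w (shift z h)))" if "w \<in> L2 P" for w
      by (rule integrable_compact_support[of _ r])
        (use sp in \<open>auto simp: vanishes_outside_def intro!: continuous_intros cp correlation_continuous[OF ai that]\<close>)
    have "\<bar>(LINT z|lborel. partial i \<rho> z * (LINT h|P. a h $ i * v (shift z h)))
        - (LINT z|lborel. partial i \<rho> z * (LINT h|P. a h $ i * f n (shift z h)))\<bar> \<le> L2_norm P (\<lambda>h. a h $ i) * ?d n * ?I" for n
    proof -
      note fL = bounded_cts_L2[OF f(1)[of n]]
      have diff: "(LINT h|P. a h $ i * v (shift z h)) - (LINT h|P. a h $ i * f n (shift z h))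
          = (LINT h|P. a h $ i * (v (shift z h) - f n (shift z h)))" for z
        using L2_mult_integrable[OF ai L2_shift[OF v]] L2_mult_integrable[OF ai L2_shift[OF fL]]
        by (simp add: right_diff_distrib)
      have bd: "\<bar>LINT h|P. a h $ i * (v (shift z h) - f n (shift z h))\<bar> \<le> L2_norm P (\<lambda>h. a h $ i) * ?d n" for z
      proof -
        have "L2_norm P (\<lambda>h. v (shift z h) - f n (shift z h)) = L2_norm P (\<lambda>h. v h - f n h)"
          by (rule L2_norm_shift[of "\<lambda>h. v h - f n h"]) (rule L2_measurable[OF L2_diff[OF v fL]])
        then show ?thesis
          using L2_Cauchy_Schwarz[OF ai L2_diff[OF L2_shift[OF v] L2_shift[OF fL]], of i z z]
          by (simp add: L2_norm_diff_commute[of P v])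
      qed
      have "(LINT z|lborel. partial i \<rho> z * (LINT h|P. a h $ i * v (shift z h)))
          - (LINT z|lborel. partial i \<rho> z * (LINT h|P. a h $ i * f n (shift z h)))
          = (LINT z|lborel. partial i \<rho> z * (LINT h|P. a h $ i * v (shift z h))
              - partial i \<rho> z * (LINT h|P. a h $ i * f n (shift z h)))"
        by (rule Bochner_Integration.integral_diff[symmetric, OF int[OF v] int[OF fL]])
      also have "\<dots> = (LINT z|lborel. partial i \<rho> z * (LINT h|P. a h $ i * (v (shift z h) - f n (shift z h))))"
        by (simp only: diff[symmetric]) (simp only: right_diff_distrib)
      also have "\<bar>\<dots>\<bar> \<le> (LINT z|lborel. \<bar>partial i \<rho> z * (LINT h|P. a h $ i * (v (shift z h) - f n (shift z h)))\<bar>)"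
        by (rule integral_abs_bound)
      also have "\<dots> \<le> (LINT z|lborel. L2_norm P (\<lambda>h. a h $ i) * ?d n * \<bar>partial i \<rho> z\<bar>)"
      proof (rule integral_mono)
        show "integrable lborel (\<lambda>z. \<bar>partial i \<rho> z * (LINT h|P. a h $ i * (v (shift z h) - f n (shift z h)))\<bar>)"
          by (rule integrable_abs) (rule int[OF L2_diff[OF v fL]])
        show "integrable lborel (\<lambda>z. L2_norm P (\<lambda>h. a h $ i) * ?d n * \<bar>partial i \<rho> z\<bar>)"
          by (rule integrable_compact_support[of _ r]) (use sp in \<open>auto simp: vanishes_outside_def intro!: continuous_intros cp\<close>)
        show "\<bar>partial i \<rho> z * (LINT h|P. a h $ i * (v (shift z h) - f n (shift z h)))\<bar>
            \<le> L2_norm P (\<lambda>h. a h $ i) * ?d n * \<bar>partial i \<rho> z\<bar>" for z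
          unfolding abs_mult using mult_left_mono[OF bd[of z], of "\<bar>partial i \<rho> z\<bar>"] by (simp add: mult_ac)
      qed
      finally show ?thesis by simp
    qed
    then show "(\<lambda>n. (LINT z|lborel. partial i \<rho> z * (LINT h|P. a h $ i * v (shift z h)))
        - (LINT z|lborel. partial i \<rho> z * (LINT h|P. a h $ i * f n (shift z h)))) \<longlonglongrightarrow> 0"
      by (intro Lim_null_comparison[OF _ lim] always_eventually allI) simp
  qed
  then have "(\<lambda>n. \<Sum>i\<in>UNIV. LINT z|lborel. partial i \<rho> z * (LINT h|P. a h $ i * f n (shift z h)))
      \<longlonglongrightarrow> (\<Sum>i\<in>UNIV. LINT z|lborel. partial i \<rho> z * (LINT h|P. a h $ i * v (shift z h)))"
    by (intro tendsto_sum)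
  then show ?thesis unfolding zero by (simp add: LIMSEQ_const_iff)
qed

end

locale planar_surface = random_surface P for P :: "(real^2 \<Rightarrow> real) measure"
begin

lemma solenoidal_determinant:
  fixes q r :: "(real^2 \<Rightarrow> real) \<Rightarrow> real^2"
  assumes q: "q \<in> L2 P" "\<And>\<phi>. \<phi> \<in> Cb 2 \<Longrightarrow> (LINT h|P. q h \<bullet> path_grad \<phi> h) = 0"
    and r: "r \<in> L2 P" "\<And>\<phi>. \<phi> \<in> Cb 2 \<Longrightarrow> (LINT h|P. r h \<bullet> path_grad \<phi> h) = 0"
  shows "(LINT h|P. q h $ 1 * r h $ 2 - q h $ 2 * r h $ 1)
    = (LINT h|P. q h $ 1) * (LINT h|P. r h $ 2) - (LINT h|P. q h $ 2) * (LINT h|P. r h $ 1)"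
proof -
  note qi = L2_component[OF q(1)] and ri = L2_component[OF r(1)]
  define E where "E i j z = (LINT h|P. q h $ i * r (shift z h) $ j)" for i j z
  have Ec: "continuous_on UNIV (E i j)" for i j
    unfolding E_def using correlation_continuous[OF qi ri] by simp
  define c where "c z = E 1 2 z - E 2 1 z" for z
  have cc: "continuous_on UNIV c" unfolding c_def by (intro continuous_intros Ec)
  have cxy: "c x = c y" for x y
  proof (rule weak_gradient_zero_imp_const[OF cc])
    fix \<rho> :: "real^2 \<Rightarrow> real" and R i
    assume \<rho>: "Ck 2 \<rho>" "vanishes_outside R \<rho>"
    have k: "Ck (Suc 1) \<rho>" using \<rho>(1) by (simp add: numeral_2_eq_2)
    have cp: "continuous_on UNIV (partial i \<rho>)" for i
    using k unfolding Ck.simps(2) using Ck_continuous by blast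
    have sp: "vanishes_outside R (partial i \<rho>)" for i by (rule partial_vanishes_outside[OF \<rho>(2)])
    let ?I = "\<lambda>k i j. LINT z|lborel. partial k \<rho> z * E i j z"
    have int: "integrable lborel (\<lambda>z. partial k \<rho> z * E i j z)" for i j k
      by (rule integrable_compact_support[of _ R]) (use sp in \<open>auto simp: vanishes_outside_def intro!: continuous_intros cp Ec\<close>)
    \<comment> \<open>The orthogonality of \<open>q\<close> to gradients makes the correlation
      matrix \<open>E\<close> divergence free in its first index.\<close>
    have A: "?I 1 1 j + ?I 2 2 j = 0" for j
      using weak_divergence_correlation[OF q ri \<rho>, of j] by (simp add: sum_2 E_def)
    \<comment> \<open>In the second index the orthogonality of \<open>r\<close> is used. In
      \<open>E\<close> it is \<open>r\<close> that carries the translation; stationarity moves it to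
      \<open>q\<close> and reverses its sign, so the test function has to be reflected.\<close>
    have B: "?I 1 i 1 + ?I 2 i 2 = 0" for i
    proof -
      have pu: "partial k (\<lambda>y. \<rho> (- y)) z = - partial k \<rho> (- z)" for k z
        using partial_uminus[of \<rho> k] k by (simp add: fun_eq_iff)
      have refl: "(LINT z|lborel. partial k (\<lambda>y. \<rho> (- y)) z * (LINT h|P. r h $ k * q (shift z h) $ i)) = - ?I k i k" for k
      proof -
        have "(LINT h|P. r h $ k * q (shift z h) $ i) = E i k (- z)" for z
          using integral_inner_shift[OF L2_measurable[OF ri] L2_measurable[OF qi], of k z i]
          by (simp add: E_def mult.commute)
        then have "(LINT z|lborel. partial k (\<lambda>y. \<rho> (- y)) z * (LINT h|P. r h $ k * q (shift z h) $ i))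
            = (LINT z|lborel. - (partial k \<rho> (- z) * E i k (- z)))"
          by (simp add: pu)
        also have "\<dots> = - (LINT z|lborel. partial k \<rho> (- z) * E i k (- z))" by simp
        also have "(LINT z|lborel. partial k \<rho> (- z) * E i k (- z)) = ?I k i k"
          by (rule integral_lborel_uminus[of "\<lambda>z. partial k \<rho> z * E i k z"])
            (intro borel_measurable_continuous_onI continuous_intros cp Ec)
        finally show ?thesis .
      qed
      have "(\<Sum>k\<in>UNIV. LINT z|lborel. partial k (\<lambda>y. \<rho> (- y)) z * (LINT h|P. r h $ k * q (shift z h) $ i)) = 0"
      proof (rule weak_divergence_correlation[OF r qi Ck_uminus[OF \<rho>(1)]])
        show "vanishes_outside R (\<lambda>y. \<rho> (- y))"
          unfolding vanishes_outside_def
        proof (intro allI impI)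
          fix y :: "real^2" assume "norm y > R"
          then show "\<rho> (- y) = 0" using vanishes_outsideD[OF \<rho>(2), of "- y"] by simp
        qed
      qed
      then show ?thesis unfolding refl by (simp add: sum_2)
    qed
    have "(LINT z|lborel. partial k \<rho> z * c z) = ?I k 1 2 - ?I k 2 1" for k
      using int by (simp add: c_def right_diff_distrib)
    \<comment> \<open>For \<open>k = 1\<close> both terms equal \<open>- ?I 2 2 2\<close>, the first
      by \<open>A\<close> and the second by \<open>B\<close>; for \<open>k = 2\<close> both equal
      \<open>- ?I 1 1 1\<close>.\<close>
    moreover have "?I k 1 2 - ?I k 2 1 = 0" for k
    proof -
      have "k = 1 \<or> k = 2" by (rule exhaust_2)
      then show ?thesis
      proof
        assume k: "k = 1"
        show ?thesis unfolding k using A[of 2] B[of 2] by linarith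
      next
        assume k: "k = 2"
        show ?thesis unfolding k using A[of 1] B[of 1] by linarith
      qed
    qed
    ultimately show "(LINT z|lborel. partial i \<rho> z * c z) = 0" by simp
  qed
  \<comment> \<open>The field \<open>r\<close> turned by a right angle, so that the inner product of
    \<open>q\<close> with \<open>p\<close> is the determinant of \<open>q\<close> and
    \<open>r\<close>.\<close>
  define p :: "(real^2 \<Rightarrow> real) \<Rightarrow> real^2" where "p h = vector [r h $ 2, - r h $ 1]" for h
  have p_nth: "p h $ 1 = r h $ 2" "p h $ 2 = - r h $ 1" for h by (simp_all add: p_def)
  have pL: "p \<in> L2 P"
  proof (rule L2_componentwise)
    fix i :: 2
    have "i = 1 \<or> i = 2" by (rule exhaust_2)
    then show "(\<lambda>h. p h $ i) \<in> L2 P"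
    proof
      assume "i = 1" then show ?thesis using ri[of 2] by (simp add: p_nth)
    next
      assume "i = 2" then show ?thesis using L2_minus[OF ri[of 1]] by (simp add: p_nth)
    qed
  qed
  have qp: "(LINT h|P. q h \<bullet> p (shift x h)) = c x" for x
    using L2_mult_integrable[OF qi L2_shift[OF ri]]
    by (simp add: inner_vec_def sum_2 p_nth c_def E_def)
  have "(LINT h|P. q h \<bullet> p (shift x h)) = c 0" for x
    using qp[of x] cxy[of x 0] by (rule trans)
  from correlation_eq_product_of_means[OF q(1) pL this]
  have "c 0 = (LINT h|P. q h) \<bullet> (LINT h|P. p h)" .
  moreover have "(LINT h|P. u h) $ i = (LINT h|P. u h $ i)" if "u \<in> L2 P" for u :: "_ \<Rightarrow> real^2" and i
    using L2_integrable[OF that] by (simp add: cart_eq_inner_axis)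
  ultimately have "c 0 = (LINT h|P. q h $ 1) * (LINT h|P. r h $ 2) - (LINT h|P. q h $ 2) * (LINT h|P. r h $ 1)"
    using q(1) pL by (simp add: inner_vec_def sum_2 p_nth)
  moreover have "c 0 = (LINT h|P. q h $ 1 * r h $ 2 - q h $ 2 * r h $ 1)"
    using L2_mult_integrable[OF qi ri] by (simp add: c_def E_def)
  ultimately show ?thesis by simp
qed

end

section \<open>The coefficient field in two dimensions\<close>

lemma metric_g_shift: "metric_g 0 (shift y h) = metric_g y h"
  by (simp add: metric_g_def partial_shift shift_apply)

lemma area_shift: "area 0 (shift y h) = area y h"
  by (simp add: area_def metric_g_shift)

lemma det_metric_g: "det (metric_g y (h :: real^2 \<Rightarrow> real)) = 1 + (partial 1 h y)\<^sup>2 + (partial 2 h y)\<^sup>2"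
  by (simp add: det_2 metric_g_def mat_def power2_eq_square algebra_simps)

lemma matrix_inv_eqI:
  fixes A :: "real^'n^'n"
  assumes "A ** B = mat 1" "B ** A = mat 1"
  shows "matrix_inv A = B"
  unfolding matrix_inv_def
proof (rule some_equality)
  fix A' assume "A ** A' = mat 1 \<and> A' ** A = mat 1"
  then have "A' ** (A ** B) = B" by (simp add: matrix_mul_assoc)
  then show "A' = B" using assms by simp
qed (use assms in simp)

lemma matrix_inv_metric_g:
  fixes h :: "real^2 \<Rightarrow> real" and y :: "real^2"
  defines "p \<equiv> partial 1 h y" and "q \<equiv> partial 2 h y"
  shows "matrix_inv (metric_g y h) =
    vector [vector [(1 + q\<^sup>2) / (1 + p\<^sup>2 + q\<^sup>2), - (p * q) / (1 + p\<^sup>2 + q\<^sup>2)],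
            vector [- (p * q) / (1 + p\<^sup>2 + q\<^sup>2), (1 + p\<^sup>2) / (1 + p\<^sup>2 + q\<^sup>2)]]" (is "_ = ?B")
proof (rule matrix_inv_eqI)
  have "1 + p\<^sup>2 + q\<^sup>2 > 0" by (simp add: add_pos_nonneg)
  then have nz: "1 + p\<^sup>2 + q\<^sup>2 \<noteq> 0" by simp
  have g: "metric_g y h $ 1 $ 1 = 1 + p * p" "metric_g y h $ 1 $ 2 = p * q"
    "metric_g y h $ 2 $ 1 = q * p" "metric_g y h $ 2 $ 2 = 1 + q * q"
    by (simp_all add: metric_g_def mat_def p_def q_def)
  show "metric_g y h ** ?B = mat 1"
    using nz by (simp add: vec_eq_iff forall_2 matrix_matrix_mult_def sum_2 g mat_def divide_simps)
      (simp add: power2_eq_square algebra_simps)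
  show "?B ** metric_g y h = mat 1"
    using nz by (simp add: vec_eq_iff forall_2 matrix_matrix_mult_def sum_2 g mat_def divide_simps)
      (simp add: power2_eq_square algebra_simps)
qed

text \<open>The field \<open>A\<close> of the overview. It absorbs the density of the weighted
  measure into the inverse metric, so that energies become plain expectations under
  \<open>P\<close>.\<close>

definition coef :: "(real^2 \<Rightarrow> real) \<Rightarrow> real^2^2" where
  "coef h = area 0 h *\<^sub>R matrix_inv (metric_g 0 h)"

lemma area_eq: "area y (h :: real^2 \<Rightarrow> real) = sqrt (1 + (partial 1 h y)\<^sup>2 + (partial 2 h y)\<^sup>2)"
  by (simp add: area_def det_metric_g)

lemma area_ge_1: "1 \<le> area y (h :: real^2 \<Rightarrow> real)"
  by (simp add: area_eq)

lemma area_sq: "(area y (h :: real^2 \<Rightarrow> real))\<^sup>2 = 1 + (partial 1 h y)\<^sup>2 + (partial 2 h y)\<^sup>2"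
  by (simp add: area_eq)

lemma coef_nth:
  "coef h $ 1 $ 1 = (1 + (partial 2 h 0)\<^sup>2) / area 0 h"
  "coef h $ 1 $ 2 = - (partial 1 h 0 * partial 2 h 0) / area 0 h"
  "coef h $ 2 $ 1 = - (partial 1 h 0 * partial 2 h 0) / area 0 h"
  "coef h $ 2 $ 2 = (1 + (partial 1 h 0)\<^sup>2) / area 0 h"
proof -
  have a: "area 0 h \<noteq> 0" using area_ge_1[of 0 h] by linarith
  show "coef h $ 1 $ 1 = (1 + (partial 2 h 0)\<^sup>2) / area 0 h"
    "coef h $ 1 $ 2 = - (partial 1 h 0 * partial 2 h 0) / area 0 h"
    "coef h $ 2 $ 1 = - (partial 1 h 0 * partial 2 h 0) / area 0 h"
    "coef h $ 2 $ 2 = (1 + (partial 1 h 0)\<^sup>2) / area 0 h"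
    using a by (simp_all add: coef_def matrix_inv_metric_g area_sq[symmetric] power2_eq_square[of "area 0 h"])
qed

lemma coef_shift_nth: "coef (shift y h) $ i $ j = area y h * matrix_inv (metric_g y h) $ i $ j"
  by (simp add: coef_def area_shift metric_g_shift)

lemma coef_mult_nth:
  "(coef h *v x) $ 1 = coef h $ 1 $ 1 * x $ 1 + coef h $ 1 $ 2 * x $ 2"
  "(coef h *v x) $ 2 = coef h $ 1 $ 2 * x $ 1 + coef h $ 2 $ 2 * x $ 2"
  by (simp_all add: matrix_vector_mult_def sum_2 coef_nth)

lemma coef_sym: "x \<bullet> (coef h *v y) = (coef h *v x) \<bullet> y"
  by (simp add: inner_vec_def sum_2 coef_mult_nth algebra_simps)

text \<open>In the plane the adjugate of the metric is the identity plus the tensor square of the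
  gradient of \<open>h\<close> turned by a right angle, and \<open>coef\<close> is this adjugate
  divided by the area.\<close>

lemma coef_quadratic: "x \<bullet> (coef h *v x) = (x \<bullet> x + (partial 2 h 0 * x $ 1 - partial 1 h 0 * x $ 2)\<^sup>2) / area 0 h"
proof -
  have a: "area 0 h \<noteq> 0" using area_ge_1[of 0 h] by linarith
  show ?thesis
    using a by (simp add: inner_vec_def sum_2 coef_mult_nth coef_nth divide_simps)
      (simp add: power2_eq_square algebra_simps)
qed

lemma coef_elliptic: "x \<bullet> x \<le> area 0 h * (x \<bullet> (coef h *v x))"
  using area_ge_1[of 0 h] by (simp add: coef_quadratic)

lemma coef_nonneg: "0 \<le> x \<bullet> (coef h *v x)"
  using area_ge_1[of 0 h] by (simp add: coef_quadratic)

text \<open>This expresses that the inverse metric is at most the identity: after clearing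
  denominators the difference is the square of the derivative of \<open>h\<close> in direction
  \<open>x\<close>. It is the source of the bound 1 on the eigenvalues of the effective
  tensor.\<close>

lemma coef_upper: "x \<bullet> (coef h *v x) \<le> area 0 h * (x \<bullet> x)"
proof -
  let ?p = "partial 1 h 0" and ?q = "partial 2 h 0"
  have a: "0 < area 0 h" using area_ge_1[of 0 h] by linarith
  have "(area 0 h)\<^sup>2 * (x \<bullet> x) - (x \<bullet> x + (?q * x $ 1 - ?p * x $ 2)\<^sup>2) = (?p * x $ 1 + ?q * x $ 2)\<^sup>2"
    unfolding area_sq by (simp add: inner_vec_def sum_2 power2_eq_square algebra_simps)
  then have "x \<bullet> x + (?q * x $ 1 - ?p * x $ 2)\<^sup>2 \<le> (area 0 h)\<^sup>2 * (x \<bullet> x)"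
    by (metis diff_ge_0_iff_ge zero_le_power2)
  then show ?thesis
    using a by (simp add: coef_quadratic divide_le_eq power2_eq_square mult_ac)
qed

lemma coef_det: "coef h $ 1 $ 1 * coef h $ 2 $ 2 - coef h $ 1 $ 2 * coef h $ 1 $ 2 = 1"
proof -
  let ?p = "partial 1 h 0" and ?q = "partial 2 h 0"
  have a: "area 0 h \<noteq> 0" using area_ge_1[of 0 h] by linarith
  have "coef h $ 1 $ 1 * coef h $ 2 $ 2 - coef h $ 1 $ 2 * coef h $ 1 $ 2
      = ((1 + ?q\<^sup>2) * (1 + ?p\<^sup>2) - (?p * ?q) * (?p * ?q)) / (area 0 h)\<^sup>2"
    by (simp add: coef_nth power2_eq_square[of "area 0 h"] diff_divide_distrib)
  also have "(1 + ?q\<^sup>2) * (1 + ?p\<^sup>2) - (?p * ?q) * (?p * ?q) = (area 0 h)\<^sup>2"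
    unfolding area_sq by (simp add: power2_eq_square algebra_simps)
  finally show ?thesis using a by simp
qed

lemma coef_determinant:
  "(coef h *v x) $ 1 * (coef h *v y) $ 2 - (coef h *v x) $ 2 * (coef h *v y) $ 1 = x $ 1 * y $ 2 - x $ 2 * y $ 1"
proof -
  have "(coef h *v x) $ 1 * (coef h *v y) $ 2 - (coef h *v x) $ 2 * (coef h *v y) $ 1
      = (coef h $ 1 $ 1 * coef h $ 2 $ 2 - coef h $ 1 $ 2 * coef h $ 1 $ 2) * (x $ 1 * y $ 2 - x $ 2 * y $ 1)"
    unfolding coef_mult_nth by (simp add: algebra_simps)
  then show ?thesis unfolding coef_det by simp
qed

context random_surface
begin

lemma partials_measurable_P [measurable]: "(\<lambda>h. partial i h 0) \<in> borel_measurable P"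
  "(\<lambda>h. partial j (partial i h) 0) \<in> borel_measurable P"
  using partials_borel_Omega[of "[i]" 0] partials_borel_Omega[of "[i, j]" 0]
  by (simp_all add: sets_P cong: measurable_cong_sets)

lemma partials_bounded:
  "\<exists>K>0. AE h in P. \<forall>x i j. \<bar>partial i h x\<bar> \<le> K \<and> \<bar>partial j (partial i h) x\<bar> \<le> K"
proof -
  obtain K where K: "K > 0" "AE h in P. \<forall>x. tensor_norm 1 h x + tensor_norm 2 h x \<le> K"
    using admissible by (auto simp: admissible_def)
  have "AE h in P. \<forall>x i j. \<bar>partial i h x\<bar> \<le> K \<and> \<bar>partial j (partial i h) x\<bar> \<le> K"
    using K(2)
  proof eventually_elim
    case (elim h)
    show ?case
    proof (intro allI conjI)
      fix x i j
      show "\<bar>partial i h x\<bar> \<le> K"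
        using partials_le_tensor_norm[of "[i]" h x] tensor_norm_nonneg[of 2 h x] elim[THEN spec, of x] by simp
      show "\<bar>partial j (partial i h) x\<bar> \<le> K"
        using partials_le_tensor_norm[of "[i, j]" h x] tensor_norm_nonneg[of 1 h x] elim[THEN spec, of x]
        by (simp add: numeral_2_eq_2)
    qed
  qed
  with K(1) show ?thesis by blast
qed

lemma line_smooth_partial: "line_smooth k (\<lambda>h. partial i h 0) (\<lambda>h. partial k (partial i h) 0)"
proof -
  obtain K where K: "AE h in P. \<forall>x i j. \<bar>partial i h x\<bar> \<le> K \<and> \<bar>partial j (partial i h) x\<bar> \<le> K"
    using partials_bounded by blast
  show ?thesis
    unfolding line_smooth_def
  proof (intro conjI exI partials_measurable_P)
    show "AE h in P. \<forall>t. \<bar>partial i (along k t h) 0\<bar> \<le> K \<and>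
        \<bar>partial k (partial i (along k t h)) 0\<bar> \<le> K \<and>
        ((\<lambda>s. partial i (along k s h) 0) has_real_derivative
          partial k (partial i (along k t h)) 0) (at t)"
      using K AE_space
    proof eventually_elim
      case (elim h)
      have "partial i h differentiable (at x)" for x
        using elim(2) by (simp add: Omega_def numeral_3_eq_3)
      then have "((\<lambda>s. partial i h (s *\<^sub>R axis k 1)) has_real_derivative partial k (partial i h) (t *\<^sub>R axis k 1)) (at t)" for t
        by (rule has_real_derivative_along_axis)
      then show ?case using elim(1) by (simp add: partial_shift shift_apply)
    qed
  qed
qed

text \<open>Meant for \<open>V = det g\<close>, whose inverse square root is the denominator in the
  entries of \<open>coef\<close>. The lower bound 1 keeps the function and its derivative
  bounded.\<close>

lemma line_smooth_inverse_sqrt: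
  assumes V: "line_smooth i V W" and ge: "\<And>h. 1 \<le> V h"
  shows "line_smooth i (\<lambda>h. inverse (sqrt (V h))) (\<lambda>h. - W h * inverse (sqrt (V h)) * inverse (V h) / 2)"
proof -
  obtain C where m [measurable]: "V \<in> borel_measurable P" "W \<in> borel_measurable P"
    and C: "AE h in P. line_regular i C V W h"
    using V by (rule line_smoothE)
  have sq: "0 \<le> inverse (sqrt (V h))" "inverse (sqrt (V h)) \<le> 1" "0 \<le> inverse (V h)" "inverse (V h) \<le> 1" for h
    using ge[of h] by (auto simp: inverse_le_1_iff)
  show ?thesis
    unfolding line_smooth_def
  proof (intro conjI exI)
    show "AE h in P. \<forall>t. \<bar>inverse (sqrt (V (along i t h)))\<bar> \<le> max 1 C \<and>
        \<bar>- W (along i t h) * inverse (sqrt (V (along i t h))) * inverse (V (along i t h)) / 2\<bar> \<le> max 1 C \<and>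
        ((\<lambda>s. inverse (sqrt (V (along i s h)))) has_real_derivative
          - W (along i t h) * inverse (sqrt (V (along i t h))) * inverse (V (along i t h)) / 2) (at t)"
      using C
    proof eventually_elim
      case (elim h)
      show ?case
      proof (intro allI conjI)
        fix t
        let ?V = "V (along i t h)" and ?W = "W (along i t h)"
        have W: "\<bar>?W\<bar> \<le> C" and d: "((\<lambda>s. V (along i s h)) has_real_derivative ?W) (at t)"
          using elim by blast+
        show "\<bar>inverse (sqrt ?V)\<bar> \<le> max 1 C" using sq(1,2)[of "along i t h"] by simp
        have "\<bar>?W\<bar> * inverse (sqrt ?V) * inverse ?V \<le> C * 1 * 1"
          using W sq[of "along i t h"] by (intro mult_mono) auto
        moreover have "\<bar>- ?W * inverse (sqrt ?V) * inverse ?V / 2\<bar> = \<bar>?W\<bar> * inverse (sqrt ?V) * inverse ?V / 2"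
          using sq[of "along i t h"] by (simp only: abs_mult abs_divide abs_minus_cancel abs_of_nonneg abs_numeral)
        ultimately show "\<bar>- ?W * inverse (sqrt ?V) * inverse ?V / 2\<bar> \<le> max 1 C"
          using W by linarith
        have pos: "0 < ?V" using ge[of "along i t h"] by linarith
        have "((\<lambda>s. sqrt (V (along i s h))) has_real_derivative (inverse (sqrt ?V) / 2) * ?W) (at t)"
          by (rule DERIV_chain2[OF DERIV_real_sqrt[OF pos] d])
        then have "((\<lambda>s. inverse (sqrt (V (along i s h)))) has_real_derivative
            - (inverse (sqrt ?V) * ((inverse (sqrt ?V) / 2) * ?W) * inverse (sqrt ?V))) (at t)"
          by (rule DERIV_inverse') (use pos in simp)
        moreover have "inverse (sqrt ?V) * inverse (sqrt ?V) = inverse ?V"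
          using pos by (simp add: inverse_mult_distrib[symmetric])
        moreover have "- (a * ((a / 2) * w) * a) = - w * a * (a * a) / 2" for a w :: real
          by (simp add: algebra_simps)
        ultimately show "((\<lambda>s. inverse (sqrt (V (along i s h)))) has_real_derivative
            - ?W * inverse (sqrt ?V) * inverse ?V / 2) (at t)" by (simp only:)
      qed
    qed
  qed auto
qed

text \<open>Links the derivatives in \<open>drift\<close>, which are taken along the orbit of a
  single surface, with the stochastic derivatives used for integration by parts.\<close>

lemma line_smooth_path_deriv:
  assumes "line_smooth i V W"
  shows "AE h in P. path_deriv i V h = W h"
proof -
  obtain C where "AE h in P. line_regular i C V W h"
    using assms by (rule line_smoothE)
  then show ?thesis
  proof eventually_elim
    case (elim h)
    have "((\<lambda>s. V (along i s h)) has_real_derivative W (shift (0 *\<^sub>R axis i 1) h)) (at 0)"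
      using elim by blast
    then show ?case
      by (simp add: path_deriv_def partial_def DERIV_imp_deriv)
  qed
qed

lemma line_smooth_diff:
  assumes "line_smooth i V W" "line_smooth i V' W'"
  shows "line_smooth i (\<lambda>h. V h - V' h) (\<lambda>h. W h - W' h)"
  using line_smooth_add[OF assms(1) line_smooth_mult[OF line_smooth_const[of i "-1"] assms(2)]] by simp

text \<open>\<open>L_hat\<close> differentiates a flux built from an arbitrary version of the
  gradient, which has to be replaced by the smooth one. Stationarity lets equality almost everywhere
  pass to the translates in the difference quotient.\<close>

lemma has_stoch_deriv_cong_AE:
  assumes d: "has_stoch_deriv P i V W" and V': "V' \<in> borel_measurable P" and eq: "AE h in P. V h = V' h"
  shows "has_stoch_deriv P i V' W"
proof -
  have [measurable]: "V \<in> borel_measurable P" "W \<in> borel_measurable P"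
    using d by (auto simp: has_stoch_deriv_def dest: L2_measurable)
  note [measurable] = V'
  have "V' \<in> L2 P"
  proof (rule L2_dominated[where u=V and C=1, OF _ V'])
    show "V \<in> L2 P" using d by (simp add: has_stoch_deriv_def)
    show "AE h in P. norm (V' h) \<le> 1 * norm (V h)" using eq by eventually_elim simp
  qed
  moreover have "L2_norm P (\<lambda>h. diff_quot i t V h - W h) = L2_norm P (\<lambda>h. diff_quot i t V' h - W h)" for t
  proof (rule L2_norm_cong_AE)
    show "AE h in P. norm (diff_quot i t V h - W h) = norm (diff_quot i t V' h - W h)"
      using eq AE_shift[OF eq, of "t *\<^sub>R axis i 1"] by eventually_elim simp
  qed (simp_all add: measurable_compose[OF shift_measurable_P])
  ultimately show ?thesis using d by (simp add: has_stoch_deriv_def)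
qed

end

text \<open>The eigenvalues of \<open>coef h\<close> are the area, across the gradient of
  \<open>h\<close>, and its inverse, along the gradient. The area is the larger one because it is at
  least 1.\<close>

lemma coef_norm_le: "norm (coef h *v x) \<le> area 0 h * norm x"
proof -
  let ?p = "partial 1 h 0" and ?q = "partial 2 h 0" and ?s = "area 0 h"
  have s: "0 < ?s" using area_ge_1[of 0 h] by linarith
  have "?s\<^sup>2 * ?s\<^sup>2 * (x \<bullet> x) - ?s\<^sup>2 * ((coef h *v x) \<bullet> (coef h *v x))
      = (?s\<^sup>2 + 1) * (?p * x $ 1 + ?q * x $ 2)\<^sup>2"
  proof -
    have c: "?s * (coef h *v x) $ 1 = (1 + ?q\<^sup>2) * x $ 1 - ?p * ?q * x $ 2"
      "?s * (coef h *v x) $ 2 = - (?p * ?q) * x $ 1 + (1 + ?p\<^sup>2) * x $ 2"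
      using s by (simp_all add: coef_mult_nth coef_nth field_simps)
    have "?s\<^sup>2 * ((coef h *v x) \<bullet> (coef h *v x)) = (?s * (coef h *v x) $ 1)\<^sup>2 + (?s * (coef h *v x) $ 2)\<^sup>2"
      by (simp add: inner_vec_def sum_2 power2_eq_square algebra_simps)
    then show ?thesis
      unfolding c area_sq by (simp add: inner_vec_def sum_2 power2_eq_square algebra_simps)
  qed
  then have "?s\<^sup>2 * ((coef h *v x) \<bullet> (coef h *v x)) \<le> ?s\<^sup>2 * (?s\<^sup>2 * (x \<bullet> x))"
    using zero_le_power2[of "?p * x $ 1 + ?q * x $ 2"] s
    by (metis (no_types, opaque_lifting) add_nonneg_nonneg diff_ge_0_iff_ge mult.assoc mult_nonneg_nonneg zero_le_one zero_le_power2)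
  then have "(coef h *v x) \<bullet> (coef h *v x) \<le> ?s\<^sup>2 * (x \<bullet> x)"
    by (rule mult_left_le_imp_le) (use s in simp)
  then have "(norm (coef h *v x))\<^sup>2 \<le> (?s * norm x)\<^sup>2"
    by (simp add: power2_norm_eq_inner power_mult_distrib)
  then show ?thesis by (rule power2_le_imp_le) (use s in simp)
qed

lemma borel_measurable_vecI:
  fixes u :: "'a \<Rightarrow> real^'n"
  assumes "\<And>i. (\<lambda>x. u x $ i) \<in> borel_measurable M"
  shows "u \<in> borel_measurable M"
  unfolding borel_measurable_euclidean_space[of u] using assms by (auto simp: Basis_vec_def inner_axis)

context planar_surface
begin

section \<open>Regularity and bounds of the coefficients\<close>

lemma inverse_area_eq: "inverse (area 0 h) = inverse (sqrt (1 + (partial 1 h 0 * partial 1 h 0 + partial 2 h 0 * partial 2 h 0)))"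
  for h :: "real^2 \<Rightarrow> real"
  by (simp add: area_eq power2_eq_square add.assoc)

lemma coef_line_smooth: "\<exists>W. line_smooth k (\<lambda>h. coef h $ i $ j) W"
proof -
  note ps = line_smooth_partial[of k 1] line_smooth_partial[of k 2]
  note c1 = line_smooth_const[of k 1]
  note pp = line_smooth_mult[OF ps(1) ps(1)] line_smooth_mult[OF ps(2) ps(2)] line_smooth_mult[OF ps(1) ps(2)]
  have "line_smooth k (\<lambda>h. inverse (sqrt (1 + (partial 1 h 0 * partial 1 h 0 + partial 2 h 0 * partial 2 h 0)))) (\<lambda>h.
      - (0 + ((partial k (partial 1 h) 0 * partial 1 h 0 + partial k (partial 1 h) 0 * partial 1 h 0) +
             (partial k (partial 2 h) 0 * partial 2 h 0 + partial k (partial 2 h) 0 * partial 2 h 0)))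
      * inverse (sqrt (1 + (partial 1 h 0 * partial 1 h 0 + partial 2 h 0 * partial 2 h 0)))
      * inverse (1 + (partial 1 h 0 * partial 1 h 0 + partial 2 h 0 * partial 2 h 0)) / 2)"
    by (rule line_smooth_inverse_sqrt[OF line_smooth_add[OF c1 line_smooth_add[OF pp(1) pp(2)]]]) simp
  then obtain W where "line_smooth k (\<lambda>h. inverse (sqrt (1 + (partial 1 h 0 * partial 1 h 0 + partial 2 h 0 * partial 2 h 0)))) W"
    by blast
  then have inv: "line_smooth k (\<lambda>h. inverse (area 0 h)) W" by (simp only: inverse_area_eq)
  have i: "i = 1 \<or> i = 2" and j: "j = 1 \<or> j = 2" by (rule exhaust_2)+
  have 11: "\<exists>W. line_smooth k (\<lambda>h. coef h $ 1 $ 1) W"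
    using line_smooth_mult[OF line_smooth_add[OF c1 pp(2)] inv]
    by (auto simp: coef_nth divide_inverse power2_eq_square)
  have 22: "\<exists>W. line_smooth k (\<lambda>h. coef h $ 2 $ 2) W"
    using line_smooth_mult[OF line_smooth_add[OF c1 pp(1)] inv]
    by (auto simp: coef_nth divide_inverse power2_eq_square)
  have 12: "\<exists>W. line_smooth k (\<lambda>h. - (partial 1 h 0 * partial 2 h 0) / area 0 h) W"
    using line_smooth_mult[OF line_smooth_mult[OF line_smooth_const[of k "-1"] pp(3)] inv]
    by (auto simp: divide_inverse)
  from 11 22 12 i j show ?thesis by (auto simp: coef_nth(2,3))
qed

text \<open>Drift and integration by parts only ask for the existence of a bounded derivative along
  lines, so it is chosen abstractly.\<close>

definition dcoef :: "2 \<Rightarrow> 2 \<Rightarrow> 2 \<Rightarrow> (real^2 \<Rightarrow> real) \<Rightarrow> real" where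
  "dcoef i j k = (SOME W. line_smooth k (\<lambda>h. coef h $ i $ j) W)"

lemma line_smooth_coef: "line_smooth k (\<lambda>h. coef h $ i $ j) (dcoef i j k)"
  unfolding dcoef_def by (rule someI_ex[OF coef_line_smooth])

lemma coef_measurable [measurable]: "(\<lambda>h. coef h $ i $ j) \<in> borel_measurable P"
  using line_smooth_coef[of 1 i j] by (simp add: line_smooth_def)

lemma dcoef_measurable [measurable]: "dcoef i j k \<in> borel_measurable P"
  using line_smooth_coef[of k i j] by (simp add: line_smooth_def)

lemma area_measurable [measurable]: "area 0 \<in> borel_measurable P"
proof -
  have "(\<lambda>h. sqrt (1 + (partial 1 h 0)\<^sup>2 + (partial 2 h 0)\<^sup>2)) \<in> borel_measurable P" by measurable
  then show ?thesis by (simp add: area_eq[abs_def])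
qed

text \<open>Serves at once as an almost sure bound for the area, for the norm of
  \<open>coef\<close>, and for the inverse of its ellipticity constant.\<close>

definition area_bound :: real where
  "area_bound = (SOME C. 1 \<le> C \<and> (AE h in P. area 0 h \<le> C))"

lemma area_bound: "1 \<le> area_bound" "AE h in P. area 0 h \<le> area_bound"
proof -
  obtain K where K: "K > 0" "AE h in P. \<forall>x i j. \<bar>partial i h x\<bar> \<le> K \<and> \<bar>partial j (partial i h) x\<bar> \<le> K"
    using partials_bounded by blast
  have "AE h in P. area 0 h \<le> sqrt (1 + K\<^sup>2 + K\<^sup>2)"
    using K(2)
  proof eventually_elim
    case (elim h)
    have "(partial i h 0)\<^sup>2 \<le> K\<^sup>2" for i
      using elim power_mono[of "\<bar>partial i h 0\<bar>" K 2] by simp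
    then show ?case unfolding area_eq by (intro real_sqrt_le_mono add_mono) auto
  qed
  moreover have "1 \<le> sqrt (1 + K\<^sup>2 + K\<^sup>2)" by simp
  ultimately have "\<exists>C. 1 \<le> C \<and> (AE h in P. area 0 h \<le> C)" by blast
  from someI_ex[OF this] show "1 \<le> area_bound" "AE h in P. area 0 h \<le> area_bound"
    by (simp_all add: area_bound_def)
qed

lemma area_integrable: "integrable P (area 0)"
proof (rule L2_integrable[OF L2_bounded])
  show "AE h in P. norm (area 0 h) \<le> area_bound"
    using area_bound(2)
  proof eventually_elim
    case (elim h)
    then show ?case using area_ge_1[of 0 h] by simp
  qed
qed simp

lemma Z_ge_1: "1 \<le> Zconst P"
proof -
  have "(LINT h|P. 1) \<le> Zconst P"
    unfolding Zconst_def by (intro integral_mono area_integrable area_ge_1) simp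
  then show ?thesis by (simp add: prob_space)
qed

abbreviation "Z \<equiv> Zconst P"

lemma Z_pos: "0 < Z" using Z_ge_1 by linarith

section \<open>The weighted measure, the energy form and weak equations\<close>

lemma sets_pi [measurable_cong]: "sets (pi_measure P) = sets P"
  by (simp add: pi_measure_def)

lemma AE_pi: "(AE h in pi_measure P. Q h) \<longleftrightarrow> (AE h in P. Q h)"
proof -
  have "0 < area 0 h / Z" for h :: "real^2 \<Rightarrow> real" using area_ge_1[of 0 h] Z_pos by (simp add: less_le_trans[OF zero_less_one])
  then show ?thesis
    unfolding pi_measure_def by (subst AE_density) auto
qed

lemma integral_pi:
  fixes f :: "_ \<Rightarrow> real"
  assumes "f \<in> borel_measurable P"
  shows "(LINT h|pi_measure P. f h) = (LINT h|P. area 0 h * f h) / Z"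
proof -
  have "0 \<le> area 0 h / Z" for h :: "real^2 \<Rightarrow> real" using area_ge_1[of 0 h] Z_pos by (simp add: order_trans[OF zero_le_one])
  then have "(LINT h|pi_measure P. f h) = (LINT h|P. (area 0 h / Z) *\<^sub>R f h)"
    unfolding pi_measure_def using assms by (intro integral_density) auto
  then show ?thesis by simp
qed

lemma integrable_pi:
  fixes f :: "_ \<Rightarrow> real"
  assumes "f \<in> borel_measurable P"
  shows "integrable (pi_measure P) f \<longleftrightarrow> integrable P (\<lambda>h. area 0 h * f h)"
proof -
  have "0 \<le> area 0 h / Z" for h :: "real^2 \<Rightarrow> real" using area_ge_1[of 0 h] Z_pos by (simp add: order_trans[OF zero_le_one])
  then have "integrable (pi_measure P) f \<longleftrightarrow> integrable P (\<lambda>h. (area 0 h / Z) *\<^sub>R f h)"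
    unfolding pi_measure_def using assms by (intro integrable_density) auto
  also have "\<dots> \<longleftrightarrow> integrable P (\<lambda>h. area 0 h * f h)"
  proof
    assume "integrable P (\<lambda>h. (area 0 h / Z) *\<^sub>R f h)"
    then have "integrable P (\<lambda>h. Z * ((area 0 h / Z) *\<^sub>R f h))" by (rule integrable_mult_right)
    then show "integrable P (\<lambda>h. area 0 h * f h)" using Z_pos by simp
  next
    assume "integrable P (\<lambda>h. area 0 h * f h)"
    then have "integrable P (\<lambda>h. (1 / Z) * (area 0 h * f h))" by (rule integrable_mult_right)
    then show "integrable P (\<lambda>h. (area 0 h / Z) *\<^sub>R f h)" by simp
  qed
  finally show ?thesis .
qed

lemma L2_imp_L2_pi:
  fixes u :: "_ \<Rightarrow> real"
  assumes "u \<in> L2 P"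
  shows "u \<in> L2 (pi_measure P)"
proof (rule L2_I)
  have m [measurable]: "u \<in> borel_measurable P" using assms by (rule L2_measurable)
  then show "u \<in> borel_measurable (pi_measure P)" by (simp cong: measurable_cong_sets add: sets_pi)
  have i: "integrable P (\<lambda>h. area_bound * (norm (u h))\<^sup>2)"
    using L2_square_integrable[OF assms] by simp
  have "integrable P (\<lambda>h. area 0 h * (norm (u h))\<^sup>2)"
  proof (rule Bochner_Integration.integrable_bound[OF i])
    show "AE h in P. norm (area 0 h * (norm (u h))\<^sup>2) \<le> norm (area_bound * (norm (u h))\<^sup>2)"
      using area_bound(2)
    proof eventually_elim
      case (elim h)
      then show ?case using area_ge_1[of 0 h] by (auto simp: abs_mult intro!: mult_right_mono)
    qed
  qed measurable
  then show "integrable (pi_measure P) (\<lambda>h. (norm (u h))\<^sup>2)"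
    by (subst integrable_pi) auto
qed

lemma coef_mult_measurable:
  assumes "G \<in> borel_measurable P"
  shows "(\<lambda>h. coef h *v G h) \<in> borel_measurable P"
proof (rule borel_measurable_vecI)
  note [measurable] = assms
  fix i :: 2
  have "(\<lambda>h. \<Sum>j\<in>UNIV. coef h $ i $ j * G h $ j) \<in> borel_measurable P" by measurable
  then show "(\<lambda>h. (coef h *v G h) $ i) \<in> borel_measurable P" by (simp add: matrix_vector_mult_def)
qed

lemma coef_mult_L2:
  assumes "G \<in> L2 P"
  shows "(\<lambda>h. coef h *v G h) \<in> L2 P"
    and "L2_norm P (\<lambda>h. coef h *v G h) \<le> area_bound * L2_norm P G"
proof -
  have m: "(\<lambda>h. coef h *v G h) \<in> borel_measurable P"
    by (rule coef_mult_measurable[OF L2_measurable[OF assms]])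
  have "AE h in P. norm (coef h *v G h) \<le> area_bound * norm (G h)"
    using area_bound(2)
  proof eventually_elim
    case (elim h)
    show ?case
      by (rule order_trans[OF coef_norm_le mult_right_mono[OF elim]]) simp
  qed
  with m show "(\<lambda>h. coef h *v G h) \<in> L2 P" "L2_norm P (\<lambda>h. coef h *v G h) \<le> area_bound * L2_norm P G"
    using L2_dominated[OF assms m] L2_norm_mono[OF assms m] area_bound(1) by auto
qed

lemma coef_mult_tendsto:
  assumes "\<And>n. G n \<in> L2 P" "H \<in> L2 P" "((\<lambda>n. L2_norm P (\<lambda>h. G n h - H h)) \<longlongrightarrow> 0) F"
  shows "((\<lambda>n. L2_norm P (\<lambda>h. coef h *v G n h - coef h *v H h)) \<longlongrightarrow> 0) F"
proof (rule Lim_null_comparison)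
  show "((\<lambda>n. area_bound * L2_norm P (\<lambda>h. G n h - H h)) \<longlongrightarrow> 0) F"
    using tendsto_mult_left[OF assms(3), of area_bound] by simp
  show "\<forall>\<^sub>F n in F. norm (L2_norm P (\<lambda>h. coef h *v G n h - coef h *v H h)) \<le> area_bound * L2_norm P (\<lambda>h. G n h - H h)"
    using coef_mult_L2(2)[OF L2_diff[OF assms(1,2)]]
    by (intro always_eventually allI) (simp add: matrix_vector_mult_diff_distrib)
qed

text \<open>The energy form without its normalisation: on gradients of test functions it is
  \<open>Z\<close> times the form whose square root is \<open>H1_norm\<close>.\<close>

definition form :: "((real^2 \<Rightarrow> real) \<Rightarrow> real^2) \<Rightarrow> ((real^2 \<Rightarrow> real) \<Rightarrow> real^2) \<Rightarrow> real" where
  "form G H = (LINT h|P. G h \<bullet> (coef h *v H h))"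

lemma form_integrable: "G \<in> L2 P \<Longrightarrow> H \<in> L2 P \<Longrightarrow> integrable P (\<lambda>h. G h \<bullet> (coef h *v H h))"
  by (rule L2_inner_integrable[OF _ coef_mult_L2(1)])

lemma form_commute: "form G H = form H G"
proof -
  have "G h \<bullet> (coef h *v H h) = H h \<bullet> (coef h *v G h)" for h
    unfolding coef_sym[of "G h"] by (rule inner_commute)
  then show ?thesis by (simp only: form_def)
qed

lemma form_add_left:
  assumes "G \<in> L2 P" "G' \<in> L2 P" "H \<in> L2 P"
  shows "form (\<lambda>h. G h + G' h) H = form G H + form G' H"
  using form_integrable[OF assms(1,3)] form_integrable[OF assms(2,3)]
  by (simp add: form_def inner_add_left)

lemma form_diff_left:
  assumes "G \<in> L2 P" "G' \<in> L2 P" "H \<in> L2 P"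
  shows "form (\<lambda>h. G h - G' h) H = form G H - form G' H"
  using form_integrable[OF assms(1,3)] form_integrable[OF assms(2,3)]
  by (simp add: form_def inner_diff_left)

lemma form_scaleR_left: "form (\<lambda>h. c *\<^sub>R G h) H = c * form G H"
  by (simp add: form_def)

lemma form_nonneg: "0 \<le> form G G"
  unfolding form_def by (intro integral_nonneg_AE AE_I2 coef_nonneg)

lemma form_tendsto:
  assumes "\<And>n. G n \<in> L2 P" "G' \<in> L2 P" "((\<lambda>n. L2_norm P (\<lambda>h. G n h - G' h)) \<longlongrightarrow> 0) F"
    and "\<And>n. H n \<in> L2 P" "H' \<in> L2 P" "((\<lambda>n. L2_norm P (\<lambda>h. H n h - H' h)) \<longlongrightarrow> 0) F"
  shows "((\<lambda>n. form (G n) (H n)) \<longlongrightarrow> form G' H') F"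
  unfolding form_def
  by (intro L2_inner_tendsto always_eventually allI assms coef_mult_L2 coef_mult_tendsto)

lemma form_tendsto_left:
  assumes "\<And>n. G n \<in> L2 P" "G' \<in> L2 P" "((\<lambda>n. L2_norm P (\<lambda>h. G n h - G' h)) \<longlongrightarrow> 0) F" "H \<in> L2 P"
  shows "((\<lambda>n. form (G n) H) \<longlongrightarrow> form G' H) F"
  by (rule form_tendsto) (use assms in \<open>auto simp: L2_norm_def\<close>)

lemma form_elliptic:
  assumes G: "G \<in> L2 P"
  shows "(L2_norm P G)\<^sup>2 \<le> area_bound * form G G"
proof -
  have "(LINT h|P. (norm (G h))\<^sup>2) \<le> (LINT h|P. area_bound * (G h \<bullet> (coef h *v G h)))"
  proof (rule integral_mono_AE)
    show "AE h in P. (norm (G h))\<^sup>2 \<le> area_bound * (G h \<bullet> (coef h *v G h))"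
      using area_bound(2)
    proof eventually_elim
      case (elim h)
      show ?case
        unfolding power2_norm_eq_inner
        by (rule order_trans[OF coef_elliptic mult_right_mono[OF elim coef_nonneg]])
    qed
  qed (use L2_square_integrable[OF G] form_integrable[OF G G] in auto)
  then show ?thesis by (simp add: L2_norm_eq form_def)
qed

lemma Cb2: "\<phi> \<in> Cb 2 \<Longrightarrow> \<phi> \<in> Cb (Suc 1)"
  by (simp add: numeral_2_eq_2)

lemmas grad_L2 = path_grad_L2[OF Cb2]

text \<open>\<open>W\<close> is the divergence of the flux
  \<open>coef h *v path_grad \<phi> h\<close>. As \<open>L_hat\<close> contains chosen versions of
  both gradient and divergence, it agrees with \<open>W\<close> over the area only almost
  everywhere.\<close>

lemma form_grad_by_parts:
  assumes \<phi>: "\<phi> \<in> Cb 2"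
  shows "\<exists>W. W \<in> borel_measurable P \<and> (AE h in P. L_hat P \<phi> h = W h / area 0 h) \<and>
    (\<forall>u\<in>Cb 2. (LINT h|P. u h * W h) = - form (path_grad u) (path_grad \<phi>))"
proof -
  let ?V = "\<lambda>a h. (coef h *v path_grad \<phi> h) $ a"
  have "\<exists>W. line_smooth a (?V a) W" for a
  proof -
    have "line_smooth a (\<lambda>h. \<Sum>b\<in>UNIV. coef h $ a $ b * path_deriv b \<phi> h)
      (\<lambda>h. \<Sum>b\<in>UNIV. dcoef a b a h * path_deriv b \<phi> h + path_deriv a (path_deriv b \<phi>) h * coef h $ a $ b)"
      using Cb_line_smooth[of "path_deriv b \<phi>" 0 a for b] Cb_path_deriv[OF Cb2[OF \<phi>]]
      by (intro line_smooth_sum line_smooth_mult line_smooth_coef) simp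
    then show ?thesis by (auto simp: matrix_vector_mult_def)
  qed
  then obtain W where W: "\<And>a. line_smooth a (?V a) (W a)" by metis
  have d: "has_stoch_deriv P a (?V a) (W a)" for a by (rule line_smooth_imp_has_stoch_deriv[OF W])
  have WL: "W a \<in> L2 P" for a using d by (simp add: has_stoch_deriv_def)
  let ?V' = "\<lambda>h. area 0 h *\<^sub>R (matrix_inv (metric_g 0 h) *v stoch_grad P \<phi> h)"
  have V': "?V' h = coef h *v stoch_grad P \<phi> h" for h
    by (simp add: coef_def scaleR_matrix_vector_assoc)
  have "AE h in P. \<forall>a. stoch_deriv P a (\<lambda>h. ?V' h $ a) h = W a h"
    unfolding AE_all_countable
  proof
    fix a
    have "has_stoch_deriv P a (\<lambda>h. ?V' h $ a) (W a)"
    proof (rule has_stoch_deriv_cong_AE[OF d])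
      show "(\<lambda>h. ?V' h $ a) \<in> borel_measurable P"
        unfolding V' using L2_measurable[OF L2_component[OF coef_mult_L2(1)[OF stoch_grad_L2[OF Cb2[OF \<phi>]]]]] .
      show "AE h in P. ?V a h = ?V' h $ a"
        using stoch_grad_AE_eq[OF Cb2[OF \<phi>]] unfolding V' by eventually_elim simp
    qed
    then show "AE h in P. stoch_deriv P a (\<lambda>h. ?V' h $ a) h = W a h" by (rule stoch_deriv_AE_eq)
  qed
  then have L: "AE h in P. L_hat P \<phi> h = (\<Sum>a\<in>UNIV. W a h) / area 0 h"
    by eventually_elim (simp add: L_hat_def stoch_div_def)
  show ?thesis
  proof (intro exI conjI ballI)
    show "AE h in P. L_hat P \<phi> h = (\<Sum>a\<in>UNIV. W a h) / area 0 h" by (rule L)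
    show "(\<lambda>h. \<Sum>a\<in>UNIV. W a h) \<in> borel_measurable P" using WL[THEN L2_measurable] by measurable
    fix u :: "(real^2 \<Rightarrow> real) \<Rightarrow> real" assume u: "u \<in> Cb 2"
    note ud = Cb_has_stoch_deriv[OF Cb2[OF u]]
    have uL: "u \<in> L2 P" by (rule Cb_L2[OF Cb2[OF u]])
    have "(LINT h|P. u h * (\<Sum>a\<in>UNIV. W a h)) = (\<Sum>a\<in>UNIV. LINT h|P. u h * W a h)"
      using L2_mult_integrable[OF uL WL] by (simp add: sum_distrib_left)
    also have "\<dots> = (\<Sum>a\<in>UNIV. - (LINT h|P. path_deriv a u h * ?V a h))"
      using has_stoch_deriv_by_parts[OF ud d] by simp
    also have "\<dots> = - (LINT h|P. (\<Sum>a\<in>UNIV. path_deriv a u h * ?V a h))"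
      using L2_mult_integrable[OF L2_component[OF grad_L2[OF u]] L2_component[OF coef_mult_L2(1)[OF grad_L2[OF \<phi>]]]]
      by (simp add: sum_negf)
    finally show "(LINT h|P. u h * (\<Sum>a\<in>UNIV. W a h)) = - form (path_grad u) (path_grad \<phi>)"
      by (simp add: form_def inner_vec_def)
  qed
qed

text \<open>The assumption on \<open>L_hat P \<phi>\<close> secures measurability of the chosen
  version. In the application it holds because the graph of a self-adjoint operator lies in
  L2.\<close>

lemma L_hat_form:
  assumes u: "u \<in> Cb 2" and \<phi>: "\<phi> \<in> Cb 2" and m: "L_hat P \<phi> \<in> L2 (pi_measure P)"
  shows "L2_inner (pi_measure P) u (L_hat P \<phi>) = - form (path_grad u) (path_grad \<phi>) / Z"
proof -
  obtain W where W: "W \<in> borel_measurable P" "AE h in P. L_hat P \<phi> h = W h / area 0 h"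
    "\<And>u. u \<in> Cb 2 \<Longrightarrow> (LINT h|P. u h * W h) = - form (path_grad u) (path_grad \<phi>)"
    using form_grad_by_parts[OF \<phi>] by blast
  have [measurable]: "L_hat P \<phi> \<in> borel_measurable P" "u \<in> borel_measurable P"
    using L2_measurable[OF m] Cb_measurable[OF u] by (simp_all cong: measurable_cong_sets add: sets_pi)
  note [measurable] = W(1)
  have "L2_inner (pi_measure P) u (L_hat P \<phi>) = (LINT h|P. area 0 h * (u h * L_hat P \<phi> h)) / Z"
    unfolding L2_inner_def by (rule integral_pi) measurable
  also have "(LINT h|P. area 0 h * (u h * L_hat P \<phi> h)) = (LINT h|P. u h * W h)"
  proof (rule integral_cong_AE)
    show "AE h in P. area 0 h * (u h * L_hat P \<phi> h) = u h * W h"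
      using W(2)
    proof eventually_elim
      case (elim h)
      then show ?case using area_ge_1[of 0 h] by simp
    qed
  qed measurable
  finally show ?thesis using W(3)[OF u] by simp
qed

text \<open>The drift is the row-wise divergence of \<open>coef\<close> divided by the area. Hence
  the drift on the right-hand side of the corrector problem combines with the gradient of the
  corrector: the field \<open>e + grad\<close> has a divergence-free flux.\<close>

lemma drift_form:
  "\<exists>B\<in>L2 P. (AE h in P. drift 0 h \<bullet> e = B h / area 0 h) \<and>
    (\<forall>\<phi>\<in>Cb 2. (LINT h|P. B h * \<phi> h) = - form (\<lambda>h. e) (path_grad \<phi>))"
proof -
  let ?B = "\<lambda>h. \<Sum>i\<in>UNIV. e $ i * (\<Sum>j\<in>UNIV. dcoef i j j h)"
  have d: "has_stoch_deriv P j (\<lambda>h. coef h $ i $ j) (dcoef i j j)" for i j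
    by (rule line_smooth_imp_has_stoch_deriv[OF line_smooth_coef])
  have dL: "dcoef i j j \<in> L2 P" for i j using d by (simp add: has_stoch_deriv_def)
  have BL: "?B \<in> L2 P" by (intro L2_sum L2_cmult dL)
  have "AE h in P. \<forall>i j. path_deriv j (\<lambda>h. coef h $ i $ j) h = dcoef i j j h"
    unfolding AE_all_countable by (intro allI line_smooth_path_deriv line_smooth_coef)
  then have dr: "AE h in P. drift 0 h \<bullet> e = ?B h / area 0 h"
  proof eventually_elim
    case (elim h)
    have "partial j (\<lambda>y. area y h * matrix_inv (metric_g y h) $ i $ j) 0 = dcoef i j j h" for i j
      using elim by (simp add: path_deriv_def coef_shift_nth)
    then show ?case
      by (simp add: drift_def inner_vec_def sum_2 add_divide_distrib algebra_simps)
  qed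
  show ?thesis
  proof (intro bexI[of _ ?B] conjI dr ballI BL)
    fix \<phi> :: "(real^2 \<Rightarrow> real) \<Rightarrow> real" assume \<phi>: "\<phi> \<in> Cb 2"
    have \<phi>L: "\<phi> \<in> L2 P" by (rule Cb_L2[OF Cb2[OF \<phi>]])
    note \<phi>d = Cb_has_stoch_deriv[OF Cb2[OF \<phi>]]
    have cL: "(\<lambda>h. coef h $ i $ j) \<in> L2 P" for i j using d[of j i] by (simp add: has_stoch_deriv_def)
    note int = L2_mult_integrable[OF cL L2_component[OF grad_L2[OF \<phi>]], unfolded path_grad_component]
    have "(LINT h|P. ?B h * \<phi> h) = (LINT h|P. (\<Sum>i\<in>UNIV. \<Sum>j\<in>UNIV. e $ i * (dcoef i j j h * \<phi> h)))"
      by (simp add: sum_distrib_left sum_distrib_right mult_ac)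
    also have "\<dots> = (\<Sum>i\<in>UNIV. \<Sum>j\<in>UNIV. e $ i * (LINT h|P. dcoef i j j h * \<phi> h))"
      using L2_mult_integrable[OF dL \<phi>L] by simp
    also have "\<dots> = (\<Sum>i\<in>UNIV. \<Sum>j\<in>UNIV. - (e $ i * (LINT h|P. coef h $ i $ j * path_deriv j \<phi> h)))"
      using has_stoch_deriv_by_parts[OF d \<phi>d] by simp
    also have "\<dots> = - (LINT h|P. (\<Sum>i\<in>UNIV. \<Sum>j\<in>UNIV. e $ i * (coef h $ i $ j * path_deriv j \<phi> h)))"
      using int by (simp add: sum_negf)
    also have "\<dots> = - form (\<lambda>h. e) (path_grad \<phi>)"
      by (simp add: form_def inner_vec_def matrix_vector_mult_def sum_distrib_left)
    finally show "(LINT h|P. ?B h * \<phi> h) = - form (\<lambda>h. e) (path_grad \<phi>)" .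
  qed
qed

end

section \<open>Correctors\<close>

context planar_surface
begin

text \<open>Differences are what \<open>H1\<close> and \<open>H1_dist\<close> measure; smoothness
  along lines passes to them and identifies their stochastic gradient.\<close>

lemma H1_norm_diff:
  assumes \<phi>: "\<phi> \<in> Cb 2" and \<psi>: "\<psi> \<in> Cb 2"
  shows "H1_norm P (\<lambda>h. \<phi> h - \<psi> h)
    = sqrt (form (\<lambda>h. path_grad \<phi> h - path_grad \<psi> h) (\<lambda>h. path_grad \<phi> h - path_grad \<psi> h) / Z)"
proof -
  let ?d = "\<lambda>h. \<phi> h - \<psi> h" and ?g = "\<lambda>h. path_grad \<phi> h - path_grad \<psi> h"
  have d: "has_stoch_deriv P i ?d (\<lambda>h. path_deriv i \<phi> h - path_deriv i \<psi> h)" for i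
    by (intro line_smooth_imp_has_stoch_deriv line_smooth_diff Cb_line_smooth[OF Cb2] \<phi> \<psi>)
  have "AE h in P. \<forall>i. stoch_deriv P i ?d h = path_deriv i \<phi> h - path_deriv i \<psi> h"
    unfolding AE_all_countable by (intro allI stoch_deriv_AE_eq d)
  then have eq: "AE h in P. stoch_grad P ?d h = ?g h"
    by eventually_elim (simp add: vec_eq_iff)
  have sL: "stoch_grad P ?d \<in> L2 P"
    by (rule L2_componentwise)
      (use has_stoch_deriv_stoch_deriv[OF d] in \<open>auto simp: has_stoch_deriv_def\<close>)
  have gL: "?g \<in> L2 P" by (intro L2_diff grad_L2 \<phi> \<psi>)
  have "(LINT h|P. (stoch_grad P ?d h \<bullet> (matrix_inv (metric_g 0 h) *v stoch_grad P ?d h)) * area 0 h)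
      = form (stoch_grad P ?d) (stoch_grad P ?d)"
    unfolding form_def coef_def by (simp add: scaleR_matrix_vector_assoc[symmetric] mult.commute)
  also have "\<dots> = form ?g ?g"
    unfolding form_def
    by (rule integral_cong_AE)
      (use form_integrable[OF sL sL] form_integrable[OF gL gL] eq in \<open>auto elim: eventually_mono\<close>)
  finally show ?thesis by (simp add: H1_norm_def)
qed

lemma grad_diff_le_H1_norm:
  assumes \<phi>: "\<phi> \<in> Cb 2" and \<psi>: "\<psi> \<in> Cb 2"
  shows "L2_norm P (\<lambda>h. path_grad \<phi> h - path_grad \<psi> h)
    \<le> sqrt (area_bound * Z) * H1_norm P (\<lambda>h. \<phi> h - \<psi> h)"
proof -
  let ?g = "\<lambda>h. path_grad \<phi> h - path_grad \<psi> h"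
  have "(L2_norm P ?g)\<^sup>2 \<le> area_bound * form ?g ?g"
    by (intro form_elliptic L2_diff grad_L2 \<phi> \<psi>)
  then have "L2_norm P ?g \<le> sqrt (area_bound * form ?g ?g)"
    by (rule real_le_rsqrt)
  also have "\<dots> = sqrt (area_bound * Z) * sqrt (form ?g ?g / Z)"
    using Z_pos by (simp add: real_sqrt_mult[symmetric])
  finally show ?thesis by (simp add: H1_norm_diff[OF \<phi> \<psi>])
qed

lemma H1_Cb2: "\<Phi> \<in> H1 P \<Longrightarrow> \<Phi> n \<in> Cb 2"
  by (auto simp: H1_def H1_pre_def)

text \<open>By ellipticity the gradients of a Cauchy sequence for \<open>H1_norm\<close> are Cauchy
  in L2. Completeness then provides the limit that \<open>SOME\<close> in \<open>H1_grad\<close> is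
  meant to pick.\<close>

lemma H1_grad_limit:
  assumes \<Phi>: "\<Phi> \<in> H1 P"
  shows "H1_grad P \<Phi> \<in> L2 P" "(\<lambda>n. L2_norm P (\<lambda>h. path_grad (\<Phi> n) h - H1_grad P \<Phi> h)) \<longlonglongrightarrow> 0"
proof -
  note C = H1_Cb2[OF \<Phi>]
  let ?k = "sqrt (area_bound * Z)"
  have k: "0 < ?k" using Z_pos area_bound(1) by simp
  obtain G where G: "G \<in> L2 P" "(\<lambda>n. L2_norm P (\<lambda>h. path_grad (\<Phi> n) h - G h)) \<longlonglongrightarrow> 0"
  proof (rule L2_complete[of "\<lambda>n. path_grad (\<Phi> n)"])
    show "path_grad (\<Phi> n) \<in> L2 P" for n by (rule grad_L2[OF C])
    fix e :: real assume "e > 0"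
    then have "0 < e / ?k" using k by simp
    then obtain N where N: "\<forall>m\<ge>N. \<forall>n\<ge>N. H1_norm P (\<lambda>h. \<Phi> m h - \<Phi> n h) < e / ?k"
      using \<Phi> unfolding H1_def by blast
    have "L2_norm P (\<lambda>h. path_grad (\<Phi> m) h - path_grad (\<Phi> n) h) < e" if "m \<ge> N" "n \<ge> N" for m n
    proof -
      have "?k * H1_norm P (\<lambda>h. \<Phi> m h - \<Phi> n h) < ?k * (e / ?k)"
        using N that k by (intro mult_strict_left_mono) auto
      also have "?k * (e / ?k) = e"
        unfolding times_divide_eq_right by (rule nonzero_mult_div_cancel_left[OF less_imp_neq[OF k, THEN not_sym]])
      finally show ?thesis using grad_diff_le_H1_norm[OF C C, of m n] by linarith
    qed
    then show "\<exists>N. \<forall>m\<ge>N. \<forall>n\<ge>N. L2_norm P (\<lambda>h. path_grad (\<Phi> m) h - path_grad (\<Phi> n) h) < e" by blast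
  qed blast
  have norm_eq: "L2_norm P (\<lambda>h. stoch_grad P (\<Phi> n) h - G h) = L2_norm P (\<lambda>h. path_grad (\<Phi> n) h - G h)"
    if "G \<in> L2 P" for G n
  proof (rule L2_norm_cong_AE)
    show "AE h in P. norm (stoch_grad P (\<Phi> n) h - G h) = norm (path_grad (\<Phi> n) h - G h)"
      using stoch_grad_AE_eq[OF Cb2[OF C[of n]]] by eventually_elim simp
  qed (intro L2_measurable L2_diff stoch_grad_L2[OF Cb2] grad_L2 C that)+
  have "\<exists>G. G \<in> L2 P \<and> (\<lambda>n. L2_norm P (\<lambda>h. stoch_grad P (\<Phi> n) h - G h)) \<longlonglongrightarrow> 0"
    using G norm_eq by auto
  from someI_ex[OF this]
  have s: "H1_grad P \<Phi> \<in> L2 P \<and> (\<lambda>n. L2_norm P (\<lambda>h. stoch_grad P (\<Phi> n) h - H1_grad P \<Phi> h)) \<longlonglongrightarrow> 0"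
    unfolding H1_grad_def .
  then show L: "H1_grad P \<Phi> \<in> L2 P" ..
  show "(\<lambda>n. L2_norm P (\<lambda>h. path_grad (\<Phi> n) h - H1_grad P \<Phi> h)) \<longlonglongrightarrow> 0"
    using s norm_eq[OF L] by simp
qed

text \<open>\<open>H1_dist\<close> is defined by \<open>lim\<close>, which is informative only once
  convergence is known. Continuity of \<open>form\<close> gives the limit, the normalised energy
  norm of the difference of the two gradients, and ellipticity compares it with the L2 norm.\<close>

lemma grad_diff_le_H1_dist:
  assumes \<Phi>: "\<Phi> \<in> H1 P" and \<Psi>: "\<Psi> \<in> H1 P"
  shows "L2_norm P (\<lambda>h. H1_grad P \<Phi> h - H1_grad P \<Psi> h) \<le> sqrt (area_bound * Z) * H1_dist P \<Phi> \<Psi>"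
proof -
  let ?g = "\<lambda>n h. path_grad (\<Phi> n) h - path_grad (\<Psi> n) h" and ?G = "\<lambda>h. H1_grad P \<Phi> h - H1_grad P \<Psi> h"
  note C = H1_Cb2[OF \<Phi>] H1_Cb2[OF \<Psi>]
  note L = grad_L2[OF C(1)] grad_L2[OF C(2)] H1_grad_limit(1)[OF \<Phi>] H1_grad_limit(1)[OF \<Psi>]
  have lim: "(\<lambda>n. L2_norm P (\<lambda>h. ?g n h - ?G h)) \<longlonglongrightarrow> 0"
  proof (rule Lim_null_comparison)
    show "(\<lambda>n. L2_norm P (\<lambda>h. path_grad (\<Phi> n) h - H1_grad P \<Phi> h) + L2_norm P (\<lambda>h. path_grad (\<Psi> n) h - H1_grad P \<Psi> h)) \<longlonglongrightarrow> 0"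
      by (rule tendsto_add_zero[OF H1_grad_limit(2)[OF \<Phi>] H1_grad_limit(2)[OF \<Psi>]])
    have eq: "(\<lambda>h. ?g n h - ?G h)
        = (\<lambda>h. (path_grad (\<Phi> n) h - H1_grad P \<Phi> h) + - (path_grad (\<Psi> n) h - H1_grad P \<Psi> h))" for n
      by (rule ext) simp
    have "L2_norm P (\<lambda>h. ?g n h - ?G h)
        \<le> L2_norm P (\<lambda>h. path_grad (\<Phi> n) h - H1_grad P \<Phi> h) + L2_norm P (\<lambda>h. path_grad (\<Psi> n) h - H1_grad P \<Psi> h)" for n
      using L2_norm_triangle[OF L2_diff[OF L(1,3)] L2_minus[OF L2_diff[OF L(2,4)]], of n n]
      unfolding eq L2_norm_minus .
    then show "\<forall>\<^sub>F n in sequentially. norm (L2_norm P (\<lambda>h. ?g n h - ?G h))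
        \<le> L2_norm P (\<lambda>h. path_grad (\<Phi> n) h - H1_grad P \<Phi> h) + L2_norm P (\<lambda>h. path_grad (\<Psi> n) h - H1_grad P \<Psi> h)"
      by (intro always_eventually allI) simp
  qed
  have GL: "?G \<in> L2 P" by (rule L2_diff[OF L(3,4)])
  have gL: "?g n \<in> L2 P" for n by (rule L2_diff[OF L(1,2)])
  have "(\<lambda>n. sqrt (form (?g n) (?g n) / Z)) \<longlonglongrightarrow> sqrt (form ?G ?G / Z)"
    by (rule tendsto_real_sqrt[OF tendsto_divide[OF form_tendsto[OF gL GL lim gL GL lim] tendsto_const]])
      (use Z_pos in simp)
  then have "(\<lambda>n. H1_norm P (\<lambda>h. \<Phi> n h - \<Psi> n h)) \<longlonglongrightarrow> sqrt (form ?G ?G / Z)"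
    by (simp add: H1_norm_diff[OF C])
  then have dist: "H1_dist P \<Phi> \<Psi> = sqrt (form ?G ?G / Z)"
    unfolding H1_dist_def by (rule limI)
  have "L2_norm P ?G \<le> sqrt (area_bound * form ?G ?G)"
    by (rule real_le_rsqrt[OF form_elliptic[OF GL]])
  also have "\<dots> = sqrt (area_bound * Z) * sqrt (form ?G ?G / Z)"
    using Z_pos by (simp add: real_sqrt_mult[symmetric])
  finally show ?thesis by (simp add: dist)
qed

text \<open>Self-adjointness moves the operator from \<open>u\<close> to the test function, where it
  is the explicit \<open>L_hat\<close>; the domain of \<open>L\<close> need not be known.
  Approximating \<open>u\<close> by the sequence \<open>\<Phi>\<close> then brings in its
  gradient.\<close>

lemma resolvent_weak:
  assumes L: "self_adjoint_extension P L" and res: "resolvent_solution P L e lam u"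
    and rep: "H1_represents P \<Phi> u" and \<phi>: "\<phi> \<in> Cb 2"
  shows "lam * L2_inner (pi_measure P) u \<phi> + form (\<lambda>h. e + H1_grad P \<Phi> h) (path_grad \<phi>) / Z = 0"
proof -
  let ?pi = "pi_measure P"
  from rep have \<Phi>: "\<Phi> \<in> H1 P" and u: "u \<in> L2 ?pi"
    and lim: "(\<lambda>n. L2_norm ?pi (\<lambda>h. \<Phi> n h - u h)) \<longlonglongrightarrow> 0" by (auto simp: H1_represents_def)
  note C = H1_Cb2[OF \<Phi>]
  have CL: "\<psi> \<in> L2 ?pi" if "\<psi> \<in> Cb 2" for \<psi> by (rule L2_imp_L2_pi[OF Cb_L2[OF Cb2[OF that]]])
  have sa: "L \<subseteq> L2 ?pi \<times> L2 ?pi" "adjoint_graph ?pi L = L" "(\<phi>, L_hat P \<phi>) \<in> L"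
    using L \<phi> by (auto simp: self_adjoint_extension_def self_adjoint_def)
  obtain w where w: "(u, w) \<in> L" "AE h in ?pi. lam * u h - w h = drift 0 h \<bullet> e"
    using res by (auto simp: resolvent_solution_def)
  have wL: "w \<in> L2 ?pi" and LL: "L_hat P \<phi> \<in> L2 ?pi" using sa w(1) by auto
  have "(u, w) \<in> adjoint_graph ?pi L" using w(1) sa(2) by simp
  then have adj: "L2_inner ?pi u (L_hat P \<phi>) = L2_inner ?pi w \<phi>"
    using sa(3) by (auto simp: adjoint_graph_def)
  have "(\<lambda>n. L2_inner ?pi (\<Phi> n) (L_hat P \<phi>)) \<longlonglongrightarrow> L2_inner ?pi u (L_hat P \<phi>)"
    unfolding L2_inner_def
    using L2_inner_tendsto_left[of \<Phi> ?pi sequentially u "L_hat P \<phi>"] lim u LL CL[OF C] by simp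
  moreover have "(\<lambda>n. L2_inner ?pi (\<Phi> n) (L_hat P \<phi>)) \<longlonglongrightarrow> - form (H1_grad P \<Phi>) (path_grad \<phi>) / Z"
    unfolding L_hat_form[OF C \<phi> LL]
    by (rule tendsto_divide[OF tendsto_minus[OF form_tendsto_left[OF grad_L2[OF C] H1_grad_limit[OF \<Phi>] grad_L2[OF \<phi>]]] tendsto_const])
      (use Z_pos in simp)
  ultimately have lhs: "L2_inner ?pi u (L_hat P \<phi>) = - form (H1_grad P \<Phi>) (path_grad \<phi>) / Z"
    by (rule LIMSEQ_unique)
  obtain B where BL: "B \<in> L2 P" and Bd: "AE h in P. drift 0 h \<bullet> e = B h / area 0 h"
    and Bf: "\<And>\<phi>. \<phi> \<in> Cb 2 \<Longrightarrow> (LINT h|P. B h * \<phi> h) = - form (\<lambda>h. e) (path_grad \<phi>)"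
    using drift_form[of e] by blast
  note [measurable] = L2_measurable[OF BL]
  have [measurable]: "u \<in> borel_measurable P" "w \<in> borel_measurable P" "\<phi> \<in> borel_measurable P"
    using L2_measurable[OF u] L2_measurable[OF wL] Cb_measurable[OF \<phi>]
    by (simp_all cong: measurable_cong_sets add: sets_pi)
  have "(\<lambda>h. B h / area 0 h) \<in> L2 P"
  proof (rule L2_dominated[OF BL, where C=1])
    show "AE h in P. norm (B h / area 0 h) \<le> 1 * norm (B h)"
    proof (rule AE_I2)
      fix h :: "real^2 \<Rightarrow> real"
      have "\<bar>B h\<bar> / area 0 h \<le> \<bar>B h\<bar> / 1" using area_ge_1[of 0 h] by (intro divide_left_mono) auto
      then show "norm (B h / area 0 h) \<le> 1 * norm (B h)" using area_ge_1[of 0 h] by simp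
    qed
  qed measurable
  then have BpL: "(\<lambda>h. B h / area 0 h) \<in> L2 ?pi" by (rule L2_imp_L2_pi)
  have "AE h in P. w h * \<phi> h = lam * (u h * \<phi> h) - B h / area 0 h * \<phi> h"
    using w(2) Bd unfolding AE_pi
  proof eventually_elim
    case (elim h)
    then have "w h = lam * u h - B h / area 0 h" by linarith
    show ?case unfolding \<open>w h = lam * u h - B h / area 0 h\<close> by (simp only: left_diff_distrib mult.assoc)
  qed
  then have "L2_inner ?pi w \<phi> = (LINT h|?pi. lam * (u h * \<phi> h) - B h / area 0 h * \<phi> h)"
    unfolding L2_inner_def by (intro integral_cong_AE) (auto simp: AE_pi)
  also have "\<dots> = lam * L2_inner ?pi u \<phi> - (LINT h|?pi. B h / area 0 h * \<phi> h)"
    using L2_mult_integrable[OF u CL[OF \<phi>]] L2_mult_integrable[OF BpL CL[OF \<phi>]]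
    by (simp add: L2_inner_def)
  also have "(LINT h|?pi. B h / area 0 h * \<phi> h) = (LINT h|P. area 0 h * (B h / area 0 h * \<phi> h)) / Z"
    by (rule integral_pi) measurable
  also have "(LINT h|P. area 0 h * (B h / area 0 h * \<phi> h)) = (LINT h|P. B h * \<phi> h)"
  proof (rule Bochner_Integration.integral_cong[OF refl])
    fix h :: "real^2 \<Rightarrow> real"
    show "area 0 h * (B h / area 0 h * \<phi> h) = B h * \<phi> h" using area_ge_1[of 0 h] by simp
  qed
  also have "\<dots> = - form (\<lambda>h. e) (path_grad \<phi>)" by (rule Bf[OF \<phi>])
  finally have "L2_inner ?pi w \<phi> = lam * L2_inner ?pi u \<phi> + form (\<lambda>h. e) (path_grad \<phi>) / Z" by simp
  moreover have "form (\<lambda>h. e + H1_grad P \<Phi> h) (path_grad \<phi>)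
      = form (\<lambda>h. e) (path_grad \<phi>) + form (H1_grad P \<Phi>) (path_grad \<phi>)"
    by (rule form_add_left[OF L2_const H1_grad_limit(1)[OF \<Phi>] grad_L2[OF \<phi>]])
  ultimately show ?thesis using adj lhs by (simp add: add_divide_distrib)
qed

text \<open>Test the resolvent equation with its own solution and complete the square.\<close>

lemma resolvent_bound:
  assumes L: "self_adjoint_extension P L" and res: "resolvent_solution P L e lam u"
    and rep: "H1_represents P \<Phi> u"
  shows "lam * (L2_norm (pi_measure P) u)\<^sup>2 \<le> form (\<lambda>h. e) (\<lambda>h. e) / (4 * Z)"
proof -
  let ?pi = "pi_measure P" and ?G = "H1_grad P \<Phi>"
  from rep have \<Phi>: "\<Phi> \<in> H1 P" and u: "u \<in> L2 ?pi"
    and lim: "(\<lambda>n. L2_norm ?pi (\<lambda>h. \<Phi> n h - u h)) \<longlonglongrightarrow> 0" by (auto simp: H1_represents_def)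
  note C = H1_Cb2[OF \<Phi>] and GL = H1_grad_limit(1)[OF \<Phi>]
  have CL: "\<Phi> n \<in> L2 ?pi" for n by (rule L2_imp_L2_pi[OF Cb_L2[OF Cb2[OF C]]])
  have eL: "(\<lambda>h. e) \<in> L2 P" by (rule L2_const)
  have "(\<lambda>n. L2_inner ?pi (\<Phi> n) u) \<longlonglongrightarrow> L2_inner ?pi u u"
    unfolding L2_inner_def
    using L2_inner_tendsto_left[of \<Phi> ?pi sequentially u u] lim u CL by simp
  then have l1: "(\<lambda>n. L2_inner ?pi u (\<Phi> n)) \<longlonglongrightarrow> L2_inner ?pi u u" by (simp add: L2_inner_def mult.commute)
  have l2: "(\<lambda>n. form (path_grad (\<Phi> n)) (\<lambda>h. e + ?G h)) \<longlonglongrightarrow> form ?G (\<lambda>h. e + ?G h)"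
    by (rule form_tendsto_left[OF grad_L2[OF C] H1_grad_limit[OF \<Phi>] L2_add[OF eL GL]])
  have l3: "(\<lambda>n. lam * L2_inner ?pi u (\<Phi> n) + form (path_grad (\<Phi> n)) (\<lambda>h. e + ?G h) / Z)
      \<longlonglongrightarrow> lam * L2_inner ?pi u u + form ?G (\<lambda>h. e + ?G h) / Z"
    by (rule tendsto_add[OF tendsto_mult_left[OF l1] tendsto_divide[OF l2 tendsto_const]]) (use Z_pos in simp)
  have "lam * L2_inner ?pi u (\<Phi> n) + form (path_grad (\<Phi> n)) (\<lambda>h. e + ?G h) / Z = 0" for n
    using resolvent_weak[OF L res rep C[of n]] by (simp only: form_commute[of "path_grad (\<Phi> n)" "\<lambda>h. e + ?G h"])
  then have eq: "lam * L2_inner ?pi u u + form ?G (\<lambda>h. e + ?G h) / Z = 0"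
    using l3 by (simp only: LIMSEQ_const_iff)
  \<comment> \<open>The energy of \<open>e / 2 + G\<close> is nonnegative; expanded, it bounds minus
    the energy product of \<open>G\<close> and \<open>e + G\<close> by a quarter of the energy of
    \<open>e\<close>.\<close>
  let ?h = "\<lambda>h. (1/2) *\<^sub>R e"
  have hL: "?h \<in> L2 P" by (rule L2_const)
  have he: "form ?h H = (1/2) * form (\<lambda>h. e) H" for H by (rule form_scaleR_left[of "1/2" "\<lambda>h. e" H])
  have "0 \<le> form (\<lambda>h. ?h h + ?G h) (\<lambda>h. ?h h + ?G h)" by (rule form_nonneg)
  moreover have "form (\<lambda>h. ?h h + ?G h) (\<lambda>h. ?h h + ?G h) = form ?h (\<lambda>h. ?h h + ?G h) + form ?G (\<lambda>h. ?h h + ?G h)"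
    by (rule form_add_left[OF hL GL L2_add[OF hL GL]])
  moreover have "form ?h (\<lambda>h. ?h h + ?G h) = form ?h ?h + form ?G ?h"
    using form_add_left[OF hL GL hL] form_commute[of "\<lambda>h. ?h h + ?G h" ?h] by (rule trans[OF sym, rotated])
  moreover have "form ?G (\<lambda>h. ?h h + ?G h) = form ?h ?G + form ?G ?G"
    using form_add_left[OF hL GL GL] form_commute[of "\<lambda>h. ?h h + ?G h" ?G] by (rule trans[OF sym, rotated])
  moreover have "form ?G ?h = form ?h ?G" by (rule form_commute)
  moreover have "form ?h ?h = form (\<lambda>h. e) (\<lambda>h. e) / 4"
    using he[of ?h] he[of "\<lambda>h. e"] form_commute[of "\<lambda>h. e" ?h] by linarith
  ultimately have pos: "0 \<le> form (\<lambda>h. e) (\<lambda>h. e) / 4 + form (\<lambda>h. e) ?G + form ?G ?G" using he[of ?G] by linarith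
  have "form ?G (\<lambda>h. e + ?G h) = form (\<lambda>h. e) ?G + form ?G ?G"
    using form_add_left[OF eL GL GL] form_commute[of "\<lambda>h. e + ?G h" ?G] by (rule trans[OF sym, rotated])
  then have "- form ?G (\<lambda>h. e + ?G h) \<le> form (\<lambda>h. e) (\<lambda>h. e) / 4" using pos by simp
  then have "- form ?G (\<lambda>h. e + ?G h) / Z \<le> form (\<lambda>h. e) (\<lambda>h. e) / 4 / Z"
    using Z_pos by (intro divide_right_mono) auto
  moreover have "L2_inner ?pi u u = (L2_norm ?pi u)\<^sup>2"
    by (simp only: L2_inner_def L2_norm_eq) (simp add: power2_eq_square)
  ultimately show ?thesis using eq by simp
qed

text \<open>Let \<open>lam\<close> tend to zero in the weak resolvent equation. The energy bound
  gives \<open>lam * norm u \<le> sqrt (lam * c)\<close>, so the term of order zero disappears, and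
  convergence in \<open>H1\<close> carries the gradients over.\<close>

lemma corrector_equation:
  assumes L: "self_adjoint_extension P L" and X: "is_corrector P L e X" and \<phi>: "\<phi> \<in> Cb 2"
  shows "form (\<lambda>h. e + H1_grad P X h) (path_grad \<phi>) = 0"
proof -
  let ?pi = "pi_measure P" and ?g = "path_grad \<phi>"
  from X obtain u U where XH: "X \<in> H1 P"
    and res: "\<And>lam. lam > 0 \<Longrightarrow> resolvent_solution P L e lam (u lam)"
    and rep: "\<And>lam. lam > 0 \<Longrightarrow> H1_represents P (U lam) (u lam)"
    and conv: "((\<lambda>lam. H1_dist P (U lam) X) \<longlongrightarrow> 0) (at_right 0)"
    unfolding is_corrector_def by blast
  let ?F = "form (\<lambda>h. e + H1_grad P X h) ?g"
  define c where "c = form (\<lambda>h. e) (\<lambda>h. e) / (4 * Z)"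
  \<comment> \<open>The first summand bounds the term of order zero, the second the error from
    replacing the gradient of the resolvent solution by that of the corrector.\<close>
  define b where "b lam = Z * (sqrt (lam * c) * L2_norm ?pi \<phi>)
      + sqrt (area_bound * Z) * H1_dist P (U lam) X * (area_bound * L2_norm P ?g)" for lam
  have eL: "(\<lambda>h. e) \<in> L2 P" by (rule L2_const)
  have gL: "?g \<in> L2 P" by (rule grad_L2[OF \<phi>])
  have \<phi>L: "\<phi> \<in> L2 ?pi" by (rule L2_imp_L2_pi[OF Cb_L2[OF Cb2[OF \<phi>]]])
  have XL: "H1_grad P X \<in> L2 P" by (rule H1_grad_limit(1)[OF XH])
  have bound: "\<bar>?F\<bar> \<le> b lam" if lam: "lam > 0" for lam
  proof -
    let ?G = "H1_grad P (U lam)"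
    have UH: "U lam \<in> H1 P" and uL: "u lam \<in> L2 ?pi" using rep[OF lam] by (auto simp: H1_represents_def)
    have GL: "?G \<in> L2 P" by (rule H1_grad_limit(1)[OF UH])
    have "form (\<lambda>h. e + ?G h) ?g = form (\<lambda>h. e) ?g + form ?G ?g" by (rule form_add_left[OF eL GL gL])
    moreover have "?F = form (\<lambda>h. e) ?g + form (H1_grad P X) ?g" by (rule form_add_left[OF eL XL gL])
    moreover have "form (\<lambda>h. ?G h - H1_grad P X h) ?g = form ?G ?g - form (H1_grad P X) ?g"
      by (rule form_diff_left[OF GL XL gL])
    ultimately have F: "?F = form (\<lambda>h. e + ?G h) ?g - form (\<lambda>h. ?G h - H1_grad P X h) ?g" by simp
    have "form (\<lambda>h. e + ?G h) ?g = - (Z * (lam * L2_inner ?pi (u lam) \<phi>))"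
      using resolvent_weak[OF L res[OF lam] rep[OF lam] \<phi>] Z_pos by (simp add: field_simps)
    moreover have "\<bar>lam * L2_inner ?pi (u lam) \<phi>\<bar> \<le> sqrt (lam * c) * L2_norm ?pi \<phi>"
    proof -
      have "(lam * L2_norm ?pi (u lam))\<^sup>2 = lam * (lam * (L2_norm ?pi (u lam))\<^sup>2)"
        by (simp add: power2_eq_square)
      also have "\<dots> \<le> lam * c"
        unfolding c_def by (rule mult_left_mono[OF resolvent_bound[OF L res[OF lam] rep[OF lam]]]) (use lam in simp)
      finally have "lam * L2_norm ?pi (u lam) \<le> sqrt (lam * c)" by (rule real_le_rsqrt)
      then have 1: "lam * L2_norm ?pi (u lam) * L2_norm ?pi \<phi> \<le> sqrt (lam * c) * L2_norm ?pi \<phi>"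
        by (intro mult_right_mono) auto
      have "\<bar>L2_inner ?pi (u lam) \<phi>\<bar> \<le> L2_norm ?pi (u lam) * L2_norm ?pi \<phi>"
        using L2_Cauchy_Schwarz[OF uL \<phi>L] by (simp add: L2_inner_def)
      then have 2: "lam * \<bar>L2_inner ?pi (u lam) \<phi>\<bar> \<le> lam * (L2_norm ?pi (u lam) * L2_norm ?pi \<phi>)"
        using lam by (intro mult_left_mono) auto
      have "\<bar>lam * L2_inner ?pi (u lam) \<phi>\<bar> = lam * \<bar>L2_inner ?pi (u lam) \<phi>\<bar>"
        using lam by (simp add: abs_mult)
      then show ?thesis using order_trans[OF 2 1[unfolded mult.assoc]] by (simp only:)
    qed
    ultimately have 1: "\<bar>form (\<lambda>h. e + ?G h) ?g\<bar> \<le> Z * (sqrt (lam * c) * L2_norm ?pi \<phi>)"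
      using Z_pos by (simp add: abs_mult)
    have "\<bar>form (\<lambda>h. ?G h - H1_grad P X h) ?g\<bar> \<le> L2_norm P (\<lambda>h. ?G h - H1_grad P X h) * L2_norm P (\<lambda>h. coef h *v ?g h)"
      unfolding form_def by (intro L2_Cauchy_Schwarz L2_diff GL XL coef_mult_L2 gL)
    also have "\<dots> \<le> sqrt (area_bound * Z) * H1_dist P (U lam) X * (area_bound * L2_norm P ?g)"
      by (rule mult_mono'[OF grad_diff_le_H1_dist[OF UH XH] coef_mult_L2(2)[OF gL]]) auto
    finally show ?thesis unfolding F b_def using 1 by linarith
  qed
  have "(b \<longlongrightarrow> Z * (sqrt (0 * c) * L2_norm ?pi \<phi>) + sqrt (area_bound * Z) * 0 * (area_bound * L2_norm P ?g)) (at_right 0)"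
    unfolding b_def[abs_def] by (intro tendsto_intros conv)
  then have "(b \<longlongrightarrow> 0) (at_right 0)" by simp
  moreover have "\<forall>\<^sub>F lam in at_right 0. \<bar>?F\<bar> \<le> b lam"
    using eventually_at_right_less[of "0::real"] by eventually_elim (rule bound)
  ultimately have "\<bar>?F\<bar> \<le> 0" by (rule tendsto_lowerbound) simp
  then show ?thesis by simp
qed

section \<open>The determinant of the effective tensor\<close>

text \<open>For smooth functions the determinant of \<open>axis 1 1 + path_grad (\<Phi> n)\<close>
  and \<open>axis 2 1 + path_grad (\<Psi> n)\<close> expands into 1, derivatives of mean zero, and
  two mixed products with equal means. The identity passes to L2 limits because the determinant is
  bilinear.\<close>

lemma potential_determinant:
  assumes \<Phi>: "\<Phi> \<in> H1 P" and \<Psi>: "\<Psi> \<in> H1 P"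
  shows "(LINT h|P. (1 + H1_grad P \<Phi> h $ 1) * (1 + H1_grad P \<Psi> h $ 2) - H1_grad P \<Phi> h $ 2 * H1_grad P \<Psi> h $ 1) = 1"
proof -
  note C = H1_Cb2[OF \<Phi>] H1_Cb2[OF \<Psi>]
  let ?A = "\<lambda>n h. 1 + path_grad (\<Phi> n) h $ 1" and ?B = "\<lambda>n h. 1 + path_grad (\<Psi> n) h $ 2"
  have gL: "(\<lambda>h. path_grad (\<Phi> n) h $ i) \<in> L2 P" "(\<lambda>h. path_grad (\<Psi> n) h $ i) \<in> L2 P" for n i
    by (rule L2_component[OF grad_L2[OF C(1)]], rule L2_component[OF grad_L2[OF C(2)]])
  have GL: "(\<lambda>h. H1_grad P \<Phi> h $ i) \<in> L2 P" "(\<lambda>h. H1_grad P \<Psi> h $ i) \<in> L2 P" for i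
    by (rule L2_component[OF H1_grad_limit(1)[OF \<Phi>]], rule L2_component[OF H1_grad_limit(1)[OF \<Psi>]])
  have lim: "(\<lambda>n. L2_norm P (\<lambda>h. path_grad (\<Phi> n) h $ i - H1_grad P \<Phi> h $ i)) \<longlonglongrightarrow> 0"
    "(\<lambda>n. L2_norm P (\<lambda>h. path_grad (\<Psi> n) h $ i - H1_grad P \<Psi> h $ i)) \<longlonglongrightarrow> 0" for i
    by (rule L2_norm_component_tendsto[OF grad_L2[OF C(1)] H1_grad_limit[OF \<Phi>]],
        rule L2_norm_component_tendsto[OF grad_L2[OF C(2)] H1_grad_limit[OF \<Psi>]])
  have one: "(\<lambda>h. 1::real) \<in> L2 P" by (rule L2_const)
  have la: "(\<lambda>n. L2_norm P (\<lambda>h. ?A n h - (1 + H1_grad P \<Phi> h $ 1))) \<longlonglongrightarrow> 0"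
    and lb: "(\<lambda>n. L2_norm P (\<lambda>h. ?B n h - (1 + H1_grad P \<Psi> h $ 2))) \<longlonglongrightarrow> 0"
    unfolding add_diff_cancel_left by (rule lim)+
  have l1: "(\<lambda>n. LINT h|P. ?A n h \<bullet> ?B n h) \<longlonglongrightarrow> (LINT h|P. (1 + H1_grad P \<Phi> h $ 1) \<bullet> (1 + H1_grad P \<Psi> h $ 2))"
    by (intro L2_inner_tendsto always_eventually allI L2_add one gL GL la lb)
  have l2: "(\<lambda>n. LINT h|P. path_grad (\<Phi> n) h $ 2 \<bullet> path_grad (\<Psi> n) h $ 1)
      \<longlonglongrightarrow> (LINT h|P. H1_grad P \<Phi> h $ 2 \<bullet> H1_grad P \<Psi> h $ 1)"
    by (intro L2_inner_tendsto always_eventually allI gL GL lim)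
  have one_n: "(LINT h|P. ?A n h \<bullet> ?B n h) - (LINT h|P. path_grad (\<Phi> n) h $ 2 \<bullet> path_grad (\<Psi> n) h $ 1) = 1" for n
  proof -
    note d = Cb_has_stoch_deriv[OF Cb2[OF C(1)]] Cb_has_stoch_deriv[OF Cb2[OF C(2)]]
    have mz: "(LINT h|P. path_deriv i (\<Phi> n) h) = 0" "(LINT h|P. path_deriv i (\<Psi> n) h) = 0" for i
      by (rule has_stoch_deriv_mean_zero[OF d(1)], rule has_stoch_deriv_mean_zero[OF d(2)])
    have ig: "integrable P (path_deriv i (\<Phi> n))" "integrable P (path_deriv i (\<Psi> n))" for i
      using L2_integrable[OF gL(1)] L2_integrable[OF gL(2)] by simp_all
    have im: "integrable P (\<lambda>h. path_deriv i (\<Phi> n) h * path_deriv j (\<Psi> n) h)" for i j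
      using L2_mult_integrable[OF gL(1) gL(2)] by simp
    have "(LINT h|P. ?A n h \<bullet> ?B n h)
        = (LINT h|P. 1 + path_deriv 1 (\<Phi> n) h + path_deriv 2 (\<Psi> n) h + path_deriv 1 (\<Phi> n) h * path_deriv 2 (\<Psi> n) h)"
      by (rule Bochner_Integration.integral_cong[OF refl]) (simp add: algebra_simps)
    also have "\<dots> = 1 + (LINT h|P. path_deriv 1 (\<Phi> n) h * path_deriv 2 (\<Psi> n) h)"
      using ig im by (simp add: mz prob_space)
    also have "(LINT h|P. path_deriv 1 (\<Phi> n) h * path_deriv 2 (\<Psi> n) h) = (LINT h|P. path_deriv 2 (\<Phi> n) h * path_deriv 1 (\<Psi> n) h)"
      by (rule has_stoch_deriv_by_parts_mixed[OF d(1) d(1) d(2) d(2)])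
    finally show ?thesis by (simp only: path_grad_component inner_real_def add_diff_cancel_right')
  qed
  have "1 = (LINT h|P. (1 + H1_grad P \<Phi> h $ 1) * (1 + H1_grad P \<Psi> h $ 2)) - (LINT h|P. H1_grad P \<Phi> h $ 2 * H1_grad P \<Psi> h $ 1)"
    using tendsto_diff[OF l1 l2] unfolding one_n unfolding LIMSEQ_const_iff inner_real_def .
  moreover have "integrable P (\<lambda>h. (1 + H1_grad P \<Phi> h $ 1) * (1 + H1_grad P \<Psi> h $ 2))"
    by (rule L2_mult_integrable[OF L2_add[OF one GL(1)] L2_add[OF one GL(2)]])
  ultimately show ?thesis
    using Bochner_Integration.integral_diff[OF _ L2_mult_integrable[OF GL(1) GL(2)], of _ 2 1] by simp
qed

end

locale planar_corrector = planar_surface P for P +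
  fixes L X
  assumes self_adjoint_ext: "self_adjoint_extension P L"
    and corrector: "\<And>i. is_corrector P L (axis i 1) (X i)"
begin

abbreviation G where "G i \<equiv> H1_grad P (X i)"

definition \<xi> where "\<xi> i h = axis i 1 + G i h"

lemma X_H1: "X i \<in> H1 P"
  using corrector by (simp add: is_corrector_def)

lemma G_L2: "G i \<in> L2 P"
  by (rule H1_grad_limit(1)[OF X_H1])

lemma \<xi>_eq: "\<xi> i = (\<lambda>h. axis i 1 + G i h)"
  by (rule ext) (simp only: \<xi>_def)

lemma \<xi>_L2: "\<xi> i \<in> L2 P"
  unfolding \<xi>_eq by (rule L2_add[OF L2_const G_L2])

lemma form_\<xi>_grad: "\<phi> \<in> Cb 2 \<Longrightarrow> form (\<xi> i) (path_grad \<phi>) = 0"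
  unfolding \<xi>_eq by (rule corrector_equation[OF self_adjoint_ext corrector])

text \<open>The corrector equation extends from gradients of test functions to their L2 limits, in
  particular to the gradients of the correctors themselves.\<close>

lemma form_G_\<xi>: "form (G j) (\<xi> i) = 0"
proof -
  have "(\<lambda>n. form (path_grad (X j n)) (\<xi> i)) \<longlonglongrightarrow> form (G j) (\<xi> i)"
    by (rule form_tendsto_left[OF grad_L2[OF H1_Cb2[OF X_H1]] G_L2 H1_grad_limit(2)[OF X_H1] \<xi>_L2])
  moreover have "form (path_grad (X j n)) (\<xi> i) = 0" for n
    by (rule trans[OF form_commute form_\<xi>_grad[OF H1_Cb2[OF X_H1]]])
  ultimately show ?thesis by (simp only: LIMSEQ_const_iff)
qed

lemma effective_tensor_nth: "effective_tensor P X $ i $ j = form (\<xi> i) (\<xi> j) / Z"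
proof -
  define N :: "(real^2 \<Rightarrow> real) \<Rightarrow> real^2^2" where "N h = mat 1 + (\<chi> i j. G i h $ j)" for h
  define M where "M h = area 0 h *\<^sub>R (N h ** matrix_inv (metric_g 0 h) ** transpose (N h))" for h
  have N: "N h $ i $ k = \<xi> i h $ k" for h i k
    by (auto simp: N_def \<xi>_def mat_def axis_def)
  have "(a *\<^sub>R (N h ** B ** transpose (N h))) $ i $ j = \<xi> i h \<bullet> ((a *\<^sub>R B) *v \<xi> j h)" for h i j a B
    by (simp add: matrix_matrix_mult_def transpose_def N matrix_vector_mult_def inner_vec_def sum_2 algebra_simps)
  then have M: "M h $ i $ j = \<xi> i h \<bullet> (coef h *v \<xi> j h)" for h i j
    unfolding M_def coef_def .
  \<comment> \<open>Entries can be taken under the matrix-valued integral only for an integrable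
    integrand; integrability is checked entry by entry.\<close>
  have int: "integrable P M"
  proof -
    have "integrable P (\<lambda>h. \<Sum>b\<in>Basis. (M h \<bullet> b) *\<^sub>R b)"
    proof (intro Bochner_Integration.integrable_sum integrable_scaleR_left)
      fix b :: "real^2^2" assume "b \<in> Basis"
      then obtain i j where b: "b = axis i (axis j 1)" by (auto simp: Basis_vec_def)
      have "integrable P (\<lambda>h. M h $ i $ j)" unfolding M by (rule form_integrable[OF \<xi>_L2 \<xi>_L2])
      then show "integrable P (\<lambda>h. M h \<bullet> b)" by (simp only: b inner_axis inner_real_def mult_1_right)
    qed
    then show ?thesis by (simp only: euclidean_representation)
  qed
  have "(LINT h|P. M h) \<bullet> axis i (axis j 1) = (LINT h|P. M h \<bullet> axis i (axis j 1))"
    by (rule integral_inner_left[symmetric]) (rule int)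
  then have "(LINT h|P. M h) $ i $ j = (LINT h|P. M h $ i $ j)"
    by (simp only: inner_axis inner_real_def mult_1_right)
  moreover have "effective_tensor P X = (1 / Z) *\<^sub>R (LINT h|P. M h)"
    unfolding effective_tensor_def Let_def M_def N_def ..
  ultimately show ?thesis
    unfolding M form_def by (simp only: vector_scaleR_component) simp
qed

text \<open>The fluctuation \<open>G j\<close> is orthogonal to the flux of \<open>\<xi> i\<close>,
  so in the energy product of \<open>\<xi> j\<close> and \<open>\<xi> i\<close> the first factor may
  be replaced by its mean \<open>axis j 1\<close>.\<close>

lemma flux_mean: "(LINT h|P. (coef h *v \<xi> i h) $ j) = Z * effective_tensor P X $ j $ i"
proof -
  have "(LINT h|P. (coef h *v \<xi> i h) $ j) = form (\<lambda>h. axis j 1) (\<xi> i)"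
    by (simp add: form_def inner_axis')
  moreover have "form (\<xi> j) (\<xi> i) = form (\<lambda>h. axis j 1) (\<xi> i) + form (G j) (\<xi> i)"
    using form_add_left[OF L2_const G_L2 \<xi>_L2] unfolding \<xi>_eq[of j] .
  ultimately show ?thesis using Z_pos by (simp add: form_G_\<xi> effective_tensor_nth)
qed

lemma det_effective_tensor: "det (effective_tensor P X) = 1 / Z\<^sup>2"
proof -
  let ?q = "\<lambda>i h. coef h *v \<xi> i h" and ?D = "effective_tensor P X"
  have orth: "(LINT h|P. ?q i h \<bullet> path_grad \<phi> h) = 0" if "\<phi> \<in> Cb 2" for \<phi> i
    using form_\<xi>_grad[OF that, of i] by (simp only: form_def coef_sym)
  have "(LINT h|P. ?q 1 h $ 1 * ?q 2 h $ 2 - ?q 1 h $ 2 * ?q 2 h $ 1)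
      = (LINT h|P. ?q 1 h $ 1) * (LINT h|P. ?q 2 h $ 2) - (LINT h|P. ?q 1 h $ 2) * (LINT h|P. ?q 2 h $ 1)"
    by (rule solenoidal_determinant[OF coef_mult_L2(1)[OF \<xi>_L2] orth coef_mult_L2(1)[OF \<xi>_L2] orth])
  also have "\<dots> = Z\<^sup>2 * det ?D"
    unfolding flux_mean det_2 by (simp add: power2_eq_square algebra_simps)
  finally have "Z\<^sup>2 * det ?D = (LINT h|P. \<xi> 1 h $ 1 * \<xi> 2 h $ 2 - \<xi> 1 h $ 2 * \<xi> 2 h $ 1)"
    unfolding coef_determinant by (rule sym)
  also have "\<dots> = (LINT h|P. (1 + G 1 h $ 1) * (1 + G 2 h $ 2) - G 1 h $ 2 * G 2 h $ 1)"
    by (simp add: \<xi>_def axis_def)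
  also have "\<dots> = 1" by (rule potential_determinant[OF X_H1 X_H1])
  finally show ?thesis using Z_pos by (simp add: field_simps)
qed

text \<open>The combination \<open>\<zeta>\<close> of the fields \<open>\<xi> 1\<close> and
  \<open>\<xi> 2\<close> with coefficients \<open>v\<close> is \<open>v + H\<close> with
  \<open>H\<close> orthogonal to \<open>\<zeta>\<close> in energy. By Pythagoras its energy is at
  most that of the constant field \<open>v\<close>, which is estimated pointwise by
  \<open>coef_upper\<close>.\<close>

lemma effective_tensor_quadratic:
  "0 \<le> v \<bullet> (effective_tensor P X *v v)" "v \<bullet> (effective_tensor P X *v v) \<le> v \<bullet> v"
proof -
  let ?D = "effective_tensor P X"
  define H where "H = (\<lambda>h. v $ 1 *\<^sub>R G 1 h + v $ 2 *\<^sub>R G 2 h)"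
  define \<zeta> where "\<zeta> = (\<lambda>h. v $ 1 *\<^sub>R \<xi> 1 h + v $ 2 *\<^sub>R \<xi> 2 h)"
  have HL: "H \<in> L2 P" unfolding H_def by (intro L2_add L2_scaleR G_L2)
  have \<zeta>L: "\<zeta> \<in> L2 P" unfolding \<zeta>_def by (intro L2_add L2_scaleR \<xi>_L2)
  have vL: "(\<lambda>h. v) \<in> L2 P" by (rule L2_const)
  have lin: "form (\<lambda>h. v $ 1 *\<^sub>R A h + v $ 2 *\<^sub>R B h) C = v $ 1 * form A C + v $ 2 * form B C"
    if "A \<in> L2 P" "B \<in> L2 P" "C \<in> L2 P" for A B C
    using form_add_left[OF L2_scaleR[OF that(1), of "v $ 1"] L2_scaleR[OF that(2), of "v $ 2"] that(3)]
    unfolding form_scaleR_left .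
  have lin_\<zeta>: "form \<zeta> C = v $ 1 * form (\<xi> 1) C + v $ 2 * form (\<xi> 2) C" if "C \<in> L2 P" for C
    unfolding \<zeta>_def by (rule lin[OF \<xi>_L2 \<xi>_L2 that])
  have "form (\<xi> i) (G k) = 0" for i k by (rule trans[OF form_commute form_G_\<xi>])
  then have \<zeta>G: "form \<zeta> (G k) = 0" for k using lin_\<zeta>[OF G_L2, of k] by simp
  have G\<zeta>: "form (G k) \<zeta> = 0" for k by (rule trans[OF form_commute \<zeta>G])
  have "form H \<zeta> = v $ 1 * form (G 1) \<zeta> + v $ 2 * form (G 2) \<zeta>"
    unfolding H_def by (rule lin[OF G_L2 G_L2 \<zeta>L])
  then have H\<zeta>: "form H \<zeta> = 0" by (simp add: G\<zeta>)
  have "form \<zeta> \<zeta> = Z * (v \<bullet> (?D *v v))"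
  proof -
    have \<xi>\<zeta>: "form (\<xi> i) \<zeta> = v $ 1 * form (\<xi> 1) (\<xi> i) + v $ 2 * form (\<xi> 2) (\<xi> i)" for i
      by (rule trans[OF form_commute lin_\<zeta>[OF \<xi>_L2]])
    have sym: "form (\<xi> 2) (\<xi> 1) = form (\<xi> 1) (\<xi> 2)" by (rule form_commute)
    show ?thesis
      using Z_pos unfolding lin_\<zeta>[OF \<zeta>L] \<xi>\<zeta>
      by (simp add: inner_vec_def sum_2 matrix_vector_mult_def effective_tensor_nth sym field_simps)
  qed
  then have eq: "v \<bullet> (?D *v v) = form \<zeta> \<zeta> / Z" using Z_pos by simp
  show "0 \<le> v \<bullet> (?D *v v)" unfolding eq using form_nonneg Z_pos by simp
  have \<zeta>: "\<zeta> = (\<lambda>h. v + H h)"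
    by (rule ext) (simp add: \<zeta>_def H_def \<xi>_def vec_eq_iff forall_2 axis_def algebra_simps)
  have split: "form \<zeta> C = form (\<lambda>h. v) C + form H C" if "C \<in> L2 P" for C
    by (subst \<zeta>) (rule form_add_left[OF vL HL that])
  have "form \<zeta> \<zeta> \<le> form (\<lambda>h. v) (\<lambda>h. v)"
    using split[OF \<zeta>L] split[OF vL] split[OF HL] H\<zeta> form_nonneg[of H]
      form_commute[of "\<lambda>h. v" \<zeta>] form_commute[of \<zeta> H] form_commute[of "\<lambda>h. v" H] by linarith
  also have "\<dots> \<le> (LINT h|P. area 0 h * (v \<bullet> v))"
    unfolding form_def
    by (rule integral_mono[OF form_integrable[OF vL vL] _ coef_upper]) (use area_integrable in simp)
  also have "\<dots> = Z * (v \<bullet> v)" by (simp add: Zconst_def)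
  finally show "v \<bullet> (?D *v v) \<le> v \<bullet> v" unfolding eq pos_divide_le_eq[OF Z_pos] by (simp only: mult.commute)
qed

end

section \<open>Eigenvalues of a two by two matrix\<close>

lemma eigenvalue_iff_2:
  fixes A :: "real^2^2"
  shows "c \<in> eigenvalues A \<longleftrightarrow> c\<^sup>2 - (A $ 1 $ 1 + A $ 2 $ 2) * c + det A = 0"
proof -
  let ?B = "A - c *\<^sub>R mat 1"
  have "c \<in> eigenvalues A \<longleftrightarrow> (\<exists>v. v \<noteq> 0 \<and> ?B *v v = 0)"
    by (simp add: eigenvalues_def matrix_vector_mult_diff_rdistrib scaleR_matrix_vector_assoc[symmetric])
  also have "\<dots> \<longleftrightarrow> \<not> invertible ?B"
    by (auto simp: invertible_left_inverse matrix_left_invertible_ker)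
  also have "\<dots> \<longleftrightarrow> det ?B = 0" by (simp add: invertible_det_nz)
  also have "det ?B = c\<^sup>2 - (A $ 1 $ 1 + A $ 2 $ 2) * c + det A"
    by (simp add: det_2 mat_def power2_eq_square algebra_simps)
  finally show ?thesis .
qed

text \<open>The set \<open>{a, b}\<close> does not record multiplicities. With \<open>T\<close> the
  trace, \<open>T - a\<close> is again a root, hence \<open>a\<close> or \<open>b\<close>; it
  remains to see that \<open>T - a = a\<close> leaves room for no other root.\<close>

lemma eigenvalues_2_prod:
  fixes A :: "real^2^2"
  assumes "eigenvalues A = {a, b}"
  shows "a * b = det A"
proof -
  define T where "T = A $ 1 $ 1 + A $ 2 $ 2"
  have root: "c\<^sup>2 - T * c + det A = 0 \<longleftrightarrow> c = a \<or> c = b" for c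
    using eigenvalue_iff_2[of c A] assms unfolding T_def by simp
  have a: "a\<^sup>2 - T * a + det A = 0" and b: "b\<^sup>2 - T * b + det A = 0" using root by blast+
  have "(T - a)\<^sup>2 - T * (T - a) + det A = a\<^sup>2 - T * a + det A"
    by (simp add: power2_eq_square algebra_simps)
  then have "(T - a)\<^sup>2 - T * (T - a) + det A = 0" using a by simp
  then have "T - a = a \<or> T - a = b" using root by blast
  moreover have "a = b" if "T - a = a"
  proof -
    \<comment> \<open>For \<open>T = 2 * a\<close> the characteristic polynomial is a perfect
      square, so its root \<open>b\<close> must coincide with \<open>a\<close>.\<close>
    have "(b - a)\<^sup>2 = (b\<^sup>2 - T * b + det A) - (a\<^sup>2 - T * a + det A) + (2 * a - T) * (a - b)"
      by (simp add: power2_eq_square algebra_simps)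
    then have "(b - a)\<^sup>2 = 0" using a b that by simp
    then show ?thesis by simp
  qed
  ultimately have b_eq: "b = T - a" by linarith
  have "a * (T - a) = T * a - a\<^sup>2" by (simp add: power2_eq_square algebra_simps)
  then show ?thesis using a unfolding b_eq by linarith
qed

theorem theorem6p1:
  fixes P :: "(real^2 \<Rightarrow> real) measure" and D :: "real^2^2"
  assumes "admissible P" and "is_effective_tensor P D"
  shows "det D = 1 / (Zconst P)\<^sup>2 \<and>
    (\<forall>l1 l2. l1 \<le> l2 \<and> eigenvalues D = {l1, l2} \<longrightarrow>
       1 / (Zconst P)\<^sup>2 \<le> l1 \<and> l1 \<le> 1 / Zconst P \<and> 1 / Zconst P \<le> l2 \<and> l2 \<le> 1) \<and>
    ((\<exists>c. D = c *\<^sub>R mat 1) \<longrightarrow> D = (1 / Zconst P) *\<^sub>R mat 1)"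
proof -
  obtain L X where L: "self_adjoint_extension P L" and X: "\<And>i. is_corrector P L (axis i 1) (X i)"
    and D: "D = effective_tensor P X"
    using assms(2) unfolding is_effective_tensor_def by blast
  interpret planar_corrector P L X
    by unfold_locales (use assms(1) L X in auto)
  have det: "det D = 1 / Z\<^sup>2" unfolding D by (rule det_effective_tensor)
  note quad = effective_tensor_quadratic[folded D]
  have eig: "1 / Z\<^sup>2 \<le> l1 \<and> l1 \<le> 1 / Z \<and> 1 / Z \<le> l2 \<and> l2 \<le> 1"
    if l: "l1 \<le> l2" "eigenvalues D = {l1, l2}" for l1 l2
  proof -
    have range: "0 \<le> c" "c \<le> 1" if c: "c \<in> eigenvalues D" for c
    proof -
      obtain v where v: "v \<noteq> 0" "D *v v = c *\<^sub>R v" using c by (auto simp: eigenvalues_def)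
      have "0 < v \<bullet> v" using v(1) by simp
      have q: "0 \<le> c * (v \<bullet> v)" "c * (v \<bullet> v) \<le> 1 * (v \<bullet> v)"
        using quad[of v] unfolding v(2) inner_scaleR_right mult_1 .
      show "0 \<le> c" using q(1) \<open>0 < v \<bullet> v\<close> unfolding zero_le_mult_iff by linarith
      show "c \<le> 1" using q(2) unfolding mult_le_cancel_right_pos[OF \<open>0 < v \<bullet> v\<close>] .
    qed
    have r: "0 \<le> l1" "l2 \<le> 1" using range l(2) by auto
    have prod: "l1 * l2 = (1 / Z)\<^sup>2" unfolding power_divide power_one by (rule trans[OF eigenvalues_2_prod[OF l(2)] det])
    \<comment> \<open>The product of the eigenvalues is fixed, so the upper bound on the larger one
      is a lower bound on the smaller one.\<close>
    have "l1 * l2 \<le> l1 * 1" using r by (intro mult_left_mono) auto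
    then have low: "1 / Z\<^sup>2 \<le> l1" unfolding prod by (simp add: power_divide)
    have "l1\<^sup>2 \<le> l1 * l2" "l1 * l2 \<le> l2\<^sup>2"
      unfolding power2_eq_square using r l(1) by (auto intro: mult_left_mono mult_right_mono)
    then have sq: "l1\<^sup>2 \<le> (1 / Z)\<^sup>2" "(1 / Z)\<^sup>2 \<le> l2\<^sup>2" unfolding prod .
    have "l1 \<le> 1 / Z" by (rule power2_le_imp_le[OF sq(1)]) (use Z_pos in simp)
    moreover have "1 / Z \<le> l2" by (rule power2_le_imp_le[OF sq(2)]) (use r l(1) in linarith)
    ultimately show ?thesis using low r by blast
  qed
  have iso: "D = (1 / Z) *\<^sub>R mat 1" if c: "D = c *\<^sub>R mat 1" for c
  proof -
    have "c\<^sup>2 = (1 / Z)\<^sup>2"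
    proof -
      have "det D = c * c" unfolding c by (simp add: det_2 mat_def)
      then show ?thesis using det by (simp only: power_divide power_one power2_eq_square[of c])
    qed
    \<comment> \<open>The determinant fixes \<open>c\<close> only up to sign; nonnegativity of the
      quadratic form excludes \<open>- 1 / Z\<close>.\<close>
    moreover have "0 \<le> c"
      using quad(1)[of "axis 1 1"] unfolding c
      by (simp add: scaleR_matrix_vector_assoc[symmetric] inner_axis_axis)
    ultimately have "c = 1 / Z" using Z_pos by (simp only: power2_eq_iff_nonneg zero_le_divide_1_iff less_imp_le)
    then show ?thesis using c by simp
  qed
  show ?thesis using det eig iso by blast
qed

end
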